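(* Let $M$ be an endo-$p$-permutation $kG$-module. Then $M$ is strongly capped if and only if $M$ is a capped Dade module with a unique copy of its cap (i.e. the cap of $M$ occurs with multiplicity one in a decomposition of $M$ into indecomposable summands).
   Context: $G$ is a finite group, $p$ a prime, $S$ a Sylow $p$-subgroup of $G$, $k$ an algebraically closed field of characteristic $p$. All $kG$-modules are finitely generated. A component of a module is an indecomposable direct summand. A $p$-permutation $kG$-module is a direct summand of a permutation $kG$-module; $M$ is an endo-$p$-permutation module if $\mathrm{End}(M)\cong M^*\otimes_k M$ is a $p$-permutation module. A $kG$-module $M$ is a Dade $kG$-module if $\mathrm{End}(M)\cong k^n\oplus W$ for some integer $n\ge 0$ and some $p$-permutation module $W$ all of whose components have non-Sylow vertices. It is capped if it has a component with vertex $S$; such a component of a capped Dade module is unique up to isomorphism and is called the cap of $M$. For a $kG$-module $V$, a module $N$ is $V$-projective if it is a direct summand of $V\otimes L$ for some $kG$-module $L$. Let $\mathcal F_G$ be the set of non-Sylow $p$-subgroups of $G$ and $V(\mathcal F_G):=\bigoplus_{[Q]\in\mathcal F_G/G}k[G/Q]$ (sum over $G$-conjugacy classes). An endo-$p$-permutation module $M$ is strongly capped if it is $V(\mathcal F_G)$-endotrivial, i.e. $\mathrm{End}(M)\cong k\oplus W$ for some $V(\mathcal F_G)$-projective $kG$-module $W$. *)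

theory Defs
  imports
    "HOL-Algebra.Algebra"
    "HOL-Computational_Algebra.Computational_Algebra"
    "Jordan_Normal_Form.Matrix"
begin

section \<open>Finitely generated modules over a group algebra\<close>

text \<open>
  For a finite group \<open>G\<close> and a field \<open>k\<close>, a finitely generated \<open>kG\<close>-module is the same as a
  finite-dimensional \<open>k\<close>-linear representation of \<open>G\<close>.  It is given here in coordinates: a
  dimension \<open>n\<close> together with the matrices by which the group elements act on \<open>k\<^sup>n\<close> from the
  left.  The zero module is the case \<open>n = 0\<close>.  The matrices attached to elements outside of
  the carrier of the group are irrelevant.
\<close>

record ('g, 'k) kG_module =
  mdim :: nat
  act :: "'g \<Rightarrow> 'k mat"

definition is_kG_module :: "('g, 'b) monoid_scheme \<Rightarrow> ('g, 'k::field) kG_module \<Rightarrow> bool" where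
  "is_kG_module G M \<longleftrightarrow>
     (\<forall>g\<in>carrier G. act M g \<in> carrier_mat (mdim M) (mdim M)) \<and>
     act M \<one>\<^bsub>G\<^esub> = 1\<^sub>m (mdim M) \<and>
     (\<forall>g\<in>carrier G. \<forall>h\<in>carrier G. act M (g \<otimes>\<^bsub>G\<^esub> h) = act M g * act M h)"

definition kG_iso ::
  "('g, 'b) monoid_scheme \<Rightarrow> ('g, 'k::field) kG_module \<Rightarrow> ('g, 'k) kG_module \<Rightarrow> bool" where
  "kG_iso G M N \<longleftrightarrow>
     mdim M = mdim N \<and>
     (\<exists>P\<in>carrier_mat (mdim N) (mdim M). invertible_mat P \<and>
        (\<forall>g\<in>carrier G. P * act M g = act N g * P))"

definition direct_sum :: "('g, 'k::field) kG_module list \<Rightarrow> ('g, 'k) kG_module" where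
  "direct_sum Ms =
     \<lparr>mdim = sum_list (map mdim Ms), act = (\<lambda>g. diag_block_mat (map (\<lambda>M. act M g) Ms))\<rparr>"

definition trivial_module :: "nat \<Rightarrow> ('g, 'k::field) kG_module" where
  "trivial_module n = \<lparr>mdim = n, act = (\<lambda>g. 1\<^sub>m n)\<rparr>"

definition kronecker :: "'k::field mat \<Rightarrow> 'k mat \<Rightarrow> 'k mat" where
  "kronecker A B =
     mat (dim_row A * dim_row B) (dim_col A * dim_col B)
       (\<lambda>(i, j). A $$ (i div dim_row B, j div dim_col B) * B $$ (i mod dim_row B, j mod dim_col B))"

definition tensor_module ::
  "('g, 'k::field) kG_module \<Rightarrow> ('g, 'k) kG_module \<Rightarrow> ('g, 'k) kG_module" where
  "tensor_module M N = \<lparr>mdim = mdim M * mdim N, act = (\<lambda>g. kronecker (act M g) (act N g))\<rparr>"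

definition dual_module ::
  "('g, 'b) monoid_scheme \<Rightarrow> ('g, 'k::field) kG_module \<Rightarrow> ('g, 'k) kG_module" where
  "dual_module G M = \<lparr>mdim = mdim M, act = (\<lambda>g. transpose_mat (act M (inv\<^bsub>G\<^esub> g)))\<rparr>"

text \<open>The \<open>k\<close>-linear (not \<open>kG\<close>-linear) endomorphisms of \<open>M\<close>, realised as \<open>M\<^sup>* \<otimes> M\<close>.\<close>

definition End_module ::
  "('g, 'b) monoid_scheme \<Rightarrow> ('g, 'k::field) kG_module \<Rightarrow> ('g, 'k) kG_module" where
  "End_module G M = tensor_module (dual_module G M) M"

definition direct_summand ::
  "('g, 'b) monoid_scheme \<Rightarrow> ('g, 'k::field) kG_module \<Rightarrow> ('g, 'k) kG_module \<Rightarrow> bool" where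
  "direct_summand G N M \<longleftrightarrow>
     is_kG_module G N \<and> (\<exists>N'. is_kG_module G N' \<and> kG_iso G M (direct_sum [N, N']))"

definition indecomposable_module ::
  "('g, 'b) monoid_scheme \<Rightarrow> ('g, 'k::field) kG_module \<Rightarrow> bool" where
  "indecomposable_module G M \<longleftrightarrow>
     is_kG_module G M \<and> mdim M > 0 \<and>
     (\<forall>A B. is_kG_module G A \<longrightarrow> is_kG_module G B \<longrightarrow> kG_iso G M (direct_sum [A, B]) \<longrightarrow>
        mdim A = 0 \<or> mdim B = 0)"

definition component ::
  "('g, 'b) monoid_scheme \<Rightarrow> ('g, 'k::field) kG_module \<Rightarrow> ('g, 'k) kG_module \<Rightarrow> bool" where
  "component G C M \<longleftrightarrow> indecomposable_module G C \<and> direct_summand G C M"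

text \<open>
  \<open>N\<close> occurs exactly \<open>m\<close> times, up to isomorphism, in a decomposition of \<open>M\<close> into
  indecomposable summands (by Krull-Schmidt the decomposition does not matter).
\<close>

definition occurs_with_multiplicity ::
  "('g, 'b) monoid_scheme \<Rightarrow> ('g, 'k::field) kG_module \<Rightarrow> ('g, 'k) kG_module \<Rightarrow> nat \<Rightarrow> bool" where
  "occurs_with_multiplicity G N M m \<longleftrightarrow>
     (\<exists>Ns. (\<forall>N'\<in>set Ns. indecomposable_module G N') \<and> kG_iso G M (direct_sum Ns) \<and>
        length (filter (kG_iso G N) Ns) = m)"


section \<open>Permutation modules and induced modules\<close>

text \<open>An arbitrary enumeration without repetition of a finite set.\<close>

definition listing :: "'a set \<Rightarrow> 'a list" where
  "listing A = (SOME xs. distinct xs \<and> set xs = A)"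

text \<open>The permutation module on the points \<open>xs\<close>, where \<open>g\<close> sends \<open>x\<close> to \<open>\<phi> g x\<close>.\<close>

definition perm_module :: "'x list \<Rightarrow> ('g \<Rightarrow> 'x \<Rightarrow> 'x) \<Rightarrow> ('g, 'k::field) kG_module" where
  "perm_module xs \<phi> =
     \<lparr>mdim = length xs,
      act = (\<lambda>g. mat (length xs) (length xs) (\<lambda>(i, j). if \<phi> g (xs ! j) = xs ! i then 1 else 0))\<rparr>"

text \<open>
  Every finite \<open>G\<close>-set is isomorphic to one with underlying set \<open>{..<n}\<close>.
\<close>

definition p_permutation ::
  "('g, 'b) monoid_scheme \<Rightarrow> ('g, 'k::field) kG_module \<Rightarrow> bool" where
  "p_permutation G M \<longleftrightarrow>
     (\<exists>(n::nat) \<phi>. group_action G {..<n} \<phi> \<and> direct_summand G M (perm_module [0..<n] \<phi>))"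

definition endo_p_permutation ::
  "('g, 'b) monoid_scheme \<Rightarrow> ('g, 'k::field) kG_module \<Rightarrow> bool" where
  "endo_p_permutation G M \<longleftrightarrow> is_kG_module G M \<and> p_permutation G (End_module G M)"

text \<open>The module \<open>k[G/Q]\<close> on the left cosets of \<open>Q\<close>.\<close>

definition coset_module ::
  "('g, 'b) monoid_scheme \<Rightarrow> 'g set \<Rightarrow> ('g, 'k::field) kG_module" where
  "coset_module G Q = perm_module (listing (lcosets\<^bsub>G\<^esub> Q)) (\<lambda>g C. g <#\<^bsub>G\<^esub> C)"

text \<open>
  The induced module \<open>kG \<otimes>\<^bsub>kH\<^esub> L\<close>.  Let \<open>t 0, t 1, \<dots>\<close> represent the left cosets of \<open>H\<close>.  The
  basis vector \<open>t b \<otimes> e s\<close> has index \<open>b * mdim L + s\<close>, and \<open>g (t b \<otimes> v) = t a \<otimes> h v\<close>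
  whenever \<open>g t b = t a h\<close> with \<open>h \<in> H\<close>.
\<close>

definition induced_module ::
  "('g, 'b) monoid_scheme \<Rightarrow> 'g set \<Rightarrow> ('g, 'k::field) kG_module \<Rightarrow> ('g, 'k) kG_module" where
  "induced_module G H L =
     (let cs = listing (lcosets\<^bsub>G\<^esub> H); d = mdim L; n = length cs * d;
          t = (\<lambda>a. SOME x. x \<in> cs ! a)
      in \<lparr>mdim = n,
          act = (\<lambda>g. mat n n (\<lambda>(i, j).
            let h = inv\<^bsub>G\<^esub> (t (i div d)) \<otimes>\<^bsub>G\<^esub> g \<otimes>\<^bsub>G\<^esub> t (j div d)
            in if h \<in> H then act L h $$ (i mod d, j mod d) else 0))\<rparr>)"


section \<open>Relative projectivity and vertices\<close>

text \<open>
  Projectivity relative to a subgroup \<open>H\<close>: being a direct summand of a module induced from a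
  \<open>kH\<close>-module.
\<close>

definition relatively_projective ::
  "('g, 'b) monoid_scheme \<Rightarrow> 'g set \<Rightarrow> ('g, 'k::field) kG_module \<Rightarrow> bool" where
  "relatively_projective G H M \<longleftrightarrow>
     (\<exists>L. is_kG_module (G\<lparr>carrier := H\<rparr>) L \<and> direct_summand G M (induced_module G H L))"

definition is_vertex ::
  "('g, 'b) monoid_scheme \<Rightarrow> ('g, 'k::field) kG_module \<Rightarrow> 'g set \<Rightarrow> bool" where
  "is_vertex G M Q \<longleftrightarrow>
     indecomposable_module G M \<and> subgroup Q G \<and> relatively_projective G Q M \<and>
     (\<forall>R. subgroup R G \<and> R \<subset> Q \<longrightarrow> \<not> relatively_projective G R M)"

definition module_projective ::
  "('g, 'b) monoid_scheme \<Rightarrow> ('g, 'k::field) kG_module \<Rightarrow> ('g, 'k) kG_module \<Rightarrow> bool" where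
  "module_projective G V N \<longleftrightarrow>
     (\<exists>L. is_kG_module G L \<and> direct_summand G N (tensor_module V L))"


section \<open>Sylow subgroups and the module of the family of non-Sylow subgroups\<close>

definition sylow_subgroup :: "('g, 'b) monoid_scheme \<Rightarrow> nat \<Rightarrow> 'g set \<Rightarrow> bool" where
  "sylow_subgroup G p S \<longleftrightarrow> subgroup S G \<and> card S = p ^ Factorial_Ring.multiplicity p (Coset.order G)"

definition non_sylow_subgroups :: "('g, 'b) monoid_scheme \<Rightarrow> nat \<Rightarrow> 'g set set" where
  "non_sylow_subgroups G p =
     {Q. subgroup Q G \<and> (\<exists>a. card Q = p ^ a) \<and> \<not> sylow_subgroup G p Q}"

definition conjugacy_class :: "('g, 'b) monoid_scheme \<Rightarrow> 'g set \<Rightarrow> 'g set set" where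
  "conjugacy_class G Q = {(\<lambda>x. g \<otimes>\<^bsub>G\<^esub> x \<otimes>\<^bsub>G\<^esub> inv\<^bsub>G\<^esub> g) ` Q | g. g \<in> carrier G}"

text \<open>
  The direct sum of the modules \<open>k[G/Q]\<close>, with one \<open>Q\<close> chosen from each conjugacy class of
  non-Sylow \<open>p\<close>-subgroups.  It is the zero module if \<open>p\<close> does not divide the order of \<open>G\<close>.
\<close>

definition non_sylow_module :: "('g, 'b) monoid_scheme \<Rightarrow> nat \<Rightarrow> ('g, 'k::field) kG_module" where
  "non_sylow_module G p =
     direct_sum (map (\<lambda>K. coset_module G (SOME Q. Q \<in> K))
       (listing (conjugacy_class G ` non_sylow_subgroups G p)))"


section \<open>Dade modules and strongly capped modules\<close>

definition dade_module ::
  "('g, 'b) monoid_scheme \<Rightarrow> nat \<Rightarrow> ('g, 'k::field) kG_module \<Rightarrow> bool" where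
  "dade_module G p M \<longleftrightarrow>
     is_kG_module G M \<and>
     (\<exists>n W. p_permutation G W \<and>
        (\<forall>C Q. component G C W \<and> is_vertex G C Q \<longrightarrow> Q \<in> non_sylow_subgroups G p) \<and>
        kG_iso G (End_module G M) (direct_sum [trivial_module n, W]))"

definition capped ::
  "('g, 'b) monoid_scheme \<Rightarrow> 'g set \<Rightarrow> ('g, 'k::field) kG_module \<Rightarrow> bool" where
  "capped G S M \<longleftrightarrow> (\<exists>C. component G C M \<and> is_vertex G C S)"

definition is_cap ::
  "('g, 'b) monoid_scheme \<Rightarrow> nat \<Rightarrow> 'g set \<Rightarrow> ('g, 'k::field) kG_module \<Rightarrow> ('g, 'k) kG_module \<Rightarrow> bool"
where
  "is_cap G p S C M \<longleftrightarrow>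
     dade_module G p M \<and> capped G S M \<and> component G C M \<and> is_vertex G C S"

definition strongly_capped ::
  "('g, 'b) monoid_scheme \<Rightarrow> nat \<Rightarrow> ('g, 'k::field) kG_module \<Rightarrow> bool" where
  "strongly_capped G p M \<longleftrightarrow>
     endo_p_permutation G M \<and>
     (\<exists>W. is_kG_module G W \<and> module_projective G (non_sylow_module G p) W \<and>
        kG_iso G (End_module G M) (direct_sum [trivial_module 1, W]))"

end

theory Submission
  imports Defs "Jordan_Normal_Form.Char_Poly"
begin

text \<open>
  Everything is done with relative traces.  A module is projective relative to \<open>H\<close> if and only if
  its identity is a relative trace from \<open>H\<close> (Higman), and such traces have trace divisible by the
  index of \<open>H\<close>.  Write \<open>End(M) = k\<^sup>n \<oplus> W\<close> with \<open>W\<close> projective relative to the non-Sylow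
  \<open>p\<close>-subgroups.  The bilinear form \<open>(f, h) \<mapsto> tr (f h)\<close> on \<open>End\<^bsub>kG\<^esub>(M)\<close> pairs invariants of \<open>End(M)\<close>
  with invariants of its dual, and it does not see \<open>W\<close>; hence its rank is \<open>n\<close>.

  Decompose \<open>M\<close> into indecomposable modules \<open>N\<^sub>i\<close>.  As \<open>End\<^bsub>kG\<^esub>(N\<^sub>i)\<close> consists of scalars plus
  nilpotent elements, \<open>tr (f h)\<close> only involves the pairs \<open>N\<^sub>i \<cong> N\<^sub>j\<close> of dimension prime to \<open>p\<close>
  (Benson and Carlson).  If \<open>n = 1\<close>, exactly one \<open>N\<^sub>i\<close> has dimension prime to \<open>p\<close>, and its vertex is
  \<open>S\<close>.  Conversely, if the form vanishes on \<open>Hom(N\<^sub>i, N\<^sub>j)\<close>, then \<open>Hom(N\<^sub>i, N\<^sub>j)\<close> is projective relative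
  to the non-Sylow subgroups.  For \<open>i = j\<close> so is then \<open>N\<^sub>i\<close>, so the cap has dimension prime to \<open>p\<close>;
  and in any case \<open>p\<close> divides \<open>dim N\<^sub>i dim N\<^sub>j\<close>, so every \<open>N\<^sub>i\<close> of dimension prime to \<open>p\<close> is isomorphic
  to the cap.  If there is only one such \<open>N\<^sub>i\<close>, the form has rank one and \<open>n = 1\<close>.
\<close>

section \<open>Finitely supported matrices\<close>

text \<open>In characteristic \<open>p\<close>, comparing dimensions in \<open>End(M)\<close>
  determines \<open>n\<close> only modulo \<open>p\<close>; this is why \<open>n\<close> is read off
  as the rank of a bilinear form. The rank is tested by small minors: \<open>n = 0\<close> means
  that the form vanishes, \<open>n \<ge> 2\<close> produces a nonzero 2 by 2 minor. The summand
  \<open>W\<close> is invisible because a composite \<open>k \<rightarrow> W \<rightarrow> k\<close>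
  is a sum of relative traces on the trivial module, where a trace from \<open>Q\<close> is
  multiplication by a multiple of the index of \<open>Q\<close>, hence zero for non-Sylow
  \<open>Q\<close>. Three conditions on \<open>W\<close> become one: projectivity relative to
  \<open>V(\<F>)\<close>, non-Sylow vertices of all components, and membership of the identity in
  the ideal spanned by traces from non-Sylow subgroups. The spaces \<open>Hom(N_i, N_j)\<close> are
  never built as modules; each is the image of an idempotent operator
  \<open>x \<mapsto> e x e'\<close> on \<open>End(M)\<close>, so that the splitting of
  \<open>End(M)\<close> applies to it directly.\<close>

text \<open>Matrices of all shapes become elements of a single ring, without unit, so that products and
  sums need no side conditions on dimensions.\<close>

typedef (overloaded) 'k fmat =
  "{f :: nat \<Rightarrow> nat \<Rightarrow> 'k::zero. \<exists>n. \<forall>i j. n \<le> i \<or> n \<le> j \<longrightarrow> f i j = 0}"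
  morphisms entry Abs_fmat
  by (rule exI[of _ "\<lambda>_ _. 0"]) simp

setup_lifting type_definition_fmat

lemma fmat_eqI: "(\<And>i j. entry x i j = entry y i j) \<Longrightarrow> x = y"
  by transfer blast

definition bnded :: "nat \<Rightarrow> 'k::zero fmat \<Rightarrow> bool" where
  "bnded n x \<longleftrightarrow> (\<forall>i j. n \<le> i \<or> n \<le> j \<longrightarrow> entry x i j = 0)"

lemma bnded_ex: "\<exists>n. bnded n x"
  unfolding bnded_def by transfer simp

lemma bnded_mono: "bnded n x \<Longrightarrow> n \<le> m \<Longrightarrow> bnded m x"
  unfolding bnded_def by (meson le_trans)

lemma bnded_ex2: "\<exists>n. bnded n x \<and> bnded n y"
  using bnded_ex[of x] bnded_ex[of y] bnded_mono by (metis nle_le)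

lemma bnded_ex3: "\<exists>n. bnded n x \<and> bnded n y \<and> bnded n z"
  using bnded_ex2[of x y] bnded_ex[of z] bnded_mono by (metis nle_le)

instantiation fmat :: (comm_ring_1) ring
begin

lift_definition zero_fmat :: "'a fmat" is "\<lambda>_ _. 0" by simp
lift_definition plus_fmat :: "'a fmat \<Rightarrow> 'a fmat \<Rightarrow> 'a fmat" is "\<lambda>f g i j. f i j + g i j"
  by (metis add_cancel_right_right le_trans nle_le)
lift_definition uminus_fmat :: "'a fmat \<Rightarrow> 'a fmat" is "\<lambda>f i j. - f i j"
  by force
lift_definition minus_fmat :: "'a fmat \<Rightarrow> 'a fmat \<Rightarrow> 'a fmat" is "\<lambda>f g i j. f i j - g i j"
  by (metis diff_0_right le_trans nle_le)
text \<open>Summing over the support of a row makes the product independent of any chosen bound on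
  the two matrices; \<open>entry_times_bnded\<close> recovers the usual finite range.\<close>

lift_definition times_fmat :: "'a fmat \<Rightarrow> 'a fmat \<Rightarrow> 'a fmat"
  is "\<lambda>f g i j. \<Sum>k | f i k \<noteq> 0. f i k * g k j"
proof -
  fix f g :: "nat \<Rightarrow> nat \<Rightarrow> 'a"
  assume "\<exists>n. \<forall>i j. n \<le> i \<or> n \<le> j \<longrightarrow> f i j = 0" "\<exists>n. \<forall>i j. n \<le> i \<or> n \<le> j \<longrightarrow> g i j = 0"
  then obtain n m where "\<forall>i j. n \<le> i \<or> n \<le> j \<longrightarrow> f i j = 0" "\<forall>i j. m \<le> i \<or> m \<le> j \<longrightarrow> g i j = 0"
    by blast
  then show "\<exists>n. \<forall>i j. n \<le> i \<or> n \<le> j \<longrightarrow> (\<Sum>k | f i k \<noteq> 0. f i k * g k j) = 0"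
    by (intro exI[of _ "max n m"]) auto
qed

lemma entry_times_bnded:
  assumes "bnded n x"
  shows "entry (x * y) i j = (\<Sum>k<n. entry x i k * entry y k j)"
proof -
  have "entry (x * y) i j = (\<Sum>k | entry x i k \<noteq> 0. entry x i k * entry y k j)"
    by transfer simp
  also have "\<dots> = (\<Sum>k<n. entry x i k * entry y k j)"
    using assms unfolding bnded_def
    by (intro sum.mono_neutral_left) (auto simp: not_less intro: leI)
  finally show ?thesis .
qed

lemma entry_plus: "entry (x + y) i j = entry x i j + entry y i j" for x :: "'a fmat"
  by transfer simp
lemma entry_minus: "entry (x - y) i j = entry x i j - entry y i j" for x :: "'a fmat"
  by transfer simp
lemma entry_zero: "entry (0 :: 'a fmat) i j = 0"
  by transfer simp

lemma bnded_times: "bnded n x \<Longrightarrow> bnded n y \<Longrightarrow> bnded n (x * y)" for x :: "'a fmat"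
  by (auto simp: bnded_def[of n "x * y"] entry_times_bnded) (auto simp: bnded_def)

instance
proof
  fix a b c :: "'a fmat"
  show "a + b + c = a + (b + c)" by transfer (simp add: add.assoc)
  show "a + b = b + a" by transfer (simp add: add.commute)
  show "0 + a = a" by transfer simp
  show "- a + a = 0" by transfer simp
  show "a - b = a + - b" by transfer simp
  obtain n where n: "bnded n a" "bnded n b" "bnded n c" using bnded_ex3 by blast
  note nn = n bnded_times[OF n(1,2)]
  show "a * b * c = a * (b * c)"
  proof (rule fmat_eqI)
    fix i j
    have "entry (a * b * c) i j = (\<Sum>k<n. (\<Sum>l<n. entry a i l * entry b l k) * entry c k j)"
      by (simp only: entry_times_bnded[OF nn(4)] entry_times_bnded[OF n(1)])
    also have "\<dots> = (\<Sum>l<n. entry a i l * (\<Sum>k<n. entry b l k * entry c k j))"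
      unfolding sum_distrib_left sum_distrib_right by (subst sum.swap) (simp add: mult.assoc)
    also have "\<dots> = entry (a * (b * c)) i j"
      by (simp only: entry_times_bnded[OF n(2)] entry_times_bnded[OF n(1)])
    finally show "entry (a * b * c) i j = entry (a * (b * c)) i j" .
  qed
  have "bnded n (a + b)" using n by (auto simp: bnded_def entry_plus)
  then show "(a + b) * c = a * c + b * c"
    by (intro fmat_eqI) (simp add: entry_times_bnded[of n] n entry_plus algebra_simps sum.distrib)
  show "a * (b + c) = a * b + a * c"
    by (intro fmat_eqI) (simp add: entry_times_bnded[of n] n entry_plus algebra_simps sum.distrib)
qed

end

lemma entry_sum: "entry (sum f A) i j = (\<Sum>a\<in>A. entry (f a) i j)"
  for f :: "'b \<Rightarrow> 'a::comm_ring_1 fmat"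
  by (induction A rule: infinite_finite_induct) (auto simp: entry_plus entry_zero)

lemma entry_times_left:
  fixes x :: "'a::comm_ring_1 fmat"
  assumes "\<And>k. n \<le> k \<Longrightarrow> entry x i k = 0"
  shows "entry (x * y) i j = (\<Sum>k<n. entry x i k * entry y k j)"
proof -
  obtain m where "bnded m x" using bnded_ex by blast
  then have "bnded (max n m) x" using bnded_mono by (metis max.cobounded2)
  then have "entry (x * y) i j = (\<Sum>k<max n m. entry x i k * entry y k j)"
    by (rule entry_times_bnded)
  also have "\<dots> = (\<Sum>k<n. entry x i k * entry y k j)"
    using assms by (intro sum.mono_neutral_right) (auto simp: not_less)
  finally show ?thesis .
qed

lemma entry_times_right:
  fixes x :: "'a::comm_ring_1 fmat"
  assumes "\<And>k. n \<le> k \<Longrightarrow> entry y k j = 0"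
  shows "entry (x * y) i j = (\<Sum>k<n. entry x i k * entry y k j)"
proof -
  obtain m where "bnded m x" using bnded_ex by blast
  then have "bnded (max n m) x" using bnded_mono by (metis max.cobounded2)
  then have "entry (x * y) i j = (\<Sum>k<max n m. entry x i k * entry y k j)"
    by (rule entry_times_bnded)
  also have "\<dots> = (\<Sum>k<n. entry x i k * entry y k j)"
    using assms by (intro sum.mono_neutral_right) (auto simp: not_less)
  finally show ?thesis .
qed

section \<open>Matrix units, partial identities and shapes\<close>

lift_definition munit :: "nat \<Rightarrow> nat \<Rightarrow> 'k::zero_neq_one fmat"
  is "\<lambda>a b i j. if i = a \<and> j = b then 1 else 0"
proof -
  fix a b :: nat
  show "\<exists>n. \<forall>i j. n \<le> i \<or> n \<le> j \<longrightarrow> (if i = a \<and> j = b then 1 else 0 :: 'k) = 0"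
    by (intro exI[of _ "Suc (max a b)"]) auto
qed

lemma entry_munit: "entry (munit a b) i j = (if i = a \<and> j = b then 1 else 0)"
  by transfer simp

lemma munit_times: "munit a b * munit c d = (if b = c then munit a d else (0 :: 'k::comm_ring_1 fmat))"
proof (rule fmat_eqI)
  fix i j
  have "entry (munit a b * munit c d :: 'k fmat) i j
    = (\<Sum>k<Suc b. entry (munit a b) i k * entry (munit c d) k j)"
    by (rule entry_times_left) (auto simp: entry_munit)
  also have "\<dots> = (\<Sum>k<Suc b. if k = b then (if i = a \<and> b = c \<and> j = d then 1 else 0) else 0)"
    by (rule sum.cong) (auto simp: entry_munit)
  also have "\<dots> = (if i = a \<and> b = c \<and> j = d then 1 else 0)" by simp
  finally show "entry (munit a b * munit c d :: 'k fmat) i j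
     = entry (if b = c then munit a d else (0 :: 'k fmat)) i j"
    by (auto simp: entry_munit entry_zero)
qed

text \<open>The scalar \<open>c\<close> on an \<open>n\<close>-dimensional space. As the ring has no
  unit, the case \<open>c = 1\<close>, abbreviated \<open>fone n\<close>, serves as the identity of
  that space.\<close>

lift_definition diagc :: "nat \<Rightarrow> 'k::zero \<Rightarrow> 'k fmat"
  is "\<lambda>n c i j. if i < n \<and> j = i then c else 0"
  by (metis leD)

lemma entry_diagc: "entry (diagc n c) i j = (if i < n \<and> j = i then c else 0)"
  by transfer simp

abbreviation fone :: "nat \<Rightarrow> 'k::zero_neq_one fmat" where "fone n \<equiv> diagc n 1"

lemma entry_diagc_times: "entry (diagc n c * x) i j = (if i < n then c * entry x i j else 0)"
  for x :: "'k::comm_ring_1 fmat"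
proof -
  have "entry (diagc n c * x) i j = (\<Sum>k<n. entry (diagc n c) i k * entry x k j)"
    by (rule entry_times_left) (auto simp: entry_diagc)
  also have "\<dots> = (\<Sum>k<n. if k = i then c * entry x i j else 0)"
    by (rule sum.cong) (auto simp: entry_diagc)
  also have "\<dots> = (if i < n then c * entry x i j else 0)" by simp
  finally show ?thesis .
qed

lemma entry_times_diagc: "entry (x * diagc n c) i j = (if j < n then entry x i j * c else 0)"
  for x :: "'k::comm_ring_1 fmat"
proof -
  have "entry (x * diagc n c) i j = (\<Sum>k<n. entry x i k * entry (diagc n c) k j)"
    by (rule entry_times_right) (auto simp: entry_diagc)
  also have "\<dots> = (\<Sum>k<n. if k = j then entry x i j * c else 0)"
    by (rule sum.cong) (auto simp: entry_diagc)
  also have "\<dots> = (if j < n then entry x i j * c else 0)" by simp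
  finally show ?thesis .
qed

definition shaped :: "nat \<Rightarrow> nat \<Rightarrow> 'k::comm_ring_1 fmat \<Rightarrow> bool" where
  "shaped n m x \<longleftrightarrow> fone n * x = x \<and> x * fone m = x"

lemma shaped_iff: "shaped n m x \<longleftrightarrow> (\<forall>i j. n \<le> i \<or> m \<le> j \<longrightarrow> entry x i j = 0)"
proof
  assume "shaped n m x"
  then have "\<And>i j. entry (fone n * x) i j = entry x i j" "\<And>i j. entry (x * fone m) i j = entry x i j"
    by (auto simp: shaped_def)
  then show "\<forall>i j. n \<le> i \<or> m \<le> j \<longrightarrow> entry x i j = 0"
    unfolding entry_diagc_times entry_times_diagc by (metis leD)
next
  assume *: "\<forall>i j. n \<le> i \<or> m \<le> j \<longrightarrow> entry x i j = 0"
  show "shaped n m x"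
    unfolding shaped_def by (auto intro!: fmat_eqI simp: entry_diagc_times entry_times_diagc * not_less)
qed

lemma shapedD: "shaped n m x \<Longrightarrow> fone n * x = x" "shaped n m x \<Longrightarrow> x * fone m = x"
  by (auto simp: shaped_def)

lemma shaped_entry: "shaped n m x \<Longrightarrow> n \<le> i \<or> m \<le> j \<Longrightarrow> entry x i j = 0"
  by (auto simp: shaped_iff)

lemma shaped_times: "shaped n m x \<Longrightarrow> shaped m' l y \<Longrightarrow> shaped n l (x * y)"
  unfolding shaped_def by (metis mult.assoc)

lemma shaped_plus: "shaped n m x \<Longrightarrow> shaped n m y \<Longrightarrow> shaped n m (x + y)"
  unfolding shaped_def by (simp add: algebra_simps)

lemma shaped_minus: "shaped n m x \<Longrightarrow> shaped n m y \<Longrightarrow> shaped n m (x - y)"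
  unfolding shaped_def by (simp add: algebra_simps)

lemma shaped_zero [simp]: "shaped n m 0"
  unfolding shaped_def by simp

lemma shaped_sum: "(\<And>a. a \<in> A \<Longrightarrow> shaped n m (f a)) \<Longrightarrow> shaped n m (sum f A)"
  by (induction A rule: infinite_finite_induct) (auto simp: shaped_plus)

lemma shaped_diagc [simp]: "shaped n n (diagc n c)"
  by (auto simp: shaped_iff entry_diagc)

lemma shaped_munit: "a < n \<Longrightarrow> b < m \<Longrightarrow> shaped n m (munit a b)"
  by (auto simp: shaped_iff entry_munit)

lemma fone_idem [simp]: "fone n * fone n = (fone n :: 'k::comm_ring_1 fmat)"
  by (intro fmat_eqI) (simp add: entry_diagc_times entry_diagc)

lemma fone_eq_sum: "fone n = (\<Sum>i<n. munit i i :: 'k::comm_ring_1 fmat)"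
proof (rule fmat_eqI)
  fix i j
  have "(\<Sum>a<n. entry (munit a a) i j) = (\<Sum>a<n. if a = i then (if j = i then 1 else 0) else (0::'k))"
    by (rule sum.cong) (auto simp: entry_munit)
  then show "entry (fone n) i j = entry (\<Sum>i<n. munit i i :: 'k::comm_ring_1 fmat) i j"
    by (simp add: entry_sum entry_diagc)
qed

lemma diagc_central: "shaped n n x \<Longrightarrow> diagc n c * x = x * diagc n c"
  by (rule fmat_eqI) (auto simp: entry_diagc_times entry_times_diagc shaped_entry mult.commute)

lemma diagc_times: "diagc n a * diagc n b = diagc n (a * b :: 'k::comm_ring_1)"
  by (rule fmat_eqI) (auto simp: entry_diagc_times entry_diagc)

lemma diagc_zero [simp]: "diagc n 0 = (0 :: 'k::comm_ring_1 fmat)"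
  by (rule fmat_eqI) (auto simp: entry_diagc entry_zero)

lemma fone_zero [simp]: "diagc 0 c = (0 :: 'k::comm_ring_1 fmat)"
  by (rule fmat_eqI) (auto simp: entry_diagc entry_zero)

lemma fone_eq_0_iff [simp]: "fone n = (0 :: 'k::comm_ring_1 fmat) \<longleftrightarrow> n = 0"
proof
  assume "fone n = (0 :: 'k fmat)"
  then have "entry (fone n :: 'k fmat) 0 0 = 0" by (simp add: entry_zero)
  then show "n = 0" by (simp add: entry_diagc split: if_splits)
qed simp

section \<open>Trace and transpose\<close>

definition ftrace :: "'k::comm_ring_1 fmat \<Rightarrow> 'k" where
  "ftrace x = (\<Sum>i | entry x i i \<noteq> 0. entry x i i)"

lemma ftrace_bnded: "bnded n x \<Longrightarrow> ftrace x = (\<Sum>i<n. entry x i i)"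
  unfolding ftrace_def bnded_def
  by (rule sum.mono_neutral_left) (auto simp: not_less intro: leI)

lemma ftrace_shaped: "shaped n m x \<Longrightarrow> ftrace x = (\<Sum>i<n. entry x i i)"
proof -
  assume s: "shaped n m x"
  obtain k where "bnded k x" using bnded_ex by blast
  then have "bnded (max n k) x" using bnded_mono by (metis max.cobounded2)
  then have "ftrace x = (\<Sum>i<max n k. entry x i i)" by (rule ftrace_bnded)
  also have "\<dots> = (\<Sum>i<n. entry x i i)"
    using s by (intro sum.mono_neutral_right) (auto simp: not_less shaped_entry)
  finally show ?thesis .
qed

lemma ftrace_plus: "ftrace (x + y) = ftrace x + ftrace y"
proof -
  obtain n where n: "bnded n x" "bnded n y" using bnded_ex2 by blast
  then have "bnded n (x + y)" by (auto simp: bnded_def entry_plus)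
  with n show ?thesis by (simp add: ftrace_bnded entry_plus sum.distrib)
qed

lemma ftrace_zero [simp]: "ftrace 0 = 0"
  by (simp add: ftrace_def entry_zero)

lemma ftrace_minus: "ftrace (x - y) = ftrace x - ftrace y"
  by (metis add_diff_cancel diff_add_cancel ftrace_plus)

lemma ftrace_sum: "ftrace (sum f A) = (\<Sum>a\<in>A. ftrace (f a))"
  by (induction A rule: infinite_finite_induct) (auto simp: ftrace_plus)

lemma ftrace_commute: "ftrace (x * y) = ftrace (y * x)"
proof -
  obtain n where n: "bnded n x" "bnded n y" using bnded_ex2 by blast
  have "ftrace (x * y) = (\<Sum>i<n. \<Sum>k<n. entry x i k * entry y k i)"
    by (simp add: ftrace_bnded[OF bnded_times[OF n]] entry_times_bnded[OF n(1)])
  also have "\<dots> = (\<Sum>i<n. \<Sum>k<n. entry y i k * entry x k i)"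
    by (subst sum.swap) (simp add: mult.commute)
  also have "\<dots> = ftrace (y * x)"
    by (simp add: ftrace_bnded[OF bnded_times[OF n(2,1)]] entry_times_bnded[OF n(2)])
  finally show ?thesis .
qed

lemma ftrace_diagc [simp]: "ftrace (diagc n c) = of_nat n * c"
  by (simp add: ftrace_shaped[OF shaped_diagc] entry_diagc)

lemma shaped_1_eq: "shaped (Suc 0) (Suc 0) x \<Longrightarrow> x = diagc (Suc 0) (ftrace x)"
proof (rule fmat_eqI)
  fix i j
  assume "shaped (Suc 0) (Suc 0) x"
  then show "entry x i j = entry (diagc (Suc 0) (ftrace x)) i j"
    using shaped_entry[of "Suc 0" "Suc 0" x i j]
    by (cases "i = 0 \<and> j = 0") (auto simp: ftrace_shaped entry_diagc)
qed

lift_definition ftranspose :: "'k::zero fmat \<Rightarrow> 'k fmat" is "\<lambda>f i j. f j i" by blast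

lemma entry_ftranspose: "entry (ftranspose x) i j = entry x j i"
  by transfer simp

lemma ftranspose_times: "ftranspose (x * y) = ftranspose y * ftranspose (x :: 'k::comm_ring_1 fmat)"
proof (rule fmat_eqI)
  fix i j
  obtain n where n: "bnded n x" "bnded n y" using bnded_ex2 by blast
  then have "bnded n (ftranspose y)" by (auto simp: bnded_def entry_ftranspose)
  then show "entry (ftranspose (x * y)) i j = entry (ftranspose y * ftranspose x) i j"
    using n by (simp add: entry_ftranspose entry_times_bnded[of n] mult.commute)
qed

lemma ftranspose_diagc [simp]: "ftranspose (diagc n c) = diagc n c"
  by (rule fmat_eqI) (auto simp: entry_ftranspose entry_diagc)

lemma ftranspose_twice [simp]: "ftranspose (ftranspose x) = x"
  by (rule fmat_eqI) (simp add: entry_ftranspose)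

lemma ftranspose_shaped: "shaped n m x \<Longrightarrow> shaped m n (ftranspose x)"
  by (auto simp: shaped_iff entry_ftranspose)

lemma ftrace_ftranspose [simp]: "ftrace (ftranspose x) = ftrace x"
  by (simp add: ftrace_def entry_ftranspose)

section \<open>Kronecker products\<close>

text \<open>The parameter \<open>d\<close> is the size of the second factor, which fixes the
  numbering \<open>a * d + b\<close> of pairs; a finitely supported matrix alone cannot supply
  it.\<close>

lift_definition fkron :: "nat \<Rightarrow> 'k::comm_ring_1 fmat \<Rightarrow> 'k fmat \<Rightarrow> 'k fmat"
  is "\<lambda>d f g i j. f (i div d) (j div d) * g (i mod d) (j mod d)"
proof -
  fix d :: nat and f g :: "nat \<Rightarrow> nat \<Rightarrow> 'k"
  assume "\<exists>n. \<forall>i j. n \<le> i \<or> n \<le> j \<longrightarrow> f i j = 0" "\<exists>n. \<forall>i j. n \<le> i \<or> n \<le> j \<longrightarrow> g i j = 0"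
  then obtain n m where n: "\<forall>i j. n \<le> i \<or> n \<le> j \<longrightarrow> f i j = 0" and m: "\<forall>i j. m \<le> i \<or> m \<le> j \<longrightarrow> g i j = 0"
    by blast
  show "\<exists>n. \<forall>i j. n \<le> i \<or> n \<le> j \<longrightarrow> f (i div d) (j div d) * g (i mod d) (j mod d) = 0"
  proof (cases "d = 0")
    \<comment> \<open>Here \<open>i div 0 = 0\<close> and \<open>i mod 0 = i\<close>, so the entry
      is \<open>f 0 0 * g i j\<close> and the bound \<open>m\<close> for \<open>g\<close>
      suffices.\<close>
    case True
    with m show ?thesis by (intro exI[of _ m]) auto
  next
    case False
    then have "n \<le> i div d" if "n * d \<le> i" for i using that
      by (metis div_le_mono nonzero_mult_div_cancel_right)
    with n show ?thesis by (intro exI[of _ "n * d"]) auto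
  qed
qed

lemma entry_fkron:
  "entry (fkron d x y) i j = entry x (i div d) (j div d) * entry y (i mod d) (j mod d)"
  by transfer simp

lemma sum_div_mod:
  fixes d n :: nat
  assumes "d > 0"
  shows "(\<Sum>k<n * d. f (k div d) (k mod d)) = (\<Sum>a<n. \<Sum>b<d. f a b)"
proof -
  have "(\<Sum>a<n. \<Sum>b<d. f a b) = (\<Sum>(a,b)\<in>{..<n} \<times> {..<d}. f a b)"
    by (simp add: sum.cartesian_product)
  also have "\<dots> = (\<Sum>k<n * d. f (k div d) (k mod d))"
  proof (rule sum.reindex_bij_witness[of _ "\<lambda>k. (k div d, k mod d)" "\<lambda>(a,b). a * d + b"])
    fix ab assume "ab \<in> {..<n} \<times> {..<d}"
    then obtain a b where ab: "ab = (a,b)" "a < n" "b < d" by auto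
    have "a * d + b < a * d + d" using ab by simp
    also have "\<dots> = Suc a * d" by simp
    also have "\<dots> \<le> n * d" using ab by (intro mult_le_mono1) simp
    finally show "(case ab of (a,b) \<Rightarrow> a * d + b) \<in> {..<n * d}" using ab by simp
  qed (use assms in \<open>auto simp: less_mult_imp_div_less\<close>)
  finally show ?thesis by simp
qed

text \<open>Only the second factors need a shape: the inner sum over \<open>k mod d\<close> stops at
  \<open>d\<close>, while the range of \<open>k div d\<close> is supplied by a bound on
  \<open>w\<close>.\<close>

lemma fkron_times:
  assumes y: "shaped d d y" and z: "shaped d d z"
  shows "fkron d w y * fkron d x z = fkron d (w * x) (y * z)"
proof (cases "d = 0")
  case True
  then have "y = 0" "z = 0" using y z by (auto simp: shaped_def)
  then show ?thesis by (intro fmat_eqI) (simp add: entry_fkron entry_zero entry_times_right[of 0])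
next
  case False
  show ?thesis
  proof (rule fmat_eqI)
    fix i j
    obtain n where n: "bnded n w" using bnded_ex by blast
    have 1: "entry (fkron d w y * fkron d x z) i j
      = (\<Sum>k<n*d. entry w (i div d) (k div d) * entry y (i mod d) (k mod d)
          * (entry x (k div d) (j div d) * entry z (k mod d) (j mod d)))"
    proof (subst entry_times_left[where n = "n * d"])
      fix k assume "n * d \<le> k"
      then have "n \<le> k div d" using False by (metis div_le_mono nonzero_mult_div_cancel_right)
      then show "entry (fkron d w y) i k = 0" using n by (simp add: entry_fkron bnded_def)
    qed (simp add: entry_fkron)
    also have "\<dots> = (\<Sum>a<n. \<Sum>b<d. entry w (i div d) a * entry y (i mod d) b
          * (entry x a (j div d) * entry z b (j mod d)))"
      using False by (subst sum_div_mod[symmetric]) auto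
    also have "\<dots> = (\<Sum>a<n. entry w (i div d) a * entry x a (j div d))
        * (\<Sum>b<d. entry y (i mod d) b * entry z b (j mod d))"
      by (simp add: sum_product mult_ac)
    also have "\<dots> = entry (fkron d (w * x) (y * z)) i j"
      unfolding entry_fkron using y
      by (simp add: entry_times_bnded[OF n] entry_times_left[of d] shaped_entry)
    finally show "entry (fkron d w y * fkron d x z) i j = entry (fkron d (w * x) (y * z)) i j" .
  qed
qed

lemma fkron_plus_left: "fkron d (w + x) y = fkron d w y + fkron d x y"
  by (rule fmat_eqI) (simp add: entry_fkron entry_plus algebra_simps)
lemma fkron_zero_left [simp]: "fkron d 0 y = 0"
  by (rule fmat_eqI) (simp add: entry_fkron entry_zero)
lemma fkron_zero_right [simp]: "fkron d y 0 = 0"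
  by (rule fmat_eqI) (simp add: entry_fkron entry_zero)
lemma fkron_sum_left: "fkron d (sum f A) y = (\<Sum>a\<in>A. fkron d (f a) y)"
  by (induction A rule: infinite_finite_induct) (auto simp: fkron_plus_left)
lemma fkron_fone: "fkron d (fone n) (fone d) = fone (n * d)"
proof (cases "d = 0")
  case False
  show ?thesis
  proof (rule fmat_eqI)
    fix i j
    have "i div d < n \<longleftrightarrow> i < n * d" using False by (simp add: div_less_iff_less_mult)
    moreover have "i div d = j div d \<and> i mod d = j mod d \<longleftrightarrow> i = j"
      by (metis div_mult_mod_eq)
    ultimately show "entry (fkron d (fone n) (fone d)) i j = entry (fone (n * d)) i j"
      using False by (auto simp: entry_fkron entry_diagc)
  qed
qed simp

lemma fkron_shaped: "shaped n m x \<Longrightarrow> shaped d d y \<Longrightarrow> shaped (n * d) (m * d) (fkron d x y)"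
  unfolding shaped_def[of "n * d"] fkron_fone[symmetric]
  by (simp add: fkron_times shapedD)

text \<open>Regards a \<open>d\<close> by \<open>d\<close> matrix as a single block in position
  \<open>(0, 0)\<close>, so that maps from or to one copy of a module fit the block formulas used
  for induced and tensor modules.\<close>

lemma fkron_munit_0: "shaped d d x \<Longrightarrow> fkron d (munit 0 0) x = x"
proof (rule fmat_eqI)
  fix i j
  assume x: "shaped d d x"
  show "entry (fkron d (munit 0 0) x) i j = entry x i j"
  proof (cases "d = 0")
    case True
    then have "x = 0" using x by (simp add: shaped_def)
    then show ?thesis by (simp add: entry_zero)
  next
    case False
    show ?thesis
    proof (cases "i < d \<and> j < d")
      case True
      then show ?thesis by (simp add: entry_fkron entry_munit)
    next
      case F: False
      then have "\<not> (i div d = 0 \<and> j div d = 0)" using False by (simp add: div_eq_0_iff)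
      then show ?thesis using F x by (auto simp: entry_fkron entry_munit shaped_entry)
    qed
  qed
qed

lemma ftrace_fkron:
  assumes x: "shaped n n x" and y: "shaped d d y"
  shows "ftrace (fkron d x y) = ftrace x * ftrace y"
proof (cases "d = 0")
  case True
  then have "y = 0" using y by (simp add: shaped_def)
  then show ?thesis by simp
next
  case False
  have "ftrace (fkron d x y) = (\<Sum>k<n * d. entry x (k div d) (k div d) * entry y (k mod d) (k mod d))"
    by (simp add: ftrace_shaped[OF fkron_shaped[OF assms]] entry_fkron)
  also have "\<dots> = (\<Sum>a<n. \<Sum>b<d. entry x a a * entry y b b)"
    using False by (subst sum_div_mod[symmetric]) auto
  also have "\<dots> = ftrace x * ftrace y"
    by (simp add: ftrace_shaped[OF x] ftrace_shaped[OF y] sum_product)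
  finally show ?thesis .
qed

section \<open>Passage between finitely supported matrices and matrices with dimensions\<close>

lift_definition of_mat :: "'k::zero mat \<Rightarrow> 'k fmat"
  is "\<lambda>A i j. if i < dim_row A \<and> j < dim_col A then A $$ (i, j) else 0"
proof -
  fix A :: "'k mat"
  show "\<exists>n. \<forall>i j. n \<le> i \<or> n \<le> j \<longrightarrow> (if i < dim_row A \<and> j < dim_col A then A $$ (i, j) else 0) = 0"
    by (intro exI[of _ "max (dim_row A) (dim_col A)"]) auto
qed

lemma entry_of_mat: "entry (of_mat A) i j = (if i < dim_row A \<and> j < dim_col A then A $$ (i, j) else 0)"
  by transfer simp

definition to_mat :: "nat \<Rightarrow> nat \<Rightarrow> 'k::zero fmat \<Rightarrow> 'k mat" where
  "to_mat n m x = mat n m (\<lambda>(i, j). entry x i j)"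

lemma to_mat_carrier [simp]: "to_mat n m x \<in> carrier_mat n m"
  by (simp add: to_mat_def)

lemma to_mat_dim [simp]: "dim_row (to_mat n m x) = n" "dim_col (to_mat n m x) = m"
  by (simp_all add: to_mat_def)

lemma shaped_of_mat: "A \<in> carrier_mat n m \<Longrightarrow> shaped n m (of_mat A)"
  by (auto simp: shaped_iff entry_of_mat)

lemma of_mat_to_mat: "shaped n m x \<Longrightarrow> of_mat (to_mat n m x) = x"
  by (rule fmat_eqI) (auto simp: entry_of_mat shaped_entry not_less to_mat_def)

lemma of_mat_inject:
  "A \<in> carrier_mat n m \<Longrightarrow> B \<in> carrier_mat n m \<Longrightarrow> of_mat A = of_mat B \<longleftrightarrow> A = B"
proof
  assume A: "A \<in> carrier_mat n m" and B: "B \<in> carrier_mat n m" and e: "of_mat A = of_mat B"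
  have "entry (of_mat A) i j = entry (of_mat B) i j" for i j by (simp add: e)
  then have "i < n \<Longrightarrow> j < m \<Longrightarrow> A $$ (i, j) = B $$ (i, j)" for i j
    using A B by (simp add: entry_of_mat) metis
  with A B show "A = B" by (intro eq_matI) auto
qed auto

lemma of_mat_times:
  fixes A :: "'k::comm_ring_1 mat"
  assumes A: "A \<in> carrier_mat n m" and B: "B \<in> carrier_mat m l"
  shows "of_mat (A * B) = of_mat A * of_mat B"
proof (rule fmat_eqI)
  fix i j
  have "entry (of_mat A * of_mat B) i j = (\<Sum>k<m. entry (of_mat A) i k * entry (of_mat B) k j)"
    using A by (intro entry_times_left) (auto simp: entry_of_mat)
  also have "\<dots> = entry (of_mat (A * B)) i j"
    using A B by (auto simp: entry_of_mat scalar_prod_def lessThan_atLeast0 intro!: sum.cong)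
  finally show "entry (of_mat (A * B)) i j = entry (of_mat A * of_mat B) i j" by simp
qed

lemma of_mat_one [simp]: "of_mat (1\<^sub>m n) = fone n"
  by (rule fmat_eqI) (auto simp: entry_of_mat entry_diagc)

lemma to_mat_times:
  fixes x :: "'k::comm_ring_1 fmat"
  assumes "shaped n m x" "shaped m l y"
  shows "to_mat n l (x * y) = to_mat n m x * to_mat m l y"
proof -
  have "of_mat (to_mat n l (x * y)) = of_mat (to_mat n m x * to_mat m l y)"
    using assms by (simp add: of_mat_to_mat shaped_times of_mat_times[of _ n m _ l])
  then show ?thesis
    using of_mat_inject[of "to_mat n l (x * y)" n l "to_mat n m x * to_mat m l y"]
    by (meson mult_carrier_mat to_mat_carrier)
qed

lemma to_mat_fone [simp]: "to_mat n n (fone n) = (1\<^sub>m n :: 'k::comm_ring_1 mat)"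
  using of_mat_inject[of "to_mat n n (fone n)" n n "1\<^sub>m n :: 'k mat"]
  by (simp add: of_mat_to_mat)

lemma of_mat_transpose: "of_mat (transpose_mat A) = ftranspose (of_mat A)"
  by (rule fmat_eqI) (auto simp: entry_of_mat entry_ftranspose)

lemma of_mat_kronecker:
  assumes "B \<in> carrier_mat d d"
  shows "of_mat (kronecker A B) = fkron d (of_mat A) (of_mat B)"
proof (cases "d = 0")
  case True
  then have "of_mat B = 0" using assms by (intro fmat_eqI) (auto simp: entry_of_mat entry_zero)
  with True assms show ?thesis
    by (intro fmat_eqI) (auto simp: kronecker_def entry_of_mat entry_zero)
next
  case False
  with assms have "i div d < n \<longleftrightarrow> i < n * d" for i n
    by (simp add: div_less_iff_less_mult)
  with False assms show ?thesis
    by (intro fmat_eqI) (auto simp: kronecker_def entry_of_mat entry_fkron)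
qed

section \<open>Singular matrices, nilpotent matrices and idempotents\<close>

definition funit :: "nat \<Rightarrow> 'k::comm_ring_1 fmat \<Rightarrow> bool" where
  "funit d x \<longleftrightarrow> shaped d d x \<and> (\<exists>y. shaped d d y \<and> x * y = fone d \<and> y * x = fone d)"

lemma fone_left_right:
  fixes x :: "'k::field fmat"
  assumes "shaped d d x" "shaped d d y" "x * y = fone d"
  shows "y * x = fone d"
proof -
  have "to_mat d d x * to_mat d d y = 1\<^sub>m d"
    using assms by (metis to_mat_fone to_mat_times)
  then have "to_mat d d y * to_mat d d x = 1\<^sub>m d"
    by (rule mat_mult_left_right_inverse[OF to_mat_carrier to_mat_carrier])
  then show ?thesis using assms
    by (metis of_mat_one of_mat_to_mat shaped_times to_mat_times)
qed

lemma funitI: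
  fixes x :: "'k::field fmat"
  shows "shaped d d x \<Longrightarrow> shaped d d y \<Longrightarrow> x * y = fone d \<Longrightarrow> funit d x"
  unfolding funit_def using fone_left_right by blast

lemma funitI':
  fixes x :: "'k::field fmat"
  shows "shaped d d x \<Longrightarrow> shaped d d y \<Longrightarrow> y * x = fone d \<Longrightarrow> funit d x"
  unfolding funit_def using fone_left_right by blast

text \<open>If \<open>m < n\<close>, both factors may be read as \<open>n\<close> by
  \<open>n\<close> matrices; then \<open>y * x\<close> is also the identity of size
  \<open>n\<close>, although it vanishes outside the first \<open>m\<close> rows and
  columns.\<close>

lemma fone_factor_le:
  fixes x :: "'k::field fmat"
  assumes x: "shaped n m x" and y: "shaped m n y" and xy: "x * y = fone n"
  shows "n \<le> m"
proof (rule ccontr)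
  assume "\<not> n \<le> m"
  then have nm: "m \<le> n" "m < n" by simp_all
  then have s: "shaped n n x" "shaped n n y" using x y by (auto simp: shaped_iff)
  have "y * x = fone n" by (rule fone_left_right[OF s xy])
  moreover have "shaped m m (y * x)" using x y shaped_times by blast
  ultimately have "fone n * fone m = (fone n :: 'k fmat)" by (metis shapedD(2))
  then have "entry (fone n * fone m :: 'k fmat) m m = entry (fone n) m m" by simp
  then show False using nm by (simp add: entry_times_diagc entry_diagc)
qed

text \<open>Vectors are replaced by one-column matrices. The value \<open>l = 0\<close> serves
  singular matrices, a root of the characteristic polynomial serves eigenvalues.\<close>

lemma eigenvector_column:
  fixes x :: "'k::field fmat"
  assumes x: "shaped d d x" and w: "w \<in> carrier_vec d" "w \<noteq> 0\<^sub>v d" "to_mat d d x *\<^sub>v w = l \<cdot>\<^sub>v w"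
  obtains v where "shaped d 1 v" "v \<noteq> 0" "x * v = diagc d l * v"
proof -
  define W where "W = mat d 1 (\<lambda>(i, j). w $ i)"
  have W: "W \<in> carrier_mat d 1" by (simp add: W_def)
  have cW: "col W 0 = w" using w by (intro eq_vecI) (auto simp: W_def)
  have "x * of_mat W = diagc d l * of_mat W"
  proof (rule fmat_eqI)
    fix i j
    have "x * of_mat W = of_mat (to_mat d d x * W)"
      using of_mat_times[OF to_mat_carrier W, of d x] x by (simp add: of_mat_to_mat)
    moreover have "(to_mat d d x * W) $$ (i, 0) = l * w $ i" if "i < d"
    proof -
      have "(to_mat d d x * W) $$ (i, 0) = (to_mat d d x *\<^sub>v w) $ i" using that W cW by simp
      then show ?thesis using that w by simp
    qed
    ultimately show "entry (x * of_mat W) i j = entry (diagc d l * of_mat W) i j"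
      using W by (auto simp: entry_of_mat entry_diagc_times W_def)
  qed
  moreover have "of_mat W \<noteq> 0"
  proof
    assume z: "of_mat W = 0"
    have "w = 0\<^sub>v d"
    proof (rule eq_vecI)
      fix i assume i: "i < dim_vec (0\<^sub>v d :: 'k vec)"
      have "entry (of_mat W) i 0 = 0" by (simp add: z entry_zero)
      then show "w $ i = 0\<^sub>v d $ i" using i by (simp add: entry_of_mat W_def)
    qed (use w in simp)
    with w show False by simp
  qed
  ultimately show thesis using that shaped_of_mat[OF W] by blast
qed

lemma singular_column:
  fixes x :: "'k::field fmat"
  assumes x: "shaped d d x" and nu: "\<not> funit d x"
  obtains v where "shaped d 1 v" "v \<noteq> 0" "x * v = 0"
proof -
  let ?A = "to_mat d d x"
  have "det ?A = 0"
  proof (rule ccontr)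
    assume "det ?A \<noteq> 0"
    then obtain B where B: "B \<in> carrier_mat d d" "?A * B = 1\<^sub>m d"
      using det_non_zero_imp_unit[OF to_mat_carrier] by (auto simp: Units_def ring_mat_def)
    then have "x * of_mat B = fone d"
      using x by (metis of_mat_one of_mat_times of_mat_to_mat to_mat_carrier)
    then show False using nu funitI[OF x shaped_of_mat[OF B(1)]] by simp
  qed
  then obtain w where w: "w \<in> carrier_vec d" "w \<noteq> 0\<^sub>v d" "?A *\<^sub>v w = 0\<^sub>v d"
    using det_0_iff_vec_prod_zero_field[OF to_mat_carrier] by blast
  then have "?A *\<^sub>v w = 0 \<cdot>\<^sub>v w" by auto
  from eigenvector_column[OF x w(1,2) this] show thesis using that by auto
qed

text \<open>Some column \<open>a\<close> of \<open>x\<close> is a combination of the other columns, and \<open>s\<close> omits it.\<close>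

lemma singular_factor:
  fixes x :: "'k::field fmat"
  assumes x: "shaped (Suc d) (Suc d) x" and nu: "\<not> funit (Suc d) x"
  obtains c r where "shaped (Suc d) d c" "shaped d (Suc d) r" "x = c * r"
proof -
  obtain v where v: "shaped (Suc d) 1 v" "v \<noteq> 0" "x * v = 0" using singular_column[OF assms] .
  then obtain a where a: "a < Suc d" "entry v a 0 \<noteq> 0"
    by (metis fmat_eqI entry_zero shaped_entry leI less_one)
  \<comment> \<open>Enumerates the indices other than \<open>a\<close>; \<open>s\<close> and
    \<open>s'\<close> are the corresponding inclusion and projection.\<close>
  define sg where "sg = (\<lambda>j. if j < a then j else Suc j)"
  define s :: "'k fmat" where "s = (\<Sum>j<d. munit (sg j) j)"
  define s' :: "'k fmat" where "s' = (\<Sum>j<d. munit j (sg j))"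
  \<comment> \<open>The projection with kernel spanned by \<open>v\<close> whose row
    \<open>a\<close> vanishes. Since \<open>x * v = 0\<close> it does not change \<open>x\<close>,
    and the vanishing row lets it factor through the remaining coordinates.\<close>
  define z where "z = fone (Suc d) - v * diagc 1 (1 / entry v a 0) * munit 0 a"
  have im: "sg ` {..<d} = {..<Suc d} - {a}"
  proof
    show "sg ` {..<d} \<subseteq> {..<Suc d} - {a}" using a by (auto simp: sg_def)
    show "{..<Suc d} - {a} \<subseteq> sg ` {..<d}"
    proof
      fix i assume i: "i \<in> {..<Suc d} - {a}"
      show "i \<in> sg ` {..<d}"
      proof (cases "i < a")
        case True
        then have "i = sg i" "i < d" using a by (auto simp: sg_def)
        then show ?thesis by blast
      next
        case False
        then have "i = sg (i - 1)" "i - 1 < d" using i by (auto simp: sg_def)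
        then show ?thesis by blast
      qed
    qed
  qed
  have inj: "inj_on sg {..<d}" by (auto simp: sg_def inj_on_def split: if_splits)
  have ss: "s * s' = fone (Suc d) - munit a a"
  proof -
    have "s * s' = (\<Sum>j<d. \<Sum>i<d. if j = i then munit (sg j) (sg i) else 0)"
      unfolding s_def s'_def sum_product by (simp add: munit_times)
    also have "\<dots> = (\<Sum>j<d. munit (sg j) (sg j))" by (simp add: sum.delta)
    also have "\<dots> = (\<Sum>i\<in>{..<Suc d} - {a}. munit i i)"
      by (simp add: im[symmetric] sum.reindex[OF inj] del: lessThan_Suc)
    also have "\<dots> = fone (Suc d) - munit a a"
      using a unfolding fone_eq_sum by (subst sum_diff1) (auto simp del: lessThan_Suc)
    finally show ?thesis .
  qed
  have xz: "x * z = x"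
    using v(3) shapedD(2)[OF x] by (simp add: z_def right_diff_distrib flip: mult.assoc)
  have az: "munit a a * z = 0"
  proof (rule fmat_eqI)
    fix i j
    have 1: "entry (munit a a * y) i j = (if i = a then entry y a j else 0)" for y :: "'k fmat"
    proof -
      have "entry (munit a a * y) i j = (\<Sum>k<Suc a. entry (munit a a) i k * entry y k j)"
        by (rule entry_times_left) (auto simp: entry_munit)
      also have "\<dots> = (\<Sum>k<Suc a. if k = a then (if i = a then entry y a j else 0) else 0)"
        by (rule sum.cong) (auto simp: entry_munit)
      finally show ?thesis by simp
    qed
    have 2: "entry (v * diagc 1 (1 / entry v a 0) * munit 0 a) a j = (if j = a then 1 else 0)"
    proof -
      have "entry (v * diagc 1 (1 / entry v a 0) * munit 0 a) a j
        = (\<Sum>k<1. entry (v * diagc 1 (1 / entry v a 0)) a k * entry (munit 0 a :: 'k fmat) k j)"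
        by (rule entry_times_left) (auto simp: entry_times_diagc)
      then show ?thesis using a by (simp add: entry_munit entry_times_diagc)
    qed
    show "entry (munit a a * z) i j = entry 0 i j"
      using a(1) unfolding 1 z_def entry_minus 2 by (auto simp: entry_diagc entry_zero)
  qed
  have zs: "shaped (Suc d) (Suc d) z"
  proof -
    have "shaped (Suc d) (Suc d) (v * diagc 1 (1 / entry v a 0) * munit 0 a)"
      by (rule shaped_times[OF shaped_times[OF v(1) shaped_diagc] shaped_munit]) (use a in auto)
    then show ?thesis unfolding z_def by (intro shaped_minus) auto
  qed
  have "x * s * (s' * z) = x * (s * s' * z)" by (simp add: mult.assoc)
  also have "\<dots> = x" using az xz shapedD(1)[OF zs] by (simp add: ss left_diff_distrib)
  finally have "x = x * s * (s' * z)" by simp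
  moreover have "shaped (Suc d) d (x * s)"
  proof (rule shaped_times[OF x])
    show "shaped (Suc d) d s" unfolding s_def
      using im by (intro shaped_sum shaped_munit) auto
  qed
  moreover have "shaped d (Suc d) (s' * z)"
  proof (rule shaped_times[OF _ zs])
    show "shaped d (Suc d) s'" unfolding s'_def
      using im by (intro shaped_sum shaped_munit) auto
  qed
  ultimately show thesis using that by blast
qed

text \<open>There is no unit, so powers start at exponent one: \<open>fpow x n\<close> is the power \<open>n + 1\<close> of \<open>x\<close>.\<close>

primrec fpow :: "'a::ring \<Rightarrow> nat \<Rightarrow> 'a" where
  "fpow x 0 = x"
| "fpow x (Suc n) = x * fpow x n"

text \<open>The two exponents are \<open>n + 1\<close> and \<open>m + 1\<close>, whence the
  successor in the index.\<close>

lemma fpow_add: "fpow x n * fpow x m = fpow x (Suc (n + m))"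
  by (induction n) (auto simp: mult.assoc)

text \<open>Carries nilpotency from \<open>c * r\<close> over to \<open>r * c\<close>, at the cost
  of one more factor.\<close>

lemma fpow_swap: "fpow (r * c) (Suc n) = r * fpow (c * r) n * c"
  by (induction n) (auto simp: mult.assoc)

section \<open>Nilpotent matrices and Fitting's lemma\<close>

definition fnil :: "'a::ring \<Rightarrow> bool" where
  "fnil x \<longleftrightarrow> (\<exists>n. fpow x n = 0)"

text \<open>The last nonzero power of \<open>x\<close> is annihilated by \<open>x\<close>; if
  \<open>x\<close> itself is zero, the idempotent \<open>e\<close>, which plays the role of the
  identity, is taken instead.\<close>

lemma fnil_right_kernel:
  assumes "fnil x" and "e * x = x" "x * e = x" and "e \<noteq> 0" "e * e = e"
  obtains v where "v \<noteq> 0" "x * v = 0" "e * v = v"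
proof -
  define n where "n = (LEAST n. fpow x n = 0)"
  have n: "fpow x n = 0" using assms(1) unfolding fnil_def n_def by (rule LeastI_ex)
  show thesis
  proof (cases n)
    case 0
    then show thesis using n assms that[of e] by simp
  next
    case (Suc m)
    then have "fpow x m \<noteq> 0" unfolding n_def using not_less_Least by (metis lessI)
    moreover have "e * fpow x m = fpow x m" using assms(2) by (cases m) (auto simp flip: mult.assoc)
    ultimately show thesis using n Suc that[of "fpow x m"] by simp
  qed
qed

lemma fnil_not_funit:
  assumes "fnil x" "funit d x" "d \<noteq> 0"
  shows False
proof -
  obtain y where y: "shaped d d x" "y * x = fone d" using assms(2) by (auto simp: funit_def)
  obtain v where "v \<noteq> 0" "x * v = 0" "fone d * v = v"
    using fnil_right_kernel[OF assms(1) shapedD[OF y(1)]] assms(3) by auto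
  then show False using y by (metis mult.assoc mult_zero_right)
qed

text \<open>\<open>fone d - x\<close> acts as the identity on the kernel of \<open>x\<close>, which
  is nonzero, so none of its powers vanishes.\<close>

lemma fnil_complement_not_fnil:
  fixes x :: "'k::comm_ring_1 fmat"
  assumes "fnil x" "fnil (fone d - x)" "shaped d d x" "d \<noteq> 0"
  shows False
proof -
  obtain v where v: "v \<noteq> 0" "x * v = 0" "fone d * v = v"
    using fnil_right_kernel[OF assms(1) shapedD[OF assms(3)]] assms(4) by auto
  have "fpow (fone d - x) n * v = v" for n
    by (induction n) (simp_all add: v left_diff_distrib mult.assoc)
  then show False using assms(2) v unfolding fnil_def by (metis mult_zero_left)
qed

text \<open>Induction on the size: a nilpotent matrix is singular, so \<open>x = c * r\<close>
  through dimension \<open>d\<close>; the smaller matrix \<open>r * c\<close> is again nilpotent and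
  has the same trace.\<close>

lemma fnil_ftrace:
  fixes x :: "'k::field fmat"
  shows "shaped d d x \<Longrightarrow> fnil x \<Longrightarrow> ftrace x = 0"
proof (induction d arbitrary: x)
  case 0
  then have "fone 0 * x = x" by (auto simp only: shaped_def)
  then show ?case by simp
next
  case (Suc d)
  have "\<not> funit (Suc d) x" using fnil_not_funit Suc.prems by blast
  then obtain c r where cr: "shaped (Suc d) d c" "shaped d (Suc d) r" "x = c * r"
    using singular_factor Suc.prems by blast
  obtain n where "fpow x n = 0" using Suc.prems by (auto simp: fnil_def)
  then have "fpow (r * c) (Suc n) = 0" unfolding fpow_swap cr by simp
  then have "fnil (r * c)" by (auto simp: fnil_def simp del: fpow.simps)
  then have "ftrace (r * c) = 0" using Suc.IH[of "r * c"] cr shaped_times by blast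
  then show ?case by (simp add: cr ftrace_commute)
qed

text \<open>Among all factorizations of powers of \<open>x\<close>, take one of least rank: if \<open>r * c\<close> were singular, then
  \<open>(c * r)\<^sup>2 = c * (r * c) * r\<close> would have a smaller one.\<close>

lemma least_rank_power:
  fixes x :: "'k::field fmat"
  assumes x: "shaped d d x"
  obtains n m c r where "shaped d n c" "shaped n d r" "fpow x m = c * r" "funit n (r * c)"
proof -
  define P where "P = (\<lambda>n. \<exists>m c r. shaped d n c \<and> shaped n d r \<and> fpow x m = c * r)"
  have "P d" unfolding P_def
    by (intro exI[of _ 0] exI[of _ "fone d"] exI[of _ x]) (simp add: x shapedD[OF x])
  define n where "n = (LEAST n. P n)"
  have "P n" unfolding n_def using \<open>P d\<close> by (rule LeastI)
  then obtain m c r where mcr: "shaped d n c" "shaped n d r" "fpow x m = c * r" unfolding P_def by blast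
  have rc: "shaped n n (r * c)" using mcr shaped_times by blast
  have "funit n (r * c)"
  proof (rule ccontr)
    assume nu: "\<not> funit n (r * c)"
    show False
    proof (cases n)
      case 0
      then show ?thesis using nu rc by (simp add: funit_def) (metis rc 0 fone_zero mult_zero_left shaped_def shaped_zero)
    next
      case (Suc l)
      obtain c' r' where cr': "shaped (Suc l) l c'" "shaped l (Suc l) r'" "r * c = c' * r'"
        using singular_factor[of l "r * c"] rc nu Suc by metis
      have "fpow x (Suc (m + m)) = c * (r * c) * r" using mcr(3) by (simp only: fpow_add[symmetric] mult.assoc)
      also have "\<dots> = (c * c') * (r' * r)" by (simp add: cr' mult.assoc)
      finally have "P l" unfolding P_def using cr'(1,2) mcr(1,2) Suc shaped_times by blast
      then show False using Suc unfolding n_def by (metis not_less_Least lessI)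
    qed
  qed
  with mcr show thesis by (rule that)
qed

text \<open>Below, \<open>z\<close> is the group inverse of \<open>w\<close>, so it lies in the bicommutant of \<open>w\<close>.\<close>

lemma fitting:
  fixes x :: "'k::field fmat"
  assumes x: "shaped d d x"
  obtains m z where "shaped d d z" "fpow x m * z = z * fpow x m" "fpow x m * z * fpow x m = fpow x m"
    "z * fpow x m * z = z"
    "\<And>y. y * fpow x m = fpow x m * y \<Longrightarrow> fpow x m * z * y = y * (fpow x m * z)"
proof -
  obtain n m c r where mcr: "shaped d n c" "shaped n d r" "fpow x m = c * r" "funit n (r * c)"
    using least_rank_power[OF x] .
  from mcr(4) obtain f where f: "shaped n n f" "r * c * f = fone n" "f * (r * c) = fone n"
    unfolding funit_def by blast
  define w where "w = c * r"
  \<comment> \<open>The factor \<open>f * f\<close> is chosen so that one \<open>f\<close> cancels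
    the \<open>r * c\<close> arising in \<open>w * z\<close> and in \<open>z * w\<close>; both
    products become the idempotent \<open>c * f * r\<close>.\<close>
  define z where "z = c * f * f * r"
  have c1: "c * fone n = c" and r1: "fone n * r = r" using mcr shapedD by blast+
  have f1: "fone n * f = f" "f * fone n = f" using f shapedD by blast+
  have wz: "w * z = c * f * r"
  proof -
    have "w * z = c * (r * c * f) * f * r" by (simp add: w_def z_def mult.assoc)
    then show ?thesis by (simp add: f c1)
  qed
  have zw: "z * w = c * f * r"
  proof -
    have "z * w = c * f * (f * (r * c)) * r" by (simp add: w_def z_def mult.assoc)
    then show ?thesis by (simp add: f f1 mult.assoc r1)
  qed
  have wzw: "w * z * w = w"
  proof -
    have "w * z * w = c * (f * (r * c)) * r" unfolding wz by (simp add: w_def mult.assoc)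
    then show ?thesis by (simp add: f c1 w_def)
  qed
  have zwz: "z * w * z = z"
  proof -
    have "z * w * z = c * (f * (r * c)) * f * f * r" unfolding zw by (simp add: z_def mult.assoc)
    then show ?thesis by (simp add: f c1 z_def)
  qed
  \<comment> \<open>With \<open>e = w * z\<close>, the product \<open>e * y * e\<close> is evaluated
    twice, once as \<open>y * e\<close> and once as \<open>e * y\<close>, each time by moving
    \<open>y\<close> past a factor \<open>w\<close> and collapsing \<open>w * z * w\<close> to
    \<open>w\<close>.\<close>
  have bic: "w * z * y = y * (w * z)" if y: "y * w = w * y" for y
  proof -
    have "w * z * y * (w * z) = w * z * (y * w) * z" by (simp only: mult.assoc)
    also have "\<dots> = (w * z * w) * y * z" by (simp only: y) (simp only: mult.assoc)
    also have "\<dots> = y * (w * z)" by (simp only: wzw y[symmetric]) (simp only: mult.assoc)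
    finally have 1: "w * z * y * (w * z) = y * (w * z)" .
    have "w * z * y * (w * z) = z * w * y * (z * w)" by (simp only: wz zw)
    also have "\<dots> = z * (w * y) * (z * w)" by (simp only: mult.assoc)
    also have "\<dots> = z * y * (w * z * w)" by (simp only: y[symmetric]) (simp only: mult.assoc)
    also have "\<dots> = z * (y * w)" by (simp only: wzw) (simp only: mult.assoc)
    also have "\<dots> = z * w * y" by (simp only: y) (simp only: mult.assoc)
    also have "\<dots> = w * z * y" by (simp only: wz zw)
    finally show ?thesis using 1 by simp
  qed
  show thesis
  proof (rule that[of z m])
    show "shaped d d z" unfolding z_def using mcr f by (intro shaped_times)
    show "fpow x m * z = z * fpow x m" using wz zw by (simp add: mcr(3) w_def)
    show "fpow x m * z * fpow x m = fpow x m" using wzw by (simp add: mcr(3) w_def)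
    show "z * fpow x m * z = z" using zwz by (simp add: mcr(3) w_def)
    show "fpow x m * z * y = y * (fpow x m * z)" if "y * fpow x m = fpow x m * y" for y
      using bic[of y] that by (simp add: mcr(3) w_def)
  qed
qed

text \<open>All powers of \<open>e\<close> equal \<open>e\<close>, so the least rank factorization
  is one of \<open>e\<close> itself. There \<open>h = r * c\<close> is invertible, and idempotency
  of \<open>e\<close> gives \<open>h * h * h = h * h\<close>, hence \<open>h\<close> is the
  identity.\<close>

lemma idempotent_split:
  fixes e :: "'k::field fmat"
  assumes e: "shaped d d e" "e * e = e"
  obtains n c r where "shaped d n c" "shaped n d r" "e = c * r" "r * c = fone n"
proof -
  obtain n m c r where cr: "shaped d n c" "shaped n d r" "fpow e m = c * r" "funit n (r * c)"
    using least_rank_power[OF e(1)] .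
  have "fpow e m = e" by (induction m) (simp_all add: e(2))
  with cr(3) have ecr: "e = c * r" by simp
  obtain f where f: "shaped n n f" "r * c * f = fone n"
    using cr(4) unfolding funit_def by blast
  have rc: "shaped n n (r * c)" using shaped_times[OF cr(2,1)] .
  have "r * c * (r * c) * (r * c) = r * (e * e) * c" by (simp add: ecr mult.assoc)
  also have "\<dots> = r * c * (r * c)" unfolding e(2) by (simp add: ecr mult.assoc)
  finally have 3: "r * c * (r * c) * (r * c) = r * c * (r * c)" .
  define h where "h = r * c"
  have h: "h * h * h = h * h" "h * f = fone n" "h * fone n = h"
    using 3 f(2) shapedD(2)[OF rc] by (simp_all add: h_def)
  have "h * h * (h * f) = h * h * h * f" by (simp only: mult.assoc)
  also have "\<dots> = h * (h * f)" by (simp only: h(1)) (simp only: mult.assoc)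
  finally have "h * (h * fone n) = h * fone n" by (simp only: h(2) mult.assoc)
  then have "h * h = h" by (simp only: h(3))
  then have "h * (h * f) = h * f" by (simp only: mult.assoc[symmetric])
  then have "r * c = fone n" using h by (simp add: h_def)
  with cr(1,2) ecr show thesis using that by blast
qed

text \<open>Algebraic closure enters here: the characteristic polynomial has positive degree, hence
  a root. The value \<open>l\<close> becomes the scalar part of an endomorphism.\<close>

lemma eigenvalue_exists:
  fixes x :: "'k::alg_closed_field fmat"
  assumes x: "shaped d d x" and "d \<noteq> 0"
  obtains l where "\<not> funit d (x - diagc d l)"
proof -
  let ?A = "to_mat d d x"
  have "degree (char_poly ?A) = d" using degree_monic_char_poly[OF to_mat_carrier] by blast
  then obtain l where "poly (char_poly ?A) l = 0"
    using alg_closed_imp_poly_has_root[of "char_poly ?A"] assms(2) by auto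
  then have "eigenvalue ?A l" using eigenvalue_root_char_poly[OF to_mat_carrier] by blast
  then obtain w where "w \<in> carrier_vec d" "w \<noteq> 0\<^sub>v d" "?A *\<^sub>v w = l \<cdot>\<^sub>v w"
    by (auto simp: eigenvalue_def eigenvector_def)
  then obtain v where v: "shaped d 1 v" "v \<noteq> 0" "x * v = diagc d l * v"
    using eigenvector_column[OF x] by blast
  then have "(x - diagc d l) * v = 0" by (simp add: left_diff_distrib)
  then have "\<not> funit d (x - diagc d l)"
    using v(2) shapedD(1)[OF v(1)] by (metis funit_def mult.assoc mult_zero_right)
  then show thesis by (rule that)
qed

section \<open>Homomorphisms and decompositions\<close>

definition rho :: "('g, 'k::field) kG_module \<Rightarrow> 'g \<Rightarrow> 'k fmat" where
  "rho M g = of_mat (act M g)"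

abbreviation idm :: "('g, 'k::field) kG_module \<Rightarrow> 'k fmat" where
  "idm M \<equiv> fone (mdim M)"

text \<open>Taking \<open>H\<close> smaller than the group gives the \<open>kH\<close>-homomorphisms
  from which relative traces are formed. Matrices act on columns, so the target dimension comes
  first.\<close>

definition hom_on :: "'g set \<Rightarrow> ('g, 'k::field) kG_module \<Rightarrow> ('g, 'k) kG_module \<Rightarrow> 'k fmat \<Rightarrow> bool" where
  "hom_on H M N x \<longleftrightarrow> shaped (mdim N) (mdim M) x \<and> (\<forall>h\<in>H. rho N h * x = x * rho M h)"

lemma hom_onD: "hom_on H M N x \<Longrightarrow> shaped (mdim N) (mdim M) x"
  "hom_on H M N x \<Longrightarrow> h \<in> H \<Longrightarrow> rho N h * x = x * rho M h"
  by (auto simp: hom_on_def)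

lemma hom_on_mono: "hom_on H M N x \<Longrightarrow> K \<subseteq> H \<Longrightarrow> hom_on K M N x"
  by (auto simp: hom_on_def)

lemma hom_on_id_left: "hom_on H M N x \<Longrightarrow> idm N * x = x"
  and hom_on_id_right: "hom_on H M N x \<Longrightarrow> x * idm M = x"
  by (auto simp: hom_on_def shaped_def)

lemma hom_on_comp: "hom_on H M N x \<Longrightarrow> hom_on H L M y \<Longrightarrow> hom_on H L N (x * y)"
  unfolding hom_on_def by (metis mult.assoc shaped_times)

lemma hom_on_zero [simp]: "hom_on H M N 0"
  by (simp add: hom_on_def)

lemma hom_on_plus: "hom_on H M N x \<Longrightarrow> hom_on H M N y \<Longrightarrow> hom_on H M N (x + y)"
  by (simp add: hom_on_def shaped_plus algebra_simps)

lemma hom_on_minus: "hom_on H M N x \<Longrightarrow> hom_on H M N y \<Longrightarrow> hom_on H M N (x - y)"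
  by (simp add: hom_on_def shaped_minus algebra_simps)

lemma hom_on_sum: "(\<And>a. a \<in> A \<Longrightarrow> hom_on H M N (f a)) \<Longrightarrow> hom_on H M N (sum f A)"
  by (induction A rule: infinite_finite_induct) (auto simp: hom_on_plus)

definition mk_module :: "nat \<Rightarrow> ('g \<Rightarrow> 'k::field fmat) \<Rightarrow> ('g, 'k) kG_module" where
  "mk_module d r = \<lparr>mdim = d, act = (\<lambda>g. to_mat d d (r g))\<rparr>"

lemma mdim_mk_module [simp]: "mdim (mk_module d r) = d"
  by (simp add: mk_module_def)

lemma rho_mk_module: "shaped d d (r g) \<Longrightarrow> rho (mk_module d r) g = r g"
  by (simp add: mk_module_def rho_def of_mat_to_mat)

section \<open>Modules, homomorphisms and images of idempotents\<close>

locale finite_group = group G for G (structure) +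
  assumes fin: "finite (carrier G)"
begin

abbreviation "kmod \<equiv> is_kG_module G"
abbreviation "ghom \<equiv> hom_on (carrier G)"

lemma rho_shaped: "kmod M \<Longrightarrow> g \<in> carrier G \<Longrightarrow> shaped (mdim M) (mdim M) (rho M g)"
  by (simp add: is_kG_module_def rho_def shaped_of_mat)

lemma rho_one: "kmod M \<Longrightarrow> rho M \<one> = idm M"
  by (simp add: is_kG_module_def rho_def)

lemma rho_mult: "kmod M \<Longrightarrow> g \<in> carrier G \<Longrightarrow> h \<in> carrier G \<Longrightarrow> rho M (g \<otimes> h) = rho M g * rho M h"
  by (simp add: is_kG_module_def rho_def) (metis of_mat_times)

lemma rho_inv_right: "kmod M \<Longrightarrow> g \<in> carrier G \<Longrightarrow> rho M g * rho M (inv g) = idm M"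
  and rho_inv_left: "kmod M \<Longrightarrow> g \<in> carrier G \<Longrightarrow> rho M (inv g) * rho M g = idm M"
  by (simp_all add: rho_mult[symmetric] rho_one)

lemma rho_id_left: "kmod M \<Longrightarrow> g \<in> carrier G \<Longrightarrow> idm M * rho M g = rho M g"
  and rho_id_right: "kmod M \<Longrightarrow> g \<in> carrier G \<Longrightarrow> rho M g * idm M = rho M g"
  using rho_shaped shapedD by blast+

lemma kmodI:
  assumes "\<And>g. g \<in> carrier G \<Longrightarrow> act M g \<in> carrier_mat (mdim M) (mdim M)"
    and "rho M \<one> = idm M"
    and "\<And>g h. g \<in> carrier G \<Longrightarrow> h \<in> carrier G \<Longrightarrow> rho M (g \<otimes> h) = rho M g * rho M h"
  shows "kmod M"
proof -
  have "act M \<one> = 1\<^sub>m (mdim M)"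
    using of_mat_inject[OF assms(1)[of \<one>] one_carrier_mat] assms(2) by (simp add: rho_def)
  moreover have "act M (g \<otimes> h) = act M g * act M h" if "g \<in> carrier G" "h \<in> carrier G" for g h
  proof -
    have "of_mat (act M (g \<otimes> h)) = of_mat (act M g * act M h)"
      using assms(3)[OF that] of_mat_times[OF assms(1)[OF that(1)] assms(1)[OF that(2)]] by (simp add: rho_def)
    then show ?thesis
      using of_mat_inject[OF assms(1)[of "g \<otimes> h"] mult_carrier_mat[OF assms(1)[OF that(1)] assms(1)[OF that(2)]]]
        that by simp
  qed
  ultimately show ?thesis using assms(1) by (auto simp: is_kG_module_def)
qed

lemma kmod_mk_module:
  assumes "\<And>g. g \<in> carrier G \<Longrightarrow> shaped d d (r g)" "r \<one> = fone d"
    and "\<And>g h. g \<in> carrier G \<Longrightarrow> h \<in> carrier G \<Longrightarrow> r (g \<otimes> h) = r g * r h"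
  shows "kmod (mk_module d r)"
proof (rule kmodI)
  show "rho (mk_module d r) \<one> = idm (mk_module d r)" using rho_mk_module[of d r \<one>] assms by simp
  fix g h assume g: "g \<in> carrier G"
  show "act (mk_module d r) g \<in> carrier_mat (mdim (mk_module d r)) (mdim (mk_module d r))"
    by (simp add: mk_module_def)
  assume h: "h \<in> carrier G"
  show "rho (mk_module d r) (g \<otimes> h) = rho (mk_module d r) g * rho (mk_module d r) h"
    using rho_mk_module[of d r, OF assms(1)] g h by (simp add: assms(3))
qed

lemma ghom_id: "kmod M \<Longrightarrow> ghom M M (idm M)"
  by (simp add: hom_on_def rho_id_left rho_id_right)

lemma ghom_diagc: "kmod M \<Longrightarrow> ghom M M (diagc (mdim M) c)"
  by (simp add: hom_on_def diagc_central rho_shaped)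

text \<open>Trades an invertible matrix for two mutually inverse homomorphisms. The inverse matrix
  commutes with the action automatically; conversely the two factorizations of the identity force
  equal dimensions.\<close>

lemma kG_iso_iff:
  assumes M: "kmod M" and N: "kmod N"
  shows "kG_iso G M N \<longleftrightarrow> (\<exists>f g. ghom M N f \<and> ghom N M g \<and> g * f = idm M \<and> f * g = idm N)"
    (is "?l \<longleftrightarrow> ?r")
proof
  assume ?l
  then obtain P where d: "mdim M = mdim N" and P: "P \<in> carrier_mat (mdim N) (mdim M)" "invertible_mat P"
    and c: "\<And>g. g \<in> carrier G \<Longrightarrow> P * act M g = act N g * P"
    by (auto simp: kG_iso_def)
  obtain Q where Q: "P * Q = 1\<^sub>m (mdim N)" "Q * P = 1\<^sub>m (dim_row Q)"
    using P by (auto simp: invertible_mat_def inverts_mat_def)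
  have "dim_col (P * Q) = mdim N" "dim_col (Q * P) = dim_row Q" by (simp_all add: Q)
  then have Qc: "Q \<in> carrier_mat (mdim M) (mdim N)" using P d by auto
  have aM: "act M g \<in> carrier_mat (mdim M) (mdim M)" and aN: "act N g \<in> carrier_mat (mdim N) (mdim N)"
    if "g \<in> carrier G" for g
    using M N that by (auto simp: is_kG_module_def)
  have 1: "ghom M N (of_mat P)" unfolding hom_on_def rho_def
    by (simp add: shaped_of_mat[OF P(1)] c flip: of_mat_times[OF P(1) aM] of_mat_times[OF aN P(1)])
  have QP: "of_mat Q * of_mat P = idm M" "of_mat P * of_mat Q = idm N"
    using Q Qc by (simp_all flip: of_mat_times[OF P(1) Qc] of_mat_times[OF Qc P(1)])
  have "rho M g * of_mat Q = of_mat Q * rho N g" if "g \<in> carrier G" for g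
  proof -
    have "rho M g * of_mat Q = of_mat Q * of_mat P * rho M g * of_mat Q"
      using rho_id_left[OF M that] by (simp add: QP)
    also have "\<dots> = of_mat Q * (rho N g * of_mat P) * of_mat Q"
      using hom_onD(2)[OF 1 that] by (simp add: mult.assoc)
    also have "\<dots> = of_mat Q * (rho N g * (of_mat P * of_mat Q))" by (simp add: mult.assoc)
    also have "\<dots> = of_mat Q * rho N g" by (simp add: QP rho_id_right[OF N that])
    finally show ?thesis .
  qed
  then have "ghom N M (of_mat Q)" by (simp add: hom_on_def shaped_of_mat[OF Qc])
  with 1 QP show ?r by blast
next
  assume ?r
  then obtain f g where f: "ghom M N f" "ghom N M g" "g * f = idm M" "f * g = idm N" by blast
  have s: "shaped (mdim N) (mdim M) f" "shaped (mdim M) (mdim N) g" using f hom_onD by blast+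
  have d: "mdim M = mdim N" using fone_factor_le[OF s f(4)] fone_factor_le[OF s(2,1) f(3)] by simp
  define P where "P = to_mat (mdim N) (mdim M) f"
  define Q where "Q = to_mat (mdim M) (mdim N) g"
  have PQ: "P * Q = 1\<^sub>m (mdim N)" "Q * P = 1\<^sub>m (mdim M)"
    unfolding P_def Q_def by (simp_all add: s f flip: to_mat_times)
  then have "invertible_mat P"
    unfolding invertible_mat_def inverts_mat_def by (intro conjI exI[of _ Q]) (auto simp: P_def Q_def d)
  moreover have "P * act M h = act N h * P" if h: "h \<in> carrier G" for h
  proof -
    have aM: "act M h \<in> carrier_mat (mdim M) (mdim M)" and aN: "act N h \<in> carrier_mat (mdim N) (mdim N)"
      using M N h by (auto simp: is_kG_module_def)
    have Pc: "P \<in> carrier_mat (mdim N) (mdim M)" by (simp add: P_def)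
    have "of_mat (P * act M h) = of_mat (act N h * P)"
      using hom_onD(2)[OF f(1) h] s
      by (simp add: of_mat_times[OF Pc aM] of_mat_times[OF aN Pc]) (simp add: P_def of_mat_to_mat rho_def)
    then show ?thesis
      using of_mat_inject[OF mult_carrier_mat[OF Pc aM] mult_carrier_mat[OF aN Pc]] by simp
  qed
  ultimately show ?l unfolding kG_iso_def using d by (auto simp: P_def)
qed

text \<open>The image of \<open>e\<close> receives coordinates from \<open>e = c * r\<close> with
  \<open>r * c\<close> the identity, and \<open>g\<close> acts on it by
  \<open>r * rho M g * c\<close>. This is multiplicative because \<open>e\<close> commutes with the
  action and \<open>r * e = r\<close>.\<close>

lemma idempotent_summand:
  assumes M: "kmod M" and e: "ghom M M e" "e * e = e"
  obtains N i p where "kmod N" "ghom N M i" "ghom M N p" "p * i = idm N" "i * p = e"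
proof -
  obtain n c r where cr: "shaped (mdim M) n c" "shaped n (mdim M) r" "e = c * r" "r * c = fone n"
    using idempotent_split[OF hom_onD(1)[OF e(1)] e(2)] .
  define N where "N = mk_module n (\<lambda>g. r * rho M g * c)"
  have sh: "shaped n n (r * rho M g * c)" if "g \<in> carrier G" for g
    using cr rho_shaped[OF M that] by (intro shaped_times)
  have c1: "c * fone n = c" and r1: "fone n * r = r" using cr shapedD by blast+
  have ec: "e * c = c" and re: "r * e = r" using cr c1 r1 by (metis mult.assoc)+
  have eg: "rho M g * e = e * rho M g" if "g \<in> carrier G" for g using hom_onD(2)[OF e(1) that] .
  have rN: "rho N g = r * rho M g * c" if "g \<in> carrier G" for g
    unfolding N_def using rho_mk_module[of n "\<lambda>g. r * rho M g * c" g, OF sh[OF that]] .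
  have "kmod N" unfolding N_def
  proof (rule kmod_mk_module)
    show "r * rho M \<one> * c = fone n" using cr by (simp add: rho_one[OF M] shapedD)
    fix g h assume gh: "g \<in> carrier G" "h \<in> carrier G"
    have "r * rho M g * c * (r * rho M h * c) = r * rho M g * e * (rho M h * c)"
      by (simp add: cr mult.assoc)
    also have "\<dots> = r * e * rho M g * (rho M h * c)" using eg[OF gh(1)] by (simp add: mult.assoc)
    also have "\<dots> = r * rho M (g \<otimes> h) * c" by (simp add: re rho_mult[OF M gh] mult.assoc)
    finally show "r * rho M (g \<otimes> h) * c = r * rho M g * c * (r * rho M h * c)" by simp
  qed (use sh in auto)
  moreover have "ghom N M c"
    unfolding hom_on_def
  proof (intro conjI ballI)
    fix g assume g: "g \<in> carrier G"
    have "c * rho N g = e * rho M g * c" by (simp add: rN[OF g] cr mult.assoc)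
    also have "\<dots> = rho M g * (e * c)" by (simp add: eg[OF g, symmetric] mult.assoc)
    finally show "rho M g * c = c * rho N g" by (simp add: ec)
  qed (simp add: N_def cr)
  moreover have "ghom M N r"
    unfolding hom_on_def
  proof (intro conjI ballI)
    fix g assume g: "g \<in> carrier G"
    have "rho N g * r = r * (rho M g * e)" by (simp add: rN[OF g] cr mult.assoc)
    also have "\<dots> = r * e * rho M g" by (simp add: eg[OF g] mult.assoc)
    finally show "rho N g * r = r * rho M g" by (simp add: re)
  qed (simp add: N_def cr)
  ultimately show thesis using that[of N c r] cr by (simp add: N_def)
qed

end

section \<open>Direct sums through inclusions and projections\<close>

text \<open>The inclusion of \<open>b\<close> coordinates placed after the first \<open>a\<close>;
  its transpose is the corresponding projection.\<close>

definition fshift :: "nat \<Rightarrow> nat \<Rightarrow> 'k::comm_ring_1 fmat" where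
  "fshift a b = (\<Sum>j<b. munit (a + j) j)"

lemma entry_fshift: "entry (fshift a b) i j = (if j < b \<and> i = a + j then 1 else 0)"
proof -
  have "entry (fshift a b) i j = (\<Sum>l<b. if l = j then (if i = a + j then 1 else 0) else (0::'a))"
    unfolding fshift_def entry_sum by (rule sum.cong) (auto simp: entry_munit)
  then show ?thesis by auto
qed

lemma entry_fshift_times:
  "entry (fshift a b * x) i j = (if a \<le> i \<and> i < a + b then entry x (i - a) j else 0)"
proof -
  have "entry (fshift a b * x) i j = (\<Sum>k<b. entry (fshift a b) i k * entry x k j)"
    by (rule entry_times_left) (auto simp: entry_fshift)
  also have "\<dots> = (\<Sum>k<b. if k = i - a then (if a \<le> i then entry x (i - a) j else 0) else 0)"
    by (rule sum.cong) (auto simp: entry_fshift)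
  also have "\<dots> = (if a \<le> i \<and> i < a + b then entry x (i - a) j else 0)" by auto
  finally show ?thesis .
qed

lemma entry_times_fshift_transpose:
  "entry (x * ftranspose (fshift a b)) i j = (if a \<le> j \<and> j < a + b then entry x i (j - a) else 0)"
proof -
  have "entry (x * ftranspose (fshift a b)) i j = entry (fshift a b * ftranspose x) j i"
    by (metis entry_ftranspose ftranspose_times ftranspose_twice)
  then show ?thesis by (simp add: entry_fshift_times entry_ftranspose)
qed

lemma shaped_fshift: "shaped (a + b) b (fshift a b)"
  by (auto simp: shaped_iff entry_fshift)

lemma fshift_transpose_fshift: "ftranspose (fshift a b) * fshift a b = fone b"
proof -
  have "ftranspose (fshift a b) * fshift a b = (\<Sum>i<b. \<Sum>j<b. if i = j then munit i j else (0::'a fmat))"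
    unfolding fshift_def
  proof -
    have t: "ftranspose (\<Sum>j<b. munit (a + j) j) = (\<Sum>j<b. munit j (a + j) :: 'a fmat)"
      by (rule fmat_eqI) (auto simp: entry_sum entry_ftranspose entry_munit intro!: sum.cong)
    show "ftranspose (\<Sum>j<b. munit (a + j) j) * (\<Sum>j<b. munit (a + j) j)
      = (\<Sum>i<b. \<Sum>j<b. if i = j then munit i j else (0::'a fmat))"
      unfolding t sum_product by (simp add: munit_times)
  qed
  then show ?thesis by (simp add: fone_eq_sum)
qed

lemma fshift_fshift_transpose: "fshift a b * ftranspose (fshift a b) = fone (a + b) - fone a"
  by (rule fmat_eqI)
    (auto simp: entry_times_fshift_transpose entry_fshift entry_minus entry_diagc)

lemma fone_fshift: "fone a * fshift a b = 0" "ftranspose (fshift a b) * fone a = 0"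
  by (rule fmat_eqI, auto simp: entry_diagc_times entry_times_diagc entry_fshift entry_ftranspose entry_zero)+

lemma of_mat_four_block:
  fixes A :: "'k::comm_ring_1 mat"
  assumes A: "A \<in> carrier_mat a a" and B: "B \<in> carrier_mat b b"
  shows "of_mat (four_block_mat A (0\<^sub>m a b) (0\<^sub>m b a) B)
    = of_mat A + fshift a b * of_mat B * ftranspose (fshift a b)"
  using A B
  by (intro fmat_eqI)
    (auto simp: entry_of_mat entry_plus entry_times_fshift_transpose entry_fshift_times)

context finite_group
begin

text \<open>Inclusions \<open>i j\<close> and projections \<open>p j\<close> of a direct sum, so
  that the \<open>i j * p j\<close> are orthogonal idempotents with sum the identity. This frees
  arguments about summands from block matrices.\<close>

definition decomposes :: "('a, 'k::field) kG_module \<Rightarrow> ('a, 'k) kG_module list \<Rightarrow> (nat \<Rightarrow> 'k fmat) \<Rightarrow> (nat \<Rightarrow> 'k fmat) \<Rightarrow> bool"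
where
  "decomposes M Ns i p \<longleftrightarrow>
     (\<forall>j<length Ns. ghom (Ns ! j) M (i j) \<and> ghom M (Ns ! j) (p j)) \<and>
     (\<forall>j<length Ns. \<forall>l<length Ns. p j * i l = (if j = l then idm (Ns ! j) else 0)) \<and>
     idm M = (\<Sum>j<length Ns. i j * p j)"

lemma decomposesD:
  assumes "decomposes M Ns i p" "j < length Ns"
  shows "ghom (Ns ! j) M (i j)" "ghom M (Ns ! j) (p j)"
    "l < length Ns \<Longrightarrow> p j * i l = (if j = l then idm (Ns ! j) else 0)"
    "i j * idm (Ns ! j) = i j" "idm (Ns ! j) * p j = p j"
  using assms hom_on_id_right[of _ "Ns ! j" M "i j"] hom_on_id_left[of _ M "Ns ! j" "p j"]
  by (auto simp: decomposes_def)

lemma decomposes_sum: "decomposes M Ns i p \<Longrightarrow> (\<Sum>j<length Ns. i j * p j) = idm M"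
  by (simp add: decomposes_def)

lemma direct_sum_Cons:
  fixes N :: "('a, 'k::field) kG_module"
  assumes N: "kmod N" and D: "kmod (direct_sum Ns)"
  defines "a \<equiv> mdim N" and "b \<equiv> mdim (direct_sum Ns :: ('a, 'k) kG_module)"
  shows "mdim (direct_sum (N # Ns)) = a + b"
    and "g \<in> carrier G \<Longrightarrow> rho (direct_sum (N # Ns)) g
      = rho N g + fshift a b * rho (direct_sum Ns) g * ftranspose (fshift a b)"
    and "kmod (direct_sum (N # Ns))"
proof -
  let ?s = "fshift a b :: 'k fmat" and ?t = "ftranspose (fshift a b) :: 'k fmat"
  let ?D = "direct_sum (N # Ns)" and ?E = "direct_sum Ns"
  show d: "mdim ?D = a + b" by (simp add: direct_sum_def a_def b_def)
  have A: "act N g \<in> carrier_mat a a" and B: "act ?E g \<in> carrier_mat b b" if "g \<in> carrier G" for g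
    using N D that by (auto simp: is_kG_module_def a_def b_def)
  have act: "act ?D g = four_block_mat (act N g) (0\<^sub>m a b) (0\<^sub>m b a) (act ?E g)"
    if "g \<in> carrier G" for g
    using A[OF that] B[OF that] by (simp add: direct_sum_def Let_def)
  show r: "rho ?D g = rho N g + ?s * rho ?E g * ?t" if "g \<in> carrier G" for g
    unfolding rho_def act[OF that] by (rule of_mat_four_block[OF A[OF that] B[OF that]])
  have z: "x * ?s = 0" "?t * x = 0" if "shaped a a x" for x
    using that fone_fshift[of a b] by (metis shapedD mult.assoc mult_zero_left mult_zero_right)+
  show "kmod ?D"
  proof (rule kmodI)
    fix g assume g: "g \<in> carrier G"
    show "act ?D g \<in> carrier_mat (mdim ?D) (mdim ?D)"
      unfolding d act[OF g] using A[OF g] B[OF g] by auto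
  next
    have "rho ?D \<one> = fone a + ?s * fone b * ?t" by (simp add: r rho_one[OF N] rho_one[OF D] a_def b_def)
    also have "\<dots> = fone (a + b)"
      by (simp only: shapedD(2)[OF shaped_fshift] fshift_fshift_transpose) simp
    finally show "rho ?D \<one> = idm ?D" by (simp add: d)
  next
    fix g h assume gh: "g \<in> carrier G" "h \<in> carrier G"
    note sN = rho_shaped[OF N gh(1), folded a_def] rho_shaped[OF N gh(2), folded a_def]
    have "rho ?D g * rho ?D h = rho N g * rho N h + (rho N g * ?s) * rho ?E h * ?t
      + ?s * rho ?E g * (?t * rho N h) + ?s * (rho ?E g * (?t * ?s)) * rho ?E h * ?t"
      by (simp add: r gh algebra_simps)
    also have "\<dots> = rho N g * rho N h + ?s * (rho ?E g * fone b) * rho ?E h * ?t"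
      by (simp only: z(1)[OF sN(1)] z(2)[OF sN(2)] fshift_transpose_fshift) simp
    also have "\<dots> = rho N (g \<otimes> h) + ?s * rho ?E (g \<otimes> h) * ?t"
      by (simp only: rho_id_right[OF D gh(1), folded b_def] rho_mult[OF N gh] rho_mult[OF D gh] mult.assoc)
    finally show "rho ?D (g \<otimes> h) = rho ?D g * rho ?D h" using gh by (simp add: r)
  qed
qed

lemma direct_sum_decomposes:
  fixes Ns :: "('a, 'k::field) kG_module list"
  assumes "\<forall>N\<in>set Ns. kmod N"
  shows "kmod (direct_sum Ns) \<and> (\<exists>i p. decomposes (direct_sum Ns) Ns i p)"
  using assms
proof (induction Ns)
  case Nil
  have "mdim (direct_sum []) = 0" by (simp add: direct_sum_def)
  moreover have "rho (direct_sum []) g = (0 :: 'k fmat)" for g :: 'a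
    by (intro fmat_eqI) (auto simp: rho_def direct_sum_def entry_of_mat entry_zero)
  ultimately have "kmod (direct_sum [] :: ('a, 'k) kG_module)"
    by (intro kmodI) (auto simp: direct_sum_def)
  then show ?case by (auto simp: decomposes_def direct_sum_def)
next
  case (Cons N Ns)
  let ?D = "direct_sum (N # Ns)" and ?E = "direct_sum Ns"
  have N: "kmod N" and E: "kmod ?E" using Cons by auto
  obtain i p where ip: "decomposes ?E Ns i p" using Cons by auto
  note D = direct_sum_Cons[OF N E]
  define a where "a = mdim N"
  define b where "b = mdim ?E"
  let ?s = "fshift a b :: 'k fmat" and ?t = "ftranspose (fshift a b) :: 'k fmat"
  have z: "x * ?s = 0" "?t * x = 0" if "shaped a a x" for x
    using that fone_fshift[of a b] by (metis shapedD mult.assoc mult_zero_left mult_zero_right)+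
  have sN: "shaped a a (rho N g)" if "g \<in> carrier G" for g using rho_shaped[OF N that] by (simp add: a_def)
  have fa: "shaped (a + b) a (fone a)" "shaped a (a + b) (fone a)"
    by (auto simp: shaped_iff entry_diagc)
  have t: "shaped b (a + b) ?t" using shaped_fshift ftranspose_shaped by blast
  note D' = D(1)[folded a_def b_def] D(2)[folded a_def b_def]
  have f0: "ghom N ?D (fone a)" unfolding hom_on_def
  proof (intro conjI ballI)
    fix g assume g: "g \<in> carrier G"
    have "rho ?D g * fone a = rho N g * fone a + ?s * rho ?E g * (?t * fone a)"
      by (simp add: D'(2)[OF g] distrib_right mult.assoc)
    then show "rho ?D g * fone a = fone a * rho N g"
      using shapedD[OF sN[OF g]] by (simp add: fone_fshift)
  qed (use fa in \<open>simp add: D' flip: a_def\<close>)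
  have f1: "ghom ?D N (fone a)" unfolding hom_on_def
  proof (intro conjI ballI)
    fix g assume g: "g \<in> carrier G"
    have "fone a * rho ?D g = fone a * rho N g + (fone a * ?s) * rho ?E g * ?t"
      by (simp add: D'(2)[OF g] distrib_left mult.assoc)
    then show "rho N g * fone a = fone a * rho ?D g"
      using shapedD[OF sN[OF g]] by (simp add: fone_fshift)
  qed (use fa in \<open>simp add: D' flip: a_def\<close>)
  have f2: "ghom ?E ?D ?s" unfolding hom_on_def
  proof (intro conjI ballI)
    fix g assume g: "g \<in> carrier G"
    have "rho ?D g * ?s = rho N g * ?s + ?s * rho ?E g * (?t * ?s)"
      by (simp add: D'(2)[OF g] distrib_right mult.assoc)
    then show "rho ?D g * ?s = ?s * rho ?E g"
      using rho_id_right[OF E g, folded b_def] by (simp add: z sN[OF g] fshift_transpose_fshift mult.assoc)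
  qed (use shaped_fshift[of a b] in \<open>simp add: D' flip: b_def\<close>)
  have f3: "ghom ?D ?E ?t" unfolding hom_on_def
  proof (intro conjI ballI)
    fix g assume g: "g \<in> carrier G"
    have "?t * rho ?D g = ?t * rho N g + (?t * ?s) * rho ?E g * ?t"
      by (simp add: D(2)[OF g, folded a_def b_def] distrib_left mult.assoc)
    also have "\<dots> = rho ?E g * ?t"
      using rho_id_left[OF E g, folded b_def] by (simp add: z sN[OF g] fshift_transpose_fshift)
    finally show "rho ?E g * ?t = ?t * rho ?D g" by simp
  qed (use t in \<open>simp add: D' flip: b_def\<close>)
  define i' where "i' = (\<lambda>j. case j of 0 \<Rightarrow> fone a | Suc j \<Rightarrow> ?s * i j)"
  define p' where "p' = (\<lambda>j. case j of 0 \<Rightarrow> fone a | Suc j \<Rightarrow> p j * ?t)"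
  have "decomposes ?D (N # Ns) i' p'"
    unfolding decomposes_def
  proof (intro conjI allI impI)
    fix j assume j: "j < length (N # Ns)"
    have ipj: "ghom (Ns ! l) ?E (i l)" "ghom ?E (Ns ! l) (p l)" if "l < length Ns" for l
      using ip that by (auto simp: decomposes_def)
    show "ghom ((N # Ns) ! j) ?D (i' j)"
      using j hom_on_comp[OF f2 ipj(1)] by (cases j) (simp_all add: i'_def f0)
    show "ghom ?D ((N # Ns) ! j) (p' j)"
      using j hom_on_comp[OF ipj(2) f3] by (cases j) (simp_all add: p'_def f1)
    fix l assume l: "l < length (N # Ns)"
    show "p' j * i' l = (if j = l then idm ((N # Ns) ! j) else 0)"
    proof (cases j)
      case 0
      then show ?thesis
        by (cases l) (simp_all add: i'_def p'_def a_def[symmetric] fone_fshift flip: mult.assoc)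
    next
      case (Suc j')
      show ?thesis
      proof (cases l)
        case 0
        then show ?thesis using Suc by (simp add: i'_def p'_def fone_fshift mult.assoc)
      next
        case (Suc l')
        have "p' j * i' l = p j' * (?t * ?s) * i l'"
          using Suc \<open>j = Suc j'\<close> by (simp add: i'_def p'_def mult.assoc)
        also have "\<dots> = p j' * i l'"
          using ip Suc \<open>j = Suc j'\<close> j l hom_on_id_left[of "carrier G" "Ns ! l'" ?E "i l'"]
          by (simp add: fshift_transpose_fshift b_def mult.assoc decomposes_def)
        finally show ?thesis using ip Suc \<open>j = Suc j'\<close> j l by (simp add: decomposes_def)
      qed
    qed
  next
    have "(\<Sum>j<length (N # Ns). i' j * p' j) = fone a + ?s * (\<Sum>j<length Ns. i j * p j) * ?t"
      by (simp add: sum.lessThan_Suc_shift i'_def p'_def sum_distrib_left sum_distrib_right mult.assoc del: sum.lessThan_Suc)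
    also have "\<dots> = fone a + ?s * fone b * ?t" using ip by (simp add: decomposes_def b_def)
    also have "\<dots> = fone (a + b)"
      by (simp only: shapedD(2)[OF shaped_fshift] fshift_fshift_transpose) simp
    finally show "idm ?D = (\<Sum>j<length (N # Ns). i' j * p' j)" by (simp only: D')
  qed
  then show ?case using D by blast
qed

lemma kmod_direct_sum: "\<forall>N\<in>set Ns. kmod N \<Longrightarrow> kmod (direct_sum Ns)"
  using direct_sum_decomposes by blast

text \<open>The inclusions and projections of the block sum are transported along an isomorphism;
  conversely, two decompositions with the same summands are matched by
  \<open>\<Sum>j. i j * p' j\<close> and its counterpart.\<close>

lemma kG_iso_direct_sum_iff:
  fixes Ns :: "('a, 'k::field) kG_module list"
  assumes M: "kmod M" and Ns: "\<forall>N\<in>set Ns. kmod N"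
  shows "kG_iso G M (direct_sum Ns) \<longleftrightarrow> (\<exists>i p. decomposes M Ns i p)"
proof
  let ?D = "direct_sum Ns"
  obtain i p where ip: "decomposes ?D Ns i p" using direct_sum_decomposes[OF Ns] by blast
  note iso = kG_iso_iff[OF M kmod_direct_sum[OF Ns]]
  {
    assume "kG_iso G M ?D"
    then obtain f g where fg: "ghom M ?D f" "ghom ?D M g" "g * f = idm M" "f * g = idm ?D" using iso by blast
    have "decomposes M Ns (\<lambda>j. g * i j) (\<lambda>j. p j * f)"
      unfolding decomposes_def
    proof (intro conjI allI impI)
      fix j assume j: "j < length Ns"
      show "ghom (Ns ! j) M (g * i j)" using ip j by (intro hom_on_comp[OF fg(2)]) (simp add: decomposes_def)
      show "ghom M (Ns ! j) (p j * f)" using ip j by (intro hom_on_comp[OF _ fg(1)]) (simp add: decomposes_def)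
      fix l assume l: "l < length Ns"
      have "p j * f * (g * i l) = p j * (f * g) * i l" by (simp add: mult.assoc)
      also have "\<dots> = p j * i l"
        using ip l hom_on_id_left[of "carrier G" "Ns ! l" ?D "i l"] by (simp add: fg decomposes_def mult.assoc)
      finally show "p j * f * (g * i l) = (if j = l then idm (Ns ! j) else 0)"
        using ip j l by (simp add: decomposes_def)
    next
      have "(\<Sum>j<length Ns. g * i j * (p j * f)) = g * (\<Sum>j<length Ns. i j * p j) * f"
        by (simp add: sum_distrib_left sum_distrib_right mult.assoc)
      also have "\<dots> = g * (idm ?D * f)" using ip by (simp add: decomposes_def mult.assoc)
      also have "\<dots> = idm M" using fg hom_on_id_left[OF fg(1)] by simp
      finally show "idm M = (\<Sum>j<length Ns. g * i j * (p j * f))" by simp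
    qed
    then show "\<exists>i p. decomposes M Ns i p" by blast
  }
  {
    assume "\<exists>i p. decomposes M Ns i p"
    then obtain i' p' where ip': "decomposes M Ns i' p'" by blast
    define f where "f = (\<Sum>j<length Ns. i j * p' j)"
    define g where "g = (\<Sum>j<length Ns. i' j * p j)"
    have *: "(\<Sum>j<length Ns. a j * q j) * (\<Sum>j<length Ns. b j * r j) = (\<Sum>j<length Ns. a j * r j)"
      if "\<And>j l. j < length Ns \<Longrightarrow> l < length Ns \<Longrightarrow> q j * b l = (if j = l then idm (Ns ! j) else 0)"
        "\<And>j. j < length Ns \<Longrightarrow> a j * idm (Ns ! j) = a j" for a b q r :: "nat \<Rightarrow> 'k fmat"
    proof -
      have "(\<Sum>j<length Ns. a j * q j) * (\<Sum>j<length Ns. b j * r j)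
        = (\<Sum>j<length Ns. \<Sum>l<length Ns. a j * (q j * b l) * r l)"
        by (simp add: sum_product mult.assoc)
      also have "\<dots> = (\<Sum>j<length Ns. \<Sum>l<length Ns. if j = l then a j * r j else 0)"
        by (intro sum.cong) (auto simp: that)
      finally show ?thesis by simp
    qed
    have "g * f = idm M" unfolding f_def g_def
      by (subst *) (auto simp: decomposesD[OF ip] decomposesD[OF ip'] decomposes_sum[OF ip'])
    moreover have "f * g = idm ?D" unfolding f_def g_def
      by (subst *) (auto simp: decomposesD[OF ip] decomposesD[OF ip'] decomposes_sum[OF ip])
    moreover have "ghom M ?D f" unfolding f_def
      using decomposesD(1)[OF ip] decomposesD(2)[OF ip'] by (intro hom_on_sum hom_on_comp) auto
    moreover have "ghom ?D M g" unfolding g_def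
      using decomposesD(1)[OF ip'] decomposesD(2)[OF ip] by (intro hom_on_sum hom_on_comp) auto
    ultimately show "kG_iso G M ?D" using iso by blast
  }
qed

text \<open>The mixed products vanish by themselves: expanding
  \<open>p = p * (i * p + j * q)\<close> gives \<open>p * j * q = 0\<close>, and multiplication by
  \<open>j\<close> on the right removes \<open>q\<close>.\<close>

lemma decomposes_pairI:
  assumes "ghom A M i" "ghom M A p" "p * i = idm A" "ghom B M j" "ghom M B q" "q * j = idm B"
    "i * p + j * q = idm M"
  shows "decomposes M [A, B] (\<lambda>n. if n = 0 then i else j) (\<lambda>n. if n = 0 then p else q)"
proof -
  have "p * idm M = p * i * p + p * j * q" by (simp add: assms(7)[symmetric] algebra_simps)
  then have "p * j * q = 0" using assms hom_on_id_right[OF assms(2)] hom_on_id_left[OF assms(2)] by simp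
  then have "p * j * q * j = 0" by simp
  then have pj: "p * j = 0" using assms(6) hom_on_id_right[OF assms(4)] by (simp add: mult.assoc)
  have "q * idm M = q * i * p + q * j * q" by (simp add: assms(7)[symmetric] algebra_simps)
  then have "q * i * p = 0" using assms hom_on_id_right[OF assms(5)] hom_on_id_left[OF assms(5)] by simp
  then have "q * i * p * i = 0" by simp
  then have "q * i = 0" using assms(3) hom_on_id_right[OF assms(1)] by (simp add: mult.assoc)
  with pj show ?thesis using assms by (auto simp: decomposes_def less_Suc_eq numeral_2_eq_2)
qed

text \<open>A split inclusion suffices, since a complement is the image of the idempotent
  \<open>idm M - i * p\<close>.\<close>

lemma direct_summand_iff:
  fixes N M :: "('a, 'k::field) kG_module"
  assumes N: "kmod N" and M: "kmod M"
  shows "direct_summand G N M \<longleftrightarrow> (\<exists>i p. ghom N M i \<and> ghom M N p \<and> p * i = idm N)"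
proof
  assume "direct_summand G N M"
  then obtain N' where N': "kmod N'" "kG_iso G M (direct_sum [N, N'])" by (auto simp: direct_summand_def)
  then obtain i p where "decomposes M [N, N'] i p" using kG_iso_direct_sum_iff[OF M, of "[N, N']"] N by auto
  then show "\<exists>i p. ghom N M i \<and> ghom M N p \<and> p * i = idm N"
    using decomposesD[of M "[N, N']" i p 0]
    by (intro exI[of _ "i 0"] exI[of _ "p 0"]) simp
next
  assume "\<exists>i p. ghom N M i \<and> ghom M N p \<and> p * i = idm N"
  then obtain i p where ip: "ghom N M i" "ghom M N p" "p * i = idm N" by blast
  have iN: "i * idm N = i" using hom_on_id_right[OF ip(1)] .
  have e: "ghom M M (idm M - i * p)" using hom_on_minus[OF ghom_id[OF M] hom_on_comp[OF ip(1,2)]] .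
  have "(i * p) * (i * p) = i * (p * i) * p" by (simp add: mult.assoc)
  then have "(i * p) * (i * p) = i * p" by (simp add: ip iN)
  moreover have "idm M * (i * p) = i * p" "i * p * idm M = i * p"
    using hom_on_id_left[OF hom_on_comp[OF ip(1,2)]] hom_on_id_right[OF hom_on_comp[OF ip(1,2)]] by auto
  ultimately have "(idm M - i * p) * (idm M - i * p) = idm M - i * p"
    by (simp add: left_diff_distrib right_diff_distrib)
  then obtain N' j q where "kmod N'" "ghom N' M j" "ghom M N' q" "q * j = idm N'" "j * q = idm M - i * p"
    using idempotent_summand[OF M e] by blast
  moreover from this have "\<exists>i p. decomposes M [N, N'] i p"
    using decomposes_pairI[OF ip(1-3), of N' j q] by auto
  ultimately show "direct_summand G N M"
    using kG_iso_direct_sum_iff[OF M, of "[N, N']"] N by (auto simp: direct_summand_def)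
qed

section \<open>Endomorphisms of indecomposable modules\<close>

lemma indecomposable_idempotent:
  assumes N: "indecomposable_module G N" and e: "ghom N N e" "e * e = e"
  shows "e = 0 \<or> e = idm N"
proof -
  have M: "kmod N" using N by (simp add: indecomposable_module_def)
  obtain A i p where A: "kmod A" "ghom A N i" "ghom N A p" "p * i = idm A" "i * p = e"
    using idempotent_summand[OF M e] by blast
  have "ghom N N (idm N - e)" using hom_on_minus[OF ghom_id[OF M] e(1)] .
  moreover have "(idm N - e) * (idm N - e) = idm N - e"
    using hom_on_id_left[OF e(1)] hom_on_id_right[OF e(1)] e(2)
    by (simp add: left_diff_distrib right_diff_distrib)
  ultimately obtain B j q where B: "kmod B" "ghom B N j" "ghom N B q" "q * j = idm B" "j * q = idm N - e"
    using idempotent_summand[OF M] by blast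
  have "\<exists>i p. decomposes N [A, B] i p"
    using decomposes_pairI[OF A(2-4) B(2-4)] A B by auto
  then have "kG_iso G N (direct_sum [A, B])" using kG_iso_direct_sum_iff[OF M, of "[A, B]"] A B by auto
  then have "mdim A = 0 \<or> mdim B = 0" using N A B by (auto simp: indecomposable_module_def)
  then show ?thesis
  proof
    assume "mdim A = 0"
    then have "p = 0" using hom_on_id_left[OF A(3)] by simp
    then show ?thesis using A by simp
  next
    assume "mdim B = 0"
    then have "q = 0" using hom_on_id_left[OF B(3)] by simp
    then show ?thesis using B by simp
  qed
qed

lemma fpow_ghom: "ghom M M x \<Longrightarrow> ghom M M (fpow x n)"
  by (induction n) (auto intro: hom_on_comp)

text \<open>For a suitable power \<open>w\<close> of \<open>f\<close>, the idempotent
  \<open>w * z\<close> commutes with everything that commutes with \<open>w\<close>, so it is an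
  endomorphism of \<open>N\<close> and must be \<open>0\<close> or the identity. In the first case
  \<open>w = 0\<close>, in the second \<open>f\<close> is invertible.\<close>

lemma indecomposable_local:
  fixes N :: "('a, 'k::field) kG_module"
  assumes N: "indecomposable_module G N" and f: "ghom N N f"
  shows "funit (mdim N) f \<or> fnil f"
proof -
  have M: "kmod N" using N by (simp add: indecomposable_module_def)
  obtain z m where z: "shaped (mdim N) (mdim N) z" "fpow f m * z = z * fpow f m"
    "fpow f m * z * fpow f m = fpow f m" "z * fpow f m * z = z"
    "\<And>y. y * fpow f m = fpow f m * y \<Longrightarrow> fpow f m * z * y = y * (fpow f m * z)"
    by (rule fitting[OF hom_onD(1)[OF f]]) (rule that)
  define w where "w = fpow f m"
  have w: "ghom N N w" unfolding w_def using fpow_ghom[OF f] .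
  have "ghom N N (w * z)" unfolding hom_on_def
    using shaped_times[OF hom_onD(1)[OF w] z(1)] z(5) hom_onD(2)[OF w] by (auto simp: w_def)
  moreover have "w * z * (w * z) = w * z" using z(3) by (simp add: w_def flip: mult.assoc)
  ultimately have "w * z = 0 \<or> w * z = idm N" using indecomposable_idempotent[OF N] by blast
  then show ?thesis
  proof
    assume "w * z = 0"
    then have "fpow f m = 0" using z(3) by (simp add: w_def)
    then show ?thesis by (auto simp: fnil_def)
  next
    assume wz: "w * z = idm N"
    have "\<exists>y. shaped (mdim N) (mdim N) y \<and> f * y = w * z"
    proof (cases m)
      case 0
      then show ?thesis using z(1) by (auto simp: w_def)
    next
      case (Suc n)
      have "shaped (mdim N) (mdim N) (fpow f n * z)"
        using shaped_times[OF hom_onD(1)[OF fpow_ghom[OF f]] z(1)] .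
      then show ?thesis using Suc by (intro exI[of _ "fpow f n * z"]) (simp add: w_def mult.assoc)
    qed
    then show ?thesis using funitI[OF hom_onD(1)[OF f]] wz by auto
  qed
qed

lemma unit_inverse_ghom:
  assumes "ghom N N f" "kmod N" "shaped (mdim N) (mdim N) y" "f * y = idm N" "y * f = idm N"
  shows "ghom N N y"
  unfolding hom_on_def
proof (intro conjI ballI)
  fix g assume g: "g \<in> carrier G"
  have "rho N g * y = y * f * rho N g * y" using rho_id_left[OF assms(2) g] by (simp add: assms(5))
  also have "\<dots> = y * (f * rho N g) * y" by (simp only: mult.assoc)
  also have "\<dots> = y * rho N g * (f * y)" by (simp only: hom_onD(2)[OF assms(1) g, symmetric] mult.assoc)
  also have "\<dots> = y * rho N g" using rho_id_right[OF assms(2) g] by (simp add: assms(4) mult.assoc)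
  finally show "rho N g * y = y * rho N g" .
qed (fact assms)

text \<open>Locality of the endomorphism ring: if \<open>y\<close> inverts \<open>f a + s\<close>,
  then \<open>y * f a\<close> and \<open>y * s\<close> add up to the identity and cannot both be
  nilpotent, so one of them is a unit, and with it \<open>f a\<close> or \<open>s\<close>.\<close>

lemma indecomposable_sum_unit:
  fixes N :: "('a, 'k::field) kG_module"
  assumes N: "indecomposable_module G N" and "finite A" and f: "\<And>a. a \<in> A \<Longrightarrow> ghom N N (f a)"
    and u: "funit (mdim N) (sum f A)"
  shows "\<exists>a\<in>A. funit (mdim N) (f a)"
  using assms(2-4)
proof (induction A)
  case empty
  have "fnil (0 :: 'k fmat)" by (auto simp: fnil_def intro: exI[of _ 0])
  then show ?case using fnil_not_funit empty N by (auto simp: indecomposable_module_def)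
next
  case (insert a A)
  have M: "kmod N" and d: "mdim N \<noteq> 0" using N by (simp_all add: indecomposable_module_def)
  define s where "s = sum f A"
  have fa: "ghom N N (f a)" and s: "ghom N N s" using insert unfolding s_def by (auto intro: hom_on_sum)
  have "funit (mdim N) (f a + s)" using insert by (simp add: s_def)
  then obtain y where y: "shaped (mdim N) (mdim N) y" "(f a + s) * y = idm N" "y * (f a + s) = idm N"
    unfolding funit_def by blast
  have yh: "ghom N N y" using unit_inverse_ghom[OF hom_on_plus[OF fa s] M y] .
  have ya: "ghom N N (y * f a)" "ghom N N (y * s)" using hom_on_comp[OF yh] fa s by blast+
  have eq: "y * s = idm N - y * f a" using y(3) by (simp add: algebra_simps eq_diff_eq)
  have "funit (mdim N) (y * f a) \<or> funit (mdim N) (y * s)"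
    using indecomposable_local[OF N ya(1)] indecomposable_local[OF N ya(2)]
      fnil_complement_not_fnil[OF _ _ hom_onD(1)[OF ya(1)] d] eq by auto
  then have "funit (mdim N) (f a) \<or> funit (mdim N) s"
  proof
    assume "funit (mdim N) (y * f a)"
    then obtain v where "shaped (mdim N) (mdim N) v" "v * (y * f a) = idm N" by (auto simp: funit_def)
    then have "shaped (mdim N) (mdim N) (v * y)" "(v * y) * f a = idm N" using y(1) shaped_times by (auto simp: mult.assoc)
    then show ?thesis using funitI'[OF hom_onD(1)[OF fa]] by blast
  next
    assume "funit (mdim N) (y * s)"
    then obtain v where "shaped (mdim N) (mdim N) v" "v * (y * s) = idm N" by (auto simp: funit_def)
    then have "shaped (mdim N) (mdim N) (v * y)" "(v * y) * s = idm N" using y(1) shaped_times by (auto simp: mult.assoc)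
    then show ?thesis using funitI'[OF hom_onD(1)[OF s]] by blast
  qed
  then show ?case using insert by (auto simp: s_def)
qed

text \<open>Write \<open>f\<close> as a scalar \<open>l\<close> plus a nilpotent \<open>n\<close>.
  As \<open>n * h\<close> is not a unit, it is nilpotent too, so both traces vanish and
  \<open>tr f = dim N * l\<close>, \<open>tr (f h) = l * tr h\<close>. The factor
  \<open>dim N\<close> avoids a division that fails when it is zero in \<open>k\<close>.\<close>

lemma indecomposable_ftrace_mult:
  fixes N :: "('a, 'k::alg_closed_field) kG_module"
  assumes N: "indecomposable_module G N" and f: "ghom N N f" and h: "ghom N N h"
  shows "of_nat (mdim N) * ftrace (f * h) = ftrace f * ftrace h"
proof -
  have M: "kmod N" and d: "mdim N \<noteq> 0" using N by (simp_all add: indecomposable_module_def)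
  obtain l where l: "\<not> funit (mdim N) (f - diagc (mdim N) l)"
    using eigenvalue_exists[OF hom_onD(1)[OF f] d] .
  define n where "n = f - diagc (mdim N) l"
  have n: "ghom N N n" unfolding n_def using hom_on_minus[OF f ghom_diagc[OF M]] .
  have nil: "fnil n" using indecomposable_local[OF N n] l by (simp add: n_def)
  have nh: "ghom N N (n * h)" using hom_on_comp[OF n h] .
  have "\<not> funit (mdim N) (n * h)"
  proof
    assume "funit (mdim N) (n * h)"
    then obtain v where "shaped (mdim N) (mdim N) v" "n * h * v = idm N" by (auto simp: funit_def)
    then have "funit (mdim N) n"
      using funitI[OF hom_onD(1)[OF n], of "h * v"] shaped_times[OF hom_onD(1)[OF h]] by (simp add: mult.assoc)
    then show False using l by (simp add: n_def)
  qed
  then have "fnil (n * h)" using indecomposable_local[OF N nh] by blast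
  then have t: "ftrace (n * h) = 0" "ftrace n = 0"
    using fnil_ftrace hom_onD(1)[OF nh] hom_onD(1)[OF n] nil by blast+
  have "ftrace f = of_nat (mdim N) * l"
    using t(2) by (simp add: n_def ftrace_minus)
  moreover have "ftrace (f * h) = l * ftrace h"
  proof -
    have "n * h = f * h - diagc (mdim N) l * h" by (simp add: n_def left_diff_distrib)
    then have "ftrace (f * h) = ftrace (diagc (mdim N) l * h)" using t(1) by (simp add: ftrace_minus)
    also have "\<dots> = l * ftrace h"
      by (simp add: ftrace_shaped[OF shaped_times[OF shaped_diagc hom_onD(1)[OF h]]]
          ftrace_shaped[OF hom_onD(1)[OF h]] entry_diagc_times sum_distrib_left)
    finally show ?thesis .
  qed
  ultimately show ?thesis by simp
qed

lemma decomposition_exists: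
  fixes M :: "('a, 'k::field) kG_module"
  assumes "kmod M"
  shows "\<exists>Ns i p. (\<forall>N\<in>set Ns. indecomposable_module G N) \<and> decomposes M Ns i p"
  using assms
proof (induction "mdim M" arbitrary: M rule: less_induct)
  case less
  have iffM: "kG_iso G M (direct_sum Ns) \<longleftrightarrow> (\<exists>i p. decomposes M Ns i p)" if "\<forall>N\<in>set Ns. kmod N" for Ns
    using kG_iso_direct_sum_iff[OF less(2) that] .
  consider "mdim M = 0" | "indecomposable_module G M"
    | A B where "kmod A" "kmod B" "kG_iso G M (direct_sum [A, B])" "mdim A \<noteq> 0" "mdim B \<noteq> 0"
    using less(2) unfolding indecomposable_module_def by blast
  then show ?case
  proof cases
    case 1
    then show ?thesis by (intro exI[of _ "[]"]) (simp add: decomposes_def)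
  next
    case 2
    have "decomposes M [M] (\<lambda>_. idm M) (\<lambda>_. idm M)"
      using ghom_id[OF less(2)] by (simp add: decomposes_def)
    with 2 show ?thesis by (intro exI[of _ "[M]"]) auto
  next
    case 3
    obtain i p where ip: "decomposes M [A, B] i p" using 3 iffM[of "[A, B]"] by auto
    have "mdim M = mdim A + mdim B" using 3(3) by (simp add: kG_iso_def direct_sum_def)
    then have "mdim A < mdim M" "mdim B < mdim M" using 3 by auto
    then obtain As ia pa Bs ib pb where A: "\<forall>N\<in>set As. indecomposable_module G N" "decomposes A As ia pa"
      and B: "\<forall>N\<in>set Bs. indecomposable_module G N" "decomposes B Bs ib pb"
      using less(1)[OF _ 3(1)] less(1)[OF _ 3(2)] by blast
    obtain i0 i1 p0 p1 where ip': "ghom A M i0" "ghom M A p0" "ghom B M i1" "ghom M B p1"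
      "p0 * i0 = idm A" "p1 * i1 = idm B" "p0 * i1 = 0" "p1 * i0 = 0" "idm M = i0 * p0 + i1 * p1"
      using decomposesD[OF ip, of 0] decomposesD[OF ip, of 1] decomposes_sum[OF ip]
      by (simp add: less_Suc_eq)
    define n where "n = length As"
    define j where "j = (\<lambda>l. if l < n then i0 * ia l else i1 * ib (l - n))"
    define q where "q = (\<lambda>l. if l < n then pa l * p0 else pb (l - n) * p1)"
    have 1: "pa l * p0 * (i0 * ia m) = pa l * ia m" if "m < n" for l m
    proof -
      have "pa l * p0 * (i0 * ia m) = pa l * (p0 * i0 * ia m)" by (simp only: mult.assoc)
      also have "\<dots> = pa l * ia m"
        unfolding ip' using hom_on_id_left[OF decomposesD(1)[OF A(2)]] that by (simp add: n_def)
      finally show ?thesis .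
    qed
    have 2: "pb l * p1 * (i1 * ib m) = pb l * ib m" if "m < length Bs" for l m
    proof -
      have "pb l * p1 * (i1 * ib m) = pb l * (p1 * i1 * ib m)" by (simp only: mult.assoc)
      also have "\<dots> = pb l * ib m"
        unfolding ip' using hom_on_id_left[OF decomposesD(1)[OF B(2)]] that by simp
      finally show ?thesis .
    qed
    have 3: "x * p0 * (i1 * y) = 0" "x * p1 * (i0 * y) = 0" for x y
    proof -
      have "x * p0 * (i1 * y) = x * (p0 * i1) * y" "x * p1 * (i0 * y) = x * (p1 * i0) * y"
        by (simp_all only: mult.assoc)
      then show "x * p0 * (i1 * y) = 0" "x * p1 * (i0 * y) = 0" by (simp_all add: ip')
    qed
    have "decomposes M (As @ Bs) j q"
      unfolding decomposes_def
    proof (intro conjI allI impI)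
      fix l assume l: "l < length (As @ Bs)"
      then have l': "\<not> l < n \<Longrightarrow> l - n < length Bs" by (simp add: n_def)
      show "ghom ((As @ Bs) ! l) M (j l)"
        using hom_on_comp[OF ip'(1) decomposesD(1)[OF A(2)]] hom_on_comp[OF ip'(3) decomposesD(1)[OF B(2) l']]
        by (simp add: nth_append j_def n_def)
      show "ghom M ((As @ Bs) ! l) (q l)"
        using hom_on_comp[OF decomposesD(2)[OF A(2)] ip'(2)] hom_on_comp[OF decomposesD(2)[OF B(2) l'] ip'(4)]
        by (simp add: nth_append q_def n_def)
      fix m assume m: "m < length (As @ Bs)"
      then have m': "\<not> m < n \<Longrightarrow> m - n < length Bs" by (simp add: n_def)
      show "q l * j m = (if l = m then idm ((As @ Bs) ! l) else 0)"
        using decomposesD(3)[OF A(2), of l m] decomposesD(3)[OF B(2), of "l - n" "m - n"] l' m'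
        by (auto simp: nth_append j_def q_def 1 2 3 simp flip: n_def)
    next
      have "(\<Sum>l<length (As @ Bs). j l * q l) = (\<Sum>l<n. j l * q l) + (\<Sum>l<length Bs. j (n + l) * q (n + l))"
      proof -
        have "{..<length (As @ Bs)} = {..<n} \<union> {n..<n + length Bs}" by (auto simp: n_def)
        then have "(\<Sum>l<length (As @ Bs). j l * q l) = (\<Sum>l<n. j l * q l) + (\<Sum>l\<in>{n..<n + length Bs}. j l * q l)"
          using sum.union_disjoint[of "{..<n}" "{n..<n + length Bs}" "\<lambda>l. j l * q l"] by (simp add: ivl_disj_int)
        also have "(\<Sum>l\<in>{n..<n + length Bs}. j l * q l) = (\<Sum>l<length Bs. j (n + l) * q (n + l))"
          using sum.shift_bounds_nat_ivl[of "\<lambda>l. j l * q l" 0 n "length Bs"]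
          by (simp add: lessThan_atLeast0 add.commute)
        finally show ?thesis .
      qed
      also have "\<dots> = i0 * (\<Sum>l<n. ia l * pa l) * p0 + i1 * (\<Sum>l<length Bs. ib l * pb l) * p1"
        by (simp add: j_def q_def sum_distrib_left sum_distrib_right mult.assoc)
      also have "\<dots> = i0 * idm A * p0 + i1 * idm B * p1"
        unfolding n_def decomposes_sum[OF A(2)] decomposes_sum[OF B(2)] ..
      also have "\<dots> = idm M"
        unfolding hom_on_id_right[OF ip'(1)] hom_on_id_right[OF ip'(3)] ip'(9) ..
      finally show "idm M = (\<Sum>l<length (As @ Bs). j l * q l)" by simp
    qed
    then show ?thesis using A(1) B(1) by (intro exI[of _ "As @ Bs"]) auto
  qed
qed

end

section \<open>Relative traces\<close>

text \<open>The same choice as in \<open>induced_module\<close>, so that the matrices of induced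
  modules can be expressed through it.\<close>

definition coset_rep :: "'g set \<Rightarrow> 'g" where
  "coset_rep C = (SOME x. x \<in> C)"

context group
begin

lemma mult_inv_cancel [simp]:
  "g \<in> carrier G \<Longrightarrow> x \<in> carrier G \<Longrightarrow> g \<otimes> (inv g \<otimes> x) = x"
  "g \<in> carrier G \<Longrightarrow> x \<in> carrier G \<Longrightarrow> inv g \<otimes> (g \<otimes> x) = x"
  by (simp_all flip: m_assoc)

lemma lcosetsI: "g \<in> carrier G \<Longrightarrow> g <# H \<in> lcosets H"
  by (auto simp: LCOSETS_def)

lemma coset_rep_in: "subgroup H G \<Longrightarrow> C \<in> lcosets H \<Longrightarrow> coset_rep C \<in> C"
  unfolding coset_rep_def LCOSETS_def by (rule someI_ex) (auto intro: lcos_self)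

lemma coset_rep_closed: "subgroup H G \<Longrightarrow> C \<in> lcosets H \<Longrightarrow> coset_rep C \<in> carrier G"
  by (meson coset_rep_in lcosets_subset_PowG PowD subsetD)

lemma coset_rep_coset: "subgroup H G \<Longrightarrow> C \<in> lcosets H \<Longrightarrow> coset_rep C <# H = C"
  using coset_rep_in[of H C] by (auto simp: LCOSETS_def dest: l_repr_independence)

lemma lcosets_translate: "H \<subseteq> carrier G \<Longrightarrow> g \<in> carrier G \<Longrightarrow> C \<in> lcosets H \<Longrightarrow> g <# C \<in> lcosets H"
  by (auto simp: LCOSETS_def lcos_m_assoc)

lemma lcosets_assoc:
  "H \<subseteq> carrier G \<Longrightarrow> g \<in> carrier G \<Longrightarrow> h \<in> carrier G \<Longrightarrow> C \<in> lcosets H \<Longrightarrow> (g \<otimes> h) <# C = g <# (h <# C)"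
  by (auto simp: LCOSETS_def lcos_m_assoc m_assoc)

lemma lcosets_one: "H \<subseteq> carrier G \<Longrightarrow> C \<in> lcosets H \<Longrightarrow> \<one> <# C = C"
  by (auto simp: LCOSETS_def lcos_m_assoc)

lemma lcosets_self: "subgroup H G \<Longrightarrow> H \<in> lcosets H"
  using lcosetsI[OF one_closed, of H] lcos_mult_one[OF subgroup.subset, of H] by simp

lemma lcoset_eq_iff:
  assumes "subgroup H G" "g \<in> carrier G" "h \<in> carrier G"
  shows "g <# H = h <# H \<longleftrightarrow> inv h \<otimes> g \<in> H"
proof
  assume "g <# H = h <# H"
  then have "g \<in> h <# H" using lcos_self[OF assms(2,1)] by simp
  then show "inv h \<otimes> g \<in> H" using subgroup.lcos_module_imp[OF assms(1) group_axioms assms(3)] by blast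
next
  assume "inv h \<otimes> g \<in> H"
  then have "g \<in> h <# H" using assms
    by (auto simp: l_coset_def intro!: bexI[of _ "inv h \<otimes> g"])
  then show "g <# H = h <# H" using l_repr_independence assms by blast
qed

text \<open>With representatives \<open>c\<close> of \<open>C\<close> and \<open>c'\<close> of
  \<open>g C\<close>, this is the element \<open>h\<close> in \<open>g c = c' h\<close> by which an
  induced module acts on a block.\<close>

lemma coset_rep_translate:
  assumes "subgroup H G" "g \<in> carrier G" "C \<in> lcosets H"
  shows "inv (coset_rep (g <# C)) \<otimes> g \<otimes> coset_rep C \<in> H"
proof -
  have gC: "g <# C \<in> lcosets H" using lcosets_translate[OF subgroup.subset] assms by blast
  have c: "coset_rep C \<in> carrier G" "coset_rep (g <# C) \<in> carrier G"
    using coset_rep_closed[OF assms(1)] assms(3) gC by auto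
  have "g <# (coset_rep C <# H) = coset_rep (g <# C) <# H"
    unfolding coset_rep_coset[OF assms(1,3)] coset_rep_coset[OF assms(1) gC] ..
  then have "(g \<otimes> coset_rep C) <# H = coset_rep (g <# C) <# H"
    unfolding lcos_m_assoc[OF subgroup.subset[OF assms(1)] assms(2) c(1)] .
  then have "inv (coset_rep (g <# C)) \<otimes> (g \<otimes> coset_rep C) \<in> H"
    unfolding lcoset_eq_iff[OF assms(1) m_closed[OF assms(2) c(1)] c(2)] .
  then show ?thesis using c assms(2) by (simp add: m_assoc)
qed

abbreviation conjg :: "'a \<Rightarrow> 'a set \<Rightarrow> 'a set" where
  "conjg g Q \<equiv> (\<lambda>x. g \<otimes> x \<otimes> inv g) ` Q"

text \<open>Conjugates of \<open>H\<close> appear as point stabilizers on cosets; this shows that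
  they are subgroups and later identifies the stabilizers in Mackey's formula.\<close>

lemma lcoset_stabilizer:
  assumes "subgroup H G" "g \<in> carrier G"
  shows "{x \<in> carrier G. x <# (g <# H) = g <# H} = conjg g H"
proof -
  have H: "H \<subseteq> carrier G" using assms(1) subgroup.subset by blast
  have "x <# (g <# H) = g <# H \<longleftrightarrow> inv g \<otimes> x \<otimes> g \<in> H" if "x \<in> carrier G" for x
    unfolding lcos_m_assoc[OF H that assms(2)]
      lcoset_eq_iff[OF assms(1) m_closed[OF that assms(2)] assms(2)]
    using m_assoc[of "inv g" x g] that assms(2) by simp
  moreover have "inv g \<otimes> x \<otimes> g \<in> H \<longleftrightarrow> x \<in> conjg g H" if x: "x \<in> carrier G" for x
  proof
    assume *: "inv g \<otimes> x \<otimes> g \<in> H"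
    have "x = g \<otimes> (inv g \<otimes> x \<otimes> g) \<otimes> inv g" using x assms by (simp add: m_assoc)
    with * show "x \<in> conjg g H" by blast
  next
    assume "x \<in> conjg g H"
    then obtain h where h: "h \<in> H" "x = g \<otimes> h \<otimes> inv g" by blast
    then have "h \<in> carrier G" using H by blast
    then have "inv g \<otimes> x \<otimes> g = h" using h assms by (simp add: m_assoc)
    then show "inv g \<otimes> x \<otimes> g \<in> H" using h by simp
  qed
  moreover have "conjg g H \<subseteq> carrier G" using H assms by auto
  ultimately show ?thesis by blast
qed

lemma stabilizer_subgroup:
  assumes "x \<in> \<Omega>" "\<And>g x. g \<in> carrier G \<Longrightarrow> x \<in> \<Omega> \<Longrightarrow> a g x \<in> \<Omega>" "\<And>x. x \<in> \<Omega> \<Longrightarrow> a \<one> x = x"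
    "\<And>g h x. g \<in> carrier G \<Longrightarrow> h \<in> carrier G \<Longrightarrow> x \<in> \<Omega> \<Longrightarrow> a (g \<otimes> h) x = a g (a h x)"
  shows "subgroup {g \<in> carrier G. a g x = x} G"
proof (rule subgroupI)
  fix g assume g: "g \<in> {g \<in> carrier G. a g x = x}"
  then have "a (inv g) x = a (inv g) (a g x)" by simp
  also have "\<dots> = a \<one> x" using assms(4)[of "inv g" g x] g assms(1) by simp
  finally show "inv g \<in> {g \<in> carrier G. a g x = x}" using g assms by simp
qed (use assms in auto)

lemma conjg_subgroup:
  assumes H: "subgroup H G" and g: "g \<in> carrier G"
  shows "subgroup (conjg g H) G"
  unfolding lcoset_stabilizer[OF H g, symmetric]
proof (rule stabilizer_subgroup[where \<Omega> = "lcosets H"])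
  show "g <# H \<in> lcosets H" using lcosetsI[OF g] .
  fix x C assume C: "C \<in> lcosets H"
  show "\<one> <# C = C" using lcosets_one[OF subgroup.subset[OF H] C] .
  assume x: "x \<in> carrier G"
  show "x <# C \<in> lcosets H" using lcosets_translate[OF subgroup.subset[OF H] x C] .
  fix y assume y: "y \<in> carrier G"
  show "(x \<otimes> y) <# C = x <# (y <# C)" using lcosets_assoc[OF subgroup.subset[OF H] x y C] .
qed

lemma card_conjg: "Q \<subseteq> carrier G \<Longrightarrow> g \<in> carrier G \<Longrightarrow> card (conjg g Q) = card Q"
  by (rule card_image) (auto simp: inj_on_def subset_iff)

end

context finite_group
begin

lemma finite_lcosets: "subgroup H G \<Longrightarrow> finite (lcosets H)"
  using fin lcosets_subset_PowG finite_subset by (metis finite_Pow_iff)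

section \<open>Conjugation of linear maps and relative traces\<close>

definition conja :: "('a, 'k::field) kG_module \<Rightarrow> ('a, 'k) kG_module \<Rightarrow> 'a \<Rightarrow> 'k fmat \<Rightarrow> 'k fmat" where
  "conja M N g x = rho N g * x * rho M (inv g)"

abbreviation lin :: "('a, 'k::field) kG_module \<Rightarrow> ('a, 'k) kG_module \<Rightarrow> 'k fmat \<Rightarrow> bool" where
  "lin M N x \<equiv> shaped (mdim N) (mdim M) x"

lemma conja_lin: "kmod M \<Longrightarrow> kmod N \<Longrightarrow> g \<in> carrier G \<Longrightarrow> lin M N x \<Longrightarrow> lin M N (conja M N g x)"
  unfolding conja_def by (intro shaped_times[OF shaped_times]) (auto intro: rho_shaped)

lemma conja_mult:
  assumes "kmod M" "kmod N" "g \<in> carrier G" "h \<in> carrier G"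
  shows "conja M N (g \<otimes> h) x = conja M N g (conja M N h x)"
  using assms by (simp add: conja_def rho_mult inv_mult_group mult.assoc)

lemma conja_plus: "conja M N g (x + y) = conja M N g x + conja M N g y"
  by (simp add: conja_def algebra_simps)

lemma conja_zero [simp]: "conja M N g 0 = 0"
  by (simp add: conja_def)

lemma conja_sum: "conja M N g (sum f A) = (\<Sum>a\<in>A. conja M N g (f a))"
  by (simp add: conja_def sum_distrib_left sum_distrib_right)

lemma conja_comp:
  assumes "kmod N" "g \<in> carrier G" "lin M N y"
  shows "conja M L g (x * y) = conja N L g x * conja M N g y"
proof -
  have "conja N L g x * conja M N g y = rho L g * x * (rho N (inv g) * rho N g) * y * rho M (inv g)"
    by (simp add: conja_def mult.assoc)
  also have "\<dots> = rho L g * x * (idm N * y) * rho M (inv g)"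
    using assms by (simp add: rho_inv_left mult.assoc)
  also have "\<dots> = conja M L g (x * y)" using assms by (simp add: shapedD conja_def mult.assoc)
  finally show ?thesis by simp
qed

lemma hom_on_iff_conja:
  assumes "kmod M" "kmod N" "H \<subseteq> carrier G"
  shows "hom_on H M N x \<longleftrightarrow> lin M N x \<and> (\<forall>h\<in>H. conja M N h x = x)"
proof -
  have "rho N h * x = x * rho M h \<longleftrightarrow> conja M N h x = x" if h: "h \<in> carrier G" and x: "lin M N x" for h
  proof
    assume "rho N h * x = x * rho M h"
    then have "conja M N h x = x * (rho M h * rho M (inv h))" by (simp add: conja_def mult.assoc)
    then show "conja M N h x = x" using assms h x by (simp add: rho_inv_right shapedD)
  next
    assume "conja M N h x = x"
    then have "x * rho M h = rho N h * x * (rho M (inv h) * rho M h)"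
      unfolding conja_def by (metis mult.assoc)
    then show "rho N h * x = x * rho M h"
      using assms h x by (simp add: rho_inv_left shapedD mult.assoc)
  qed
  then show ?thesis using assms(3) by (auto simp: hom_on_def)
qed

lemma conja_ghom: "kmod M \<Longrightarrow> kmod N \<Longrightarrow> ghom M N x \<Longrightarrow> g \<in> carrier G \<Longrightarrow> conja M N g x = x"
  by (simp add: hom_on_iff_conja)

text \<open>The relative trace from \<open>H\<close> to the whole group. For \<open>x\<close> linear
  over \<open>H\<close> the choice of representatives does not affect it.\<close>

definition rtrace :: "'a set \<Rightarrow> ('a, 'k::field) kG_module \<Rightarrow> ('a, 'k) kG_module \<Rightarrow> 'k fmat \<Rightarrow> 'k fmat" where
  "rtrace H M N x = (\<Sum>C\<in>lcosets H. conja M N (coset_rep C) x)"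

definition traces :: "'a set \<Rightarrow> ('a, 'k::field) kG_module \<Rightarrow> ('a, 'k) kG_module \<Rightarrow> 'k fmat set" where
  "traces H M N = {rtrace H M N x | x. hom_on H M N x}"

lemma conja_coset_rep_translate:
  assumes M: "kmod M" and N: "kmod N" and H: "subgroup H G" and x: "hom_on H M N x"
    and g: "g \<in> carrier G" and C: "C \<in> lcosets H"
  shows "conja M N (coset_rep (g <# C)) x = conja M N g (conja M N (coset_rep C) x)"
proof -
  define c where "c = coset_rep C"
  define d where "d = coset_rep (g <# C)"
  have HG: "H \<subseteq> carrier G" using subgroup.subset[OF H] .
  have c: "c \<in> carrier G" unfolding c_def using coset_rep_closed[OF H C] .
  have d: "d \<in> carrier G" unfolding d_def using coset_rep_closed[OF H lcosets_translate[OF HG g C]] .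
  define h where "h = inv d \<otimes> g \<otimes> c"
  have h: "h \<in> H" unfolding h_def c_def d_def by (rule coset_rep_translate[OF H g C])
  have hG: "h \<in> carrier G" using h HG by blast
  have dh: "g \<otimes> c = d \<otimes> h" unfolding h_def using g c d by (simp add: m_assoc)
  have "conja M N g (conja M N c x) = conja M N (d \<otimes> h) x"
    by (simp add: dh[symmetric] conja_mult[OF M N g c])
  also have "\<dots> = conja M N d x"
    using x h hom_on_iff_conja[OF M N HG] by (simp add: conja_mult[OF M N d hG])
  finally show ?thesis by (simp add: c_def d_def)
qed

text \<open>The orbit of \<open>x0\<close> is identified with the cosets of its stabilizer, and
  equivariance of \<open>w\<close> turns the orbit sum into the relative trace of
  \<open>w x0\<close>.\<close>

lemma sum_orbit_traces:
  assumes M: "kmod M" and N: "kmod N"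
    and \<Omega>: "finite \<Omega>" "x0 \<in> \<Omega>" "\<And>x. x \<in> \<Omega> \<Longrightarrow> \<exists>g\<in>carrier G. x = a g x0"
    and a: "\<And>g x. g \<in> carrier G \<Longrightarrow> x \<in> \<Omega> \<Longrightarrow> a g x \<in> \<Omega>" "\<And>x. x \<in> \<Omega> \<Longrightarrow> a \<one> x = x"
    "\<And>g h x. g \<in> carrier G \<Longrightarrow> h \<in> carrier G \<Longrightarrow> x \<in> \<Omega> \<Longrightarrow> a (g \<otimes> h) x = a g (a h x)"
    and w: "\<And>x. x \<in> \<Omega> \<Longrightarrow> lin M N (w x)" "\<And>g x. g \<in> carrier G \<Longrightarrow> x \<in> \<Omega> \<Longrightarrow> w (a g x) = conja M N g (w x)"
  shows "sum w \<Omega> \<in> traces {g \<in> carrier G. a g x0 = x0} M N"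
proof -
  define H where "H = {g \<in> carrier G. a g x0 = x0}"
  have H: "subgroup H G" unfolding H_def using stabilizer_subgroup[of x0 \<Omega> a] \<Omega> a by blast
  have HG: "H \<subseteq> carrier G" using subgroup.subset[OF H] .
  have fix0: "a h x0 = x0" if "h \<in> H" for h using that by (simp add: H_def)
  have hom: "hom_on H M N (w x0)"
    unfolding hom_on_iff_conja[OF M N HG] using w \<Omega>(2) fix0 HG by (metis subsetD)
  have bij: "bij_betw (\<lambda>C. a (coset_rep C) x0) (lcosets H) \<Omega>"
    unfolding bij_betw_def
  proof
    show "inj_on (\<lambda>C. a (coset_rep C) x0) (lcosets H)"
    proof (rule inj_onI)
      fix C D assume CD: "C \<in> lcosets H" "D \<in> lcosets H" "a (coset_rep C) x0 = a (coset_rep D) x0"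
      have c: "coset_rep C \<in> carrier G" "coset_rep D \<in> carrier G" using CD coset_rep_closed[OF H] by auto
      have "a (inv (coset_rep D) \<otimes> coset_rep C) x0 = a (inv (coset_rep D)) (a (coset_rep D) x0)"
        using CD c \<Omega>(2) a(3) by simp
      also have "\<dots> = x0" using a(3)[of "inv (coset_rep D)" "coset_rep D" x0] c \<Omega>(2) a(2) by simp
      finally have "inv (coset_rep D) \<otimes> coset_rep C \<in> H" using c by (simp add: H_def)
      then have "coset_rep C <# H = coset_rep D <# H" using lcoset_eq_iff[OF H c] by blast
      then show "C = D" unfolding coset_rep_coset[OF H CD(1)] coset_rep_coset[OF H CD(2)] .
    qed
    show "(\<lambda>C. a (coset_rep C) x0) ` (lcosets H) = \<Omega>"
    proof
      show "(\<lambda>C. a (coset_rep C) x0) ` (lcosets H) \<subseteq> \<Omega>" using coset_rep_closed[OF H] a(1) \<Omega>(2) by auto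
      show "\<Omega> \<subseteq> (\<lambda>C. a (coset_rep C) x0) ` (lcosets H)"
      proof
        fix x assume "x \<in> \<Omega>"
        then obtain g where g: "g \<in> carrier G" "x = a g x0" using \<Omega>(3) by blast
        have C: "g <# H \<in> lcosets H" using lcosetsI[OF g(1)] .
        have "coset_rep (g <# H) \<in> g <# H" using coset_rep_in[OF H C] .
        then obtain h where h: "h \<in> H" "coset_rep (g <# H) = g \<otimes> h" by (auto simp: l_coset_def)
        then have "a (coset_rep (g <# H)) x0 = x" using g a(3) \<Omega>(2) fix0 HG by auto
        then show "x \<in> (\<lambda>C. a (coset_rep C) x0) ` (lcosets H)" using C by blast
      qed
    qed
  qed
  have "sum w \<Omega> = (\<Sum>C\<in>lcosets H. w (a (coset_rep C) x0))"
    using sum.reindex_bij_betw[OF bij, of w] by simp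
  also have "\<dots> = rtrace H M N (w x0)"
    unfolding rtrace_def by (rule sum.cong) (auto intro!: w(2) coset_rep_closed[OF H] \<Omega>(2))
  finally show ?thesis using hom unfolding traces_def H_def[symmetric] by auto
qed

text \<open>Removes one orbit at a time; \<open>J\<close> is a set of orbit representatives. Applied
  to pairs of cosets, this becomes Mackey's formula.\<close>

lemma sum_gset_traces:
  assumes M: "kmod M" and N: "kmod N"
    and \<Omega>: "finite \<Omega>"
    and a: "\<And>g x. g \<in> carrier G \<Longrightarrow> x \<in> \<Omega> \<Longrightarrow> a g x \<in> \<Omega>" "\<And>x. x \<in> \<Omega> \<Longrightarrow> a \<one> x = x"
    "\<And>g h x. g \<in> carrier G \<Longrightarrow> h \<in> carrier G \<Longrightarrow> x \<in> \<Omega> \<Longrightarrow> a (g \<otimes> h) x = a g (a h x)"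
    and w: "\<And>x. x \<in> \<Omega> \<Longrightarrow> lin M N (w x)" "\<And>g x. g \<in> carrier G \<Longrightarrow> x \<in> \<Omega> \<Longrightarrow> w (a g x) = conja M N g (w x)"
  shows "\<exists>J z. J \<subseteq> \<Omega> \<and> sum w \<Omega> = sum z J \<and> (\<forall>x\<in>J. z x \<in> traces {g \<in> carrier G. a g x = x} M N)"
  using \<Omega> a w
proof (induction "card \<Omega>" arbitrary: \<Omega> rule: less_induct)
  case less
  show ?case
  proof (cases "\<Omega> = {}")
    case True
    then show ?thesis by auto
  next
    case False
    then obtain x0 where x0: "x0 \<in> \<Omega>" by blast
    define O' where "O' = (\<lambda>g. a g x0) ` carrier G"
    have OX: "O' \<subseteq> \<Omega>" unfolding O'_def using less.prems(2) x0 by auto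
    have x0O: "x0 \<in> O'" unfolding O'_def using less.prems(3)[OF x0] by (metis imageI one_closed)
    have aO: "a g x \<in> O'" if gx: "g \<in> carrier G" "x \<in> O'" for g x
    proof -
      obtain h where h: "h \<in> carrier G" "x = a h x0" using gx by (auto simp: O'_def)
      then have "a g x = a (g \<otimes> h) x0" using less.prems(4) gx x0 by simp
      then show ?thesis using gx h by (auto simp: O'_def)
    qed
    have aX: "a g x \<in> \<Omega> - O'" if g: "g \<in> carrier G" and x: "x \<in> \<Omega> - O'" for g x
    proof -
      have "a (inv g) (a g x) = x" using less.prems(4)[of "inv g" g x] less.prems(3) g x by auto
      then have "a g x \<notin> O'" using aO[of "inv g" "a g x"] g x by auto
      then show ?thesis using less.prems(2) g x by blast
    qed
    have 1: "sum w O' \<in> traces {g \<in> carrier G. a g x0 = x0} M N"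
    proof (rule sum_orbit_traces[OF M N])
      show "finite O'" using less.prems(1) OX finite_subset by blast
      show "\<exists>g\<in>carrier G. x = a g x0" if "x \<in> O'" for x using that by (auto simp: O'_def)
    qed (use x0O aO OX less.prems in auto)
    have "card (\<Omega> - O') < card \<Omega>" using x0 x0O less.prems(1) by (intro psubset_card_mono) auto
    then have "\<exists>J z. J \<subseteq> \<Omega> - O' \<and> sum w (\<Omega> - O') = sum z J \<and> (\<forall>x\<in>J. z x \<in> traces {g \<in> carrier G. a g x = x} M N)"
      by (rule less.hyps) (use less.prems aX in auto)
    then obtain J z where J: "J \<subseteq> \<Omega> - O'" "sum w (\<Omega> - O') = sum z J"
      "\<forall>x\<in>J. z x \<in> traces {g \<in> carrier G. a g x = x} M N" by blast
    have x0J: "x0 \<notin> J" using J(1) x0O by blast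
    have fJ: "finite J" using J(1) less.prems(1) by (meson finite_Diff finite_subset)
    have "sum w \<Omega> = sum w O' + sum w (\<Omega> - O')" using sum.subset_diff[OF OX less.prems(1), of w] by (simp add: add.commute)
    also have "\<dots> = sum (z(x0 := sum w O')) (insert x0 J)"
      using x0J fJ J(2) by simp (rule sum.cong, auto)
    finally show ?thesis using J x0 x0J 1
      by (intro exI[of _ "insert x0 J"] exI[of _ "z(x0 := sum w O')"]) auto
  qed
qed

lemma traces_ghom:
  assumes M: "kmod M" and N: "kmod N" and H: "subgroup H G" and x: "x \<in> traces H M N"
  shows "ghom M N x"
proof -
  obtain t where t: "x = rtrace H M N t" "hom_on H M N t" using x by (auto simp: traces_def)
  have HG: "H \<subseteq> carrier G" using subgroup.subset[OF H] .
  have "conja M N g x = x" if g: "g \<in> carrier G" for g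
  proof -
    have "conja M N g x = (\<Sum>C\<in>lcosets H. conja M N (coset_rep (g <# C)) t)"
      unfolding t(1) rtrace_def conja_sum
      by (rule sum.cong) (auto simp: conja_coset_rep_translate[OF M N H t(2) g])
    also have "\<dots> = rtrace H M N t" unfolding rtrace_def
    proof (rule sum.reindex_bij_witness[of _ "\<lambda>C. inv g <# C" "\<lambda>C. g <# C"])
      fix C assume C: "C \<in> lcosets H"
      show "inv g <# (g <# C) = C" "g <# (inv g <# C) = C"
        using lcosets_assoc[OF HG _ _ C, of "inv g" g] lcosets_assoc[OF HG _ _ C, of g "inv g"] g lcosets_one[OF HG C] by auto
      show "inv g <# C \<in> lcosets H" "g <# C \<in> lcosets H" using lcosets_translate[OF HG _ C] g by auto
    qed simp
    finally show ?thesis by (simp add: t)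
  qed
  moreover have "lin M N x" unfolding t(1) rtrace_def
    using coset_rep_closed[OF H] t(2) by (intro shaped_sum conja_lin[OF M N]) (auto simp: hom_on_def)
  ultimately show ?thesis unfolding hom_on_iff_conja[OF M N subset_refl] by blast
qed

text \<open>A homomorphism \<open>y\<close> is fixed by conjugation and therefore moves inside the
  relative trace.\<close>

lemma traces_comp_left:
  assumes "kmod M" "kmod N" "kmod L" "subgroup H G" "x \<in> traces H M N" "ghom N L y"
  shows "y * x \<in> traces H M L"
proof -
  obtain t where t: "x = rtrace H M N t" "hom_on H M N t" using assms by (auto simp: traces_def)
  have "hom_on H M L (y * t)" using hom_on_comp[OF hom_on_mono[OF assms(6) subgroup.subset[OF assms(4)]] t(2)] .
  moreover have "y * x = rtrace H M L (y * t)" unfolding t rtrace_def sum_distrib_left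
    using coset_rep_closed[OF assms(4)] t(2) assms conja_ghom[OF assms(2,3,6)]
    by (intro sum.cong) (auto simp: conja_comp[of N] hom_on_def)
  ultimately show ?thesis by (auto simp: traces_def)
qed

lemma traces_comp_right:
  assumes "kmod M" "kmod N" "kmod L" "subgroup H G" "x \<in> traces H N L" "ghom M N y"
  shows "x * y \<in> traces H M L"
proof -
  obtain t where t: "x = rtrace H N L t" "hom_on H N L t" using assms by (auto simp: traces_def)
  have "hom_on H M L (t * y)" using hom_on_comp[OF t(2) hom_on_mono[OF assms(6) subgroup.subset[OF assms(4)]]] .
  moreover have "x * y = rtrace H M L (t * y)" unfolding t rtrace_def sum_distrib_right
    using coset_rep_closed[OF assms(4)] t(2) assms conja_ghom[OF assms(1,2,6)] hom_onD(1)[OF assms(6)]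
    by (intro sum.cong) (auto simp: conja_comp[of N])
  ultimately show ?thesis by (auto simp: traces_def)
qed

lemma traces_zero: "0 \<in> traces H M N"
  unfolding traces_def by (auto simp: rtrace_def intro!: exI[of _ 0])

lemma traces_plus: "x \<in> traces H M N \<Longrightarrow> y \<in> traces H M N \<Longrightarrow> x + y \<in> traces H M N"
proof -
  assume "x \<in> traces H M N" "y \<in> traces H M N"
  then obtain s t where "x = rtrace H M N s" "hom_on H M N s" "y = rtrace H M N t" "hom_on H M N t"
    by (auto simp: traces_def)
  then show ?thesis unfolding traces_def
    by (auto simp: rtrace_def conja_plus sum.distrib intro!: exI[of _ "s + t"] hom_on_plus)
qed

text \<open>The sum defining the trace runs over a single orbit; read from the base point
  \<open>g H\<close> instead of \<open>H\<close>, its stabilizer is the conjugate subgroup.\<close>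

lemma traces_conjg:
  assumes M: "kmod M" and N: "kmod N" and H: "subgroup H G" and g: "g \<in> carrier G" and x: "x \<in> traces H M N"
  shows "x \<in> traces (conjg g H) M N"
proof -
  obtain t where t: "x = rtrace H M N t" "hom_on H M N t" using x by (auto simp: traces_def)
  have HG: "H \<subseteq> carrier G" using subgroup.subset[OF H] .
  have "(\<Sum>C\<in>lcosets H. conja M N (coset_rep C) t) \<in> traces {x \<in> carrier G. x <# (g <# H) = g <# H} M N"
  proof (rule sum_orbit_traces[OF M N])
    fix C assume C: "C \<in> lcosets H"
    then obtain c where c: "c \<in> carrier G" "C = c <# H" by (auto simp: LCOSETS_def)
    then have "C = (c \<otimes> inv g) <# (g <# H)" using g HG by (simp add: lcos_m_assoc m_assoc)
    then show "\<exists>x\<in>carrier G. C = x <# (g <# H)" using c g by blast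
    show "lin M N (conja M N (coset_rep C) t)"
      using coset_rep_closed[OF H C] t(2) conja_lin[OF M N] by (auto simp: hom_on_def)
    show "conja M N (coset_rep (x <# C)) t = conja M N x (conja M N (coset_rep C) t)" if "x \<in> carrier G" for x
      using conja_coset_rep_translate[OF M N H t(2) that C] .
  qed (use g HG finite_lcosets[OF H] lcosetsI lcosets_translate lcosets_assoc lcosets_one in auto)
  then show ?thesis unfolding lcoset_stabilizer[OF H g] t rtrace_def .
qed

section \<open>Mackey's formula and its consequences for indecomposable modules\<close>

text \<open>The product of two traces is a sum over the \<open>G\<close>-set of pairs of cosets, and
  the stabilizer of \<open>(g Q, h R)\<close> is the intersection of the two conjugates.\<close>

lemma traces_mackey:
  assumes M: "kmod M" and N: "kmod N" and L: "kmod L" and Q: "subgroup Q G" and R: "subgroup R G"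
    and x: "x \<in> traces Q N L" and y: "y \<in> traces R M N"
  shows "\<exists>J z. J \<subseteq> (lcosets Q) \<times> (lcosets R) \<and> x * y = sum z J \<and>
    (\<forall>j\<in>J. z j \<in> traces (conjg (coset_rep (fst j)) Q \<inter> conjg (coset_rep (snd j)) R) M L)"
proof -
  obtain s where s: "x = rtrace Q N L s" "hom_on Q N L s" using x by (auto simp: traces_def)
  obtain t where t: "y = rtrace R M N t" "hom_on R M N t" using y by (auto simp: traces_def)
  have QG: "Q \<subseteq> carrier G" "R \<subseteq> carrier G" using subgroup.subset Q R by blast+
  define \<Omega> where Omega_def: "\<Omega> = (lcosets Q) \<times> (lcosets R)"
  define a where "a = (\<lambda>g (CD :: 'a set \<times> 'a set). (g <# fst CD, g <# snd CD))"
  define w where "w = (\<lambda>CD. conja N L (coset_rep (fst CD)) s * conja M N (coset_rep (snd CD)) t)"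
  have fX: "finite \<Omega>" unfolding Omega_def using finite_lcosets Q R by simp
  have sl: "lin N L (conja N L (coset_rep C) s)" if "C \<in> lcosets Q" for C
    using coset_rep_closed[OF Q that] s(2) conja_lin[OF N L] by (auto simp: hom_on_def)
  have tl: "lin M N (conja M N (coset_rep C) t)" if "C \<in> lcosets R" for C
    using coset_rep_closed[OF R that] t(2) conja_lin[OF M N] by (auto simp: hom_on_def)
  have "\<exists>J z. J \<subseteq> \<Omega> \<and> sum w \<Omega> = sum z J \<and> (\<forall>x\<in>J. z x \<in> traces {g \<in> carrier G. a g x = x} M L)"
  proof (rule sum_gset_traces[OF M L fX])
    fix g CD assume g: "g \<in> carrier G" and CD: "CD \<in> \<Omega>"
    show "a g CD \<in> \<Omega>" using g CD QG lcosets_translate by (auto simp: a_def Omega_def)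
    have CD': "fst CD \<in> lcosets Q" "snd CD \<in> lcosets R" using CD by (auto simp: Omega_def)
    show "w (a g CD) = conja M L g (w CD)"
      using conja_coset_rep_translate[OF N L Q s(2) g CD'(1)] conja_coset_rep_translate[OF M N R t(2) g CD'(2)]
        tl[OF CD'(2)] by (simp add: w_def a_def conja_comp[OF N g])
  next
    fix CD assume CD: "CD \<in> \<Omega>"
    then show "a \<one> CD = CD" using QG lcosets_one by (auto simp: a_def Omega_def)
    show "lin M L (w CD)" unfolding w_def using CD sl tl by (intro shaped_times) (auto simp: Omega_def)
  next
    fix g h CD assume "g \<in> carrier G" "h \<in> carrier G" "CD \<in> \<Omega>"
    then show "a (g \<otimes> h) CD = a g (a h CD)" using QG by (auto simp: a_def Omega_def lcosets_assoc)
  qed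
  then obtain J z where J: "J \<subseteq> \<Omega>" "sum w \<Omega> = sum z J" "\<forall>x\<in>J. z x \<in> traces {g \<in> carrier G. a g x = x} M L"
    by blast
  have "x * y = sum w \<Omega>"
    unfolding s(1) t(1) rtrace_def w_def Omega_def sum_product sum.cartesian_product
    by (rule sum.cong) auto
  moreover have "z j \<in> traces (conjg (coset_rep (fst j)) Q \<inter> conjg (coset_rep (snd j)) R) M L" if j: "j \<in> J" for j
  proof -
    define g where "g = coset_rep (fst j)"
    define h where "h = coset_rep (snd j)"
    have CD: "fst j \<in> lcosets Q" "snd j \<in> lcosets R" using j J(1) by (auto simp: Omega_def)
    have gh: "g \<in> carrier G" "h \<in> carrier G" "g <# Q = fst j" "h <# R = snd j"
      unfolding g_def h_def using coset_rep_closed coset_rep_coset Q R CD by blast+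
    have "{x \<in> carrier G. a x j = j} = conjg g Q \<inter> conjg h R"
      unfolding lcoset_stabilizer[OF Q gh(1), symmetric] lcoset_stabilizer[OF R gh(2), symmetric]
      by (auto simp: a_def gh prod_eq_iff)
    then show ?thesis using J(3) j by (auto simp: g_def h_def)
  qed
  ultimately show ?thesis using J(1,2) unfolding Omega_def by metis
qed

lemma ftrace_conja: "kmod M \<Longrightarrow> g \<in> carrier G \<Longrightarrow> lin M M x \<Longrightarrow> ftrace (conja M M g x) = ftrace x"
  unfolding conja_def by (subst ftrace_commute) (simp add: rho_inv_left shapedD flip: mult.assoc)

lemma ftrace_traces:
  assumes M: "kmod M" and H: "subgroup H G" and x: "x \<in> traces H M M"
  shows "\<exists>c. ftrace x = of_nat (card (lcosets H)) * c"
proof -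
  obtain t where t: "x = rtrace H M M t" "hom_on H M M t" using x by (auto simp: traces_def)
  have "ftrace x = (\<Sum>C\<in>lcosets H. ftrace t)" unfolding t rtrace_def ftrace_sum
    using coset_rep_closed[OF H] t(2) by (intro sum.cong) (auto simp: hom_on_def ftrace_conja[OF M])
  then show ?thesis by auto
qed

lemma diagc_sum: "finite A \<Longrightarrow> (\<Sum>a\<in>A. diagc n c) = diagc n (of_nat (card A) * c :: 'k::comm_ring_1)"
  by (rule fmat_eqI) (simp add: entry_sum entry_diagc)

text \<open>The scalar \<open>1 / [G : H]\<close> is fixed by conjugation, and its relative trace
  adds it up \<open>[G : H]\<close> times.\<close>

lemma idm_traces_index:
  fixes M :: "('a, 'k::field) kG_module"
  assumes M: "kmod M" and H: "subgroup H G" and n: "of_nat (card (lcosets H)) \<noteq> (0 :: 'k)"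
  shows "idm M \<in> traces H M M"
proof -
  let ?c = "1 / of_nat (card (lcosets H)) :: 'k"
  have c: "ghom M M (diagc (mdim M) ?c)" using ghom_diagc[OF M] .
  have "rtrace H M M (diagc (mdim M) ?c) = (\<Sum>C\<in>lcosets H. diagc (mdim M) ?c)"
    unfolding rtrace_def using coset_rep_closed[OF H] conja_ghom[OF M M c] by (intro sum.cong) auto
  also have "\<dots> = idm M" unfolding diagc_sum[OF finite_lcosets[OF H]] using n by simp
  finally show ?thesis unfolding traces_def using hom_on_mono[OF c subgroup.subset[OF H]]
    by (auto intro!: exI[of _ "diagc (mdim M) ?c"])
qed

text \<open>Rosenberg's lemma: by locality one summand of the identity is a unit, and multiplying it
  by its inverse stays inside the same trace ideal.\<close>

lemma indecomposable_traces:
  fixes N :: "('a, 'k::field) kG_module"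
  assumes N: "indecomposable_module G N" and J: "finite J" "\<And>j. j \<in> J \<Longrightarrow> subgroup (H j) G"
    and z: "\<And>j. j \<in> J \<Longrightarrow> z j \<in> traces (H j) N N" "idm N = sum z J"
  shows "\<exists>j\<in>J. idm N \<in> traces (H j) N N"
proof -
  have M: "kmod N" using N by (simp add: indecomposable_module_def)
  have zh: "ghom N N (z j)" if "j \<in> J" for j using traces_ghom[OF M M J(2) z(1)] that by blast
  have "funit (mdim N) (sum z J)" unfolding z(2)[symmetric] by (rule funitI[of _ _ "idm N"]) auto
  then have "\<exists>j\<in>J. funit (mdim N) (z j)"
    by (rule indecomposable_sum_unit[OF N J(1) zh, rotated])
  then obtain j where j: "j \<in> J" "funit (mdim N) (z j)" ..
  then obtain y where y: "shaped (mdim N) (mdim N) y" "z j * y = idm N" "y * z j = idm N"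
    unfolding funit_def by blast
  have "ghom N N y" using unit_inverse_ghom[OF zh[OF j(1)] M y] .
  then have "y * z j \<in> traces (H j) N N" using traces_comp_left[OF M M M J(2) z(1)] j by blast
  then show ?thesis using y j by auto
qed

text \<open>Mackey's formula for \<open>idm N * idm N\<close> and locality leave one intersection of
  conjugates, which is conjugated back into \<open>R\<close>. The divisibility will bound the order
  of a vertex.\<close>

lemma indecomposable_two_traces:
  fixes N :: "('a, 'k::field) kG_module"
  assumes N: "indecomposable_module G N" and Q: "subgroup Q G" "idm N \<in> traces Q N N"
    and R: "subgroup R G" "idm N \<in> traces R N N"
  shows "\<exists>K. subgroup K G \<and> K \<subseteq> R \<and> card K dvd card Q \<and> idm N \<in> traces K N N"
proof -
  have M: "kmod N" using N by (simp add: indecomposable_module_def)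
  obtain J z where J: "J \<subseteq> (lcosets Q) \<times> (lcosets R)" "idm N * idm N = sum z J"
    and z: "\<forall>j\<in>J. z j \<in> traces (conjg (coset_rep (fst j)) Q \<inter> conjg (coset_rep (snd j)) R) N N"
    using traces_mackey[OF M M M Q(1) R(1) Q(2) R(2)] by blast
  have fJ: "finite J" using J(1) finite_lcosets Q(1) R(1) finite_subset by blast
  define g where "g = (\<lambda>j :: 'a set \<times> 'a set. coset_rep (fst j))"
  define h where "h = (\<lambda>j :: 'a set \<times> 'a set. coset_rep (snd j))"
  have gh: "g j \<in> carrier G" "h j \<in> carrier G" if "j \<in> J" for j
    using that J(1) coset_rep_closed[OF Q(1), of "fst j"] coset_rep_closed[OF R(1), of "snd j"]
    unfolding g_def h_def by auto
  have gh3: "z j \<in> traces (conjg (g j) Q \<inter> conjg (h j) R) N N" if "j \<in> J" for j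
    using z that by (simp add: g_def h_def)
  have sub: "subgroup (conjg (g j) Q \<inter> conjg (h j) R) G" if "j \<in> J" for j
    using subgroups_Inter_pair[OF conjg_subgroup[OF Q(1) gh(1)[OF that]] conjg_subgroup[OF R(1) gh(2)[OF that]]] .
  have "\<exists>j\<in>J. idm N \<in> traces (conjg (g j) Q \<inter> conjg (h j) R) N N"
    by (rule indecomposable_traces[OF N fJ sub gh3]) (use J(2) in auto)
  then obtain j where j: "j \<in> J" "idm N \<in> traces (conjg (g j) Q \<inter> conjg (h j) R) N N" ..
  define D where "D = conjg (g j) Q \<inter> conjg (h j) R"
  define K where "K = conjg (inv (h j)) D"
  have D: "subgroup D G" unfolding D_def using sub[OF j(1)] .
  have hj: "h j \<in> carrier G" "g j \<in> carrier G" using gh j by auto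
  have RG: "R \<subseteq> carrier G" "Q \<subseteq> carrier G" using R Q subgroup.subset by blast+
  have "K \<subseteq> R"
  proof
    fix x assume "x \<in> K"
    then obtain r where r: "r \<in> R" "x = inv (h j) \<otimes> (h j \<otimes> r \<otimes> inv (h j)) \<otimes> inv (inv (h j))"
      by (auto simp: K_def D_def)
    then have "x = r" using hj RG by (auto simp: m_assoc)
    then show "x \<in> R" using r by simp
  qed
  moreover have "card K dvd card Q"
  proof -
    have "card K = card D" unfolding K_def using card_conjg[OF subgroup.subset[OF D] inv_closed[OF hj(1)]] .
    moreover have "card D dvd card (conjg (g j) Q)"
    proof -
      interpret C: group "G\<lparr>carrier := conjg (g j) Q\<rparr>"
        using subgroup.subgroup_is_group[OF conjg_subgroup[OF Q(1) hj(2)] group_axioms] .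
      have "subgroup D (G\<lparr>carrier := conjg (g j) Q\<rparr>)"
        using subgroup_incl[OF D conjg_subgroup[OF Q(1) hj(2)]] by (auto simp: D_def)
      from C.lagrange[OF this]
      have "card (conjg (g j) Q) = card D * card (rcosets\<^bsub>G\<lparr>carrier := conjg (g j) Q\<rparr>\<^esub> D)"
        by (simp add: Coset.order_def mult.commute)
      then show ?thesis by (rule dvdI)
    qed
    ultimately show ?thesis using card_conjg[OF RG(2) hj(2)] by simp
  qed
  moreover have "idm N \<in> traces K N N"
    unfolding K_def using traces_conjg[OF M M D inv_closed[OF hj(1)] j(2)[folded D_def]] .
  moreover have "subgroup K G" unfolding K_def using conjg_subgroup[OF D inv_closed[OF hj(1)]] .
  ultimately show ?thesis by blast
qed

section \<open>Trace ideals of a family of subgroups\<close>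

definition tideal :: "'a set set \<Rightarrow> ('a, 'k::field) kG_module \<Rightarrow> ('a, 'k) kG_module \<Rightarrow> 'k fmat set" where
  "tideal F M N = {\<Sum>Q\<in>F. z Q | z. \<forall>Q\<in>F. z Q \<in> traces Q M N}"

lemma tideal_comp_left:
  assumes "kmod M" "kmod N" "kmod L" "\<forall>Q\<in>F. subgroup Q G" "x \<in> tideal F M N" "ghom N L y"
  shows "y * x \<in> tideal F M L"
proof -
  obtain z where z: "x = sum z F" "\<forall>Q\<in>F. z Q \<in> traces Q M N" using assms(5) by (auto simp: tideal_def)
  then have "y * x = (\<Sum>Q\<in>F. y * z Q)" "\<forall>Q\<in>F. y * z Q \<in> traces Q M L"
    using traces_comp_left[OF assms(1-3) _ _ assms(6)] assms(4) by (auto simp: sum_distrib_left)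
  then show ?thesis unfolding tideal_def by blast
qed

lemma tideal_comp_right:
  assumes "kmod M" "kmod N" "kmod L" "\<forall>Q\<in>F. subgroup Q G" "x \<in> tideal F N L" "ghom M N y"
  shows "x * y \<in> tideal F M L"
proof -
  obtain z where z: "x = sum z F" "\<forall>Q\<in>F. z Q \<in> traces Q N L" using assms(5) by (auto simp: tideal_def)
  then have "x * y = (\<Sum>Q\<in>F. z Q * y)" "\<forall>Q\<in>F. z Q * y \<in> traces Q M L"
    using traces_comp_right[OF assms(1-3) _ _ assms(6)] assms(4) by (auto simp: sum_distrib_right)
  then show ?thesis unfolding tideal_def by blast
qed

lemma tideal_plus: "x \<in> tideal F M N \<Longrightarrow> y \<in> tideal F M N \<Longrightarrow> x + y \<in> tideal F M N"
proof -
  assume "x \<in> tideal F M N" "y \<in> tideal F M N"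
  then obtain z z' where "x = sum z F" "\<forall>Q\<in>F. z Q \<in> traces Q M N" "y = sum z' F" "\<forall>Q\<in>F. z' Q \<in> traces Q M N"
    by (auto simp: tideal_def)
  then show ?thesis unfolding tideal_def
    by (auto intro!: exI[of _ "\<lambda>Q. z Q + z' Q"] traces_plus simp: sum.distrib)
qed

lemma tideal_zero: "0 \<in> tideal F M N"
  unfolding tideal_def by (auto intro!: exI[of _ "\<lambda>_. 0"] traces_zero)

lemma tideal_sum: "(\<And>a. a \<in> A \<Longrightarrow> f a \<in> tideal F M N) \<Longrightarrow> sum f A \<in> tideal F M N"
  by (induction A rule: infinite_finite_induct) (auto simp: tideal_zero tideal_plus)

lemma traces_tideal:
  assumes "finite F" "Q \<in> F" "x \<in> traces Q M N"
  shows "x \<in> tideal F M N"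
  unfolding tideal_def
  by (rule CollectI, rule exI[of _ "\<lambda>P. if P = Q then x else 0"]) (use assms in \<open>auto simp: traces_zero\<close>)

lemma tideal_ghom:
  assumes "kmod M" "kmod N" "\<forall>Q\<in>F. subgroup Q G" "x \<in> tideal F M N"
  shows "ghom M N x"
  using assms traces_ghom[OF assms(1,2)] by (auto simp: tideal_def intro!: hom_on_sum)

lemma ftrace_tideal:
  fixes M :: "('a, 'k::field) kG_module"
  assumes M: "kmod M" and F: "\<And>Q. Q \<in> F \<Longrightarrow> subgroup Q G" "\<And>Q. Q \<in> F \<Longrightarrow> of_nat (card (lcosets Q)) = (0 :: 'k)"
    and x: "x \<in> tideal F M M"
  shows "ftrace x = 0"
proof -
  obtain z where z: "x = sum z F" "\<forall>Q\<in>F. z Q \<in> traces Q M M" using x by (auto simp: tideal_def)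
  have "ftrace (z Q) = 0" if "Q \<in> F" for Q
    using ftrace_traces[OF M F(1)[OF that], of "z Q"] z that F(2)[OF that] by auto
  then show ?thesis by (simp add: z ftrace_sum)
qed

lemma indecomposable_tideal:
  fixes N :: "('a, 'k::field) kG_module"
  assumes "indecomposable_module G N" "finite F" "\<forall>Q\<in>F. subgroup Q G" "idm N \<in> tideal F N N"
  shows "\<exists>Q\<in>F. idm N \<in> traces Q N N"
proof -
  obtain z where "idm N = sum z F" "\<forall>Q\<in>F. z Q \<in> traces Q N N" using assms(4) by (auto simp: tideal_def)
  then show ?thesis using indecomposable_traces[OF assms(1,2), of "\<lambda>Q. Q" z] assms(3) by blast
qed

end

section \<open>Relative projectivity\<close>

definition pos :: "'x list \<Rightarrow> 'x \<Rightarrow> nat" where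
  "pos xs x = (LEAST i. i < length xs \<and> xs ! i = x)"

lemma nth_pos: "x \<in> set xs \<Longrightarrow> pos xs x < length xs \<and> xs ! pos xs x = x"
  unfolding pos_def by (rule LeastI_ex) (simp add: in_set_conv_nth)

lemma pos_nth: "distinct xs \<Longrightarrow> i < length xs \<Longrightarrow> pos xs (xs ! i) = i"
  using nth_pos[of "xs ! i" xs] nth_eq_iff_index_eq[of xs "pos xs (xs ! i)" i] by simp

lemma inj_on_pos: "inj_on (pos xs) (set xs)"
  by (rule inj_onI) (metis nth_pos)

lemma listing_enumerates: "finite A \<Longrightarrow> distinct (listing A) \<and> set (listing A) = A"
  unfolding listing_def by (rule someI_ex) (use finite_distinct_list in blast)

text \<open>Describes block matrices with one block in each block column, the shape shared by
  permutation modules and induced modules.\<close>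

lemma sum_munit_entry:
  fixes f :: "'x \<Rightarrow> nat"
  assumes xs: "distinct xs"
  shows "entry (\<Sum>x\<in>set xs. fkron d (munit (f x) (pos xs x)) (y x)) i j
    = (if j div d < length xs then (if i div d = f (xs ! (j div d)) then entry (y (xs ! (j div d))) (i mod d) (j mod d) else 0)
       else (0 :: 'k::comm_ring_1))"
proof -
  have "entry (\<Sum>x\<in>set xs. fkron d (munit (f x) (pos xs x)) (y x)) i j
    = (\<Sum>l<length xs. entry (fkron d (munit (f (xs ! l)) (pos xs (xs ! l))) (y (xs ! l))) i j)"
    unfolding entry_sum by (rule sum.reindex_bij_betw[OF bij_betw_nth[OF xs refl refl], symmetric])
  also have "\<dots> = (\<Sum>l<length xs. if l = j div d then
      (if i div d = f (xs ! l) then entry (y (xs ! l)) (i mod d) (j mod d) else 0) else 0)"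
    by (rule sum.cong) (auto simp: pos_nth[OF xs] entry_fkron entry_munit)
  finally show ?thesis by (simp add: sum.delta)
qed

lemma fkron_munit_times:
  assumes "shaped d d x" "shaped d d y"
  shows "fkron d (munit a b) x * fkron d (munit b' c) y
    = (if b = b' then fkron d (munit a c) (x * y) else 0)"
  using assms by (simp add: fkron_times munit_times)

text \<open>Since \<open>f\<close> is injective, the block of the second factor indexed by
  \<open>b\<close> meets only the block \<open>s b\<close> of the first. Permutation matrices,
  induced actions and the maps in Higman's criterion are all multiplied in this way.\<close>

lemma block_sum_times:
  assumes A: "finite A" and f: "inj_on f A" and s: "\<And>b. b \<in> B \<Longrightarrow> s b \<in> A"
    and x: "\<And>a. a \<in> A \<Longrightarrow> shaped d d (x a)" and y: "\<And>b. b \<in> B \<Longrightarrow> shaped d d (y b)"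
  shows "(\<Sum>a\<in>A. fkron d (munit (g a) (f a)) (x a)) * (\<Sum>b\<in>B. fkron d (munit (f (s b)) (h b)) (y b))
    = (\<Sum>b\<in>B. fkron d (munit (g (s b)) (h b)) (x (s b) * y b))"
proof -
  have "(\<Sum>a\<in>A. fkron d (munit (g a) (f a)) (x a)) * (\<Sum>b\<in>B. fkron d (munit (f (s b)) (h b)) (y b))
    = (\<Sum>b\<in>B. \<Sum>a\<in>A. fkron d (munit (g a) (f a)) (x a) * fkron d (munit (f (s b)) (h b)) (y b))"
    unfolding sum_product by (rule sum.swap)
  also have "\<dots> = (\<Sum>b\<in>B. \<Sum>a\<in>A. if a = s b then fkron d (munit (g (s b)) (h b)) (x (s b) * y b) else 0)"
    by (intro sum.cong refl) (auto simp: fkron_munit_times x y s inj_on_eq_iff[OF f])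
  also have "\<dots> = (\<Sum>b\<in>B. fkron d (munit (g (s b)) (h b)) (x (s b) * y b))"
    using s by (intro sum.cong) (auto simp: sum.delta[OF A])
  finally show ?thesis .
qed

lemma fkron_1_munit: "fkron (Suc 0) (munit a b) (fone (Suc 0)) = munit a b"
  by (rule fmat_eqI) (simp add: entry_fkron entry_munit entry_diagc)

context finite_group
begin

section \<open>Permutation modules and coset modules\<close>

lemma rho_perm_module:
  assumes xs: "distinct xs" and \<phi>: "\<And>x. x \<in> set xs \<Longrightarrow> \<phi> g x \<in> set xs"
  shows "rho (perm_module xs \<phi> :: ('a, 'k::field) kG_module) g = (\<Sum>x\<in>set xs. munit (pos xs (\<phi> g x)) (pos xs x))"
proof (rule fmat_eqI)
  fix i j
  have 1: "entry (\<Sum>x\<in>set xs. munit (pos xs (\<phi> g x)) (pos xs x)) i j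
    = (if j < length xs then (if i = pos xs (\<phi> g (xs ! j)) then 1 else 0) else (0::'k))"
    using sum_munit_entry[OF xs, of "Suc 0" "\<lambda>x. pos xs (\<phi> g x)" "\<lambda>_. fone (Suc 0) :: 'k fmat" i j]
    by (simp add: fkron_1_munit entry_diagc)
  have "i = pos xs (\<phi> g (xs ! j)) \<longleftrightarrow> i < length xs \<and> \<phi> g (xs ! j) = xs ! i" if "j < length xs"
  proof -
    have "\<phi> g (xs ! j) \<in> set xs" using that \<phi> by simp
    from nth_pos[OF this] show ?thesis by (metis pos_nth[OF xs])
  qed
  then show "entry (rho (perm_module xs \<phi>) g) i j
    = entry (\<Sum>x\<in>set xs. munit (pos xs (\<phi> g x)) (pos xs x) :: 'k fmat) i j"
    unfolding 1 by (simp add: rho_def perm_module_def entry_of_mat)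
qed

lemma sum_munit_pos: "distinct xs \<Longrightarrow> (\<Sum>x\<in>set xs. munit (pos xs x) (pos xs x)) = fone (length xs)"
proof -
  assume xs: "distinct xs"
  have "(\<Sum>x\<in>set xs. munit (pos xs x) (pos xs x)) = (\<Sum>l<length xs. munit (pos xs (xs ! l)) (pos xs (xs ! l)))"
    by (rule sum.reindex_bij_betw[OF bij_betw_nth[OF xs refl refl], symmetric])
  also have "\<dots> = (\<Sum>l<length xs. munit l l)" by (rule sum.cong) (auto simp: pos_nth[OF xs])
  finally show ?thesis by (simp add: fone_eq_sum)
qed

lemma kmod_perm_module:
  assumes xs: "distinct xs"
    and \<phi>: "\<And>g x. g \<in> carrier G \<Longrightarrow> x \<in> set xs \<Longrightarrow> \<phi> g x \<in> set xs" "\<And>x. x \<in> set xs \<Longrightarrow> \<phi> \<one> x = x"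
    "\<And>g h x. g \<in> carrier G \<Longrightarrow> h \<in> carrier G \<Longrightarrow> x \<in> set xs \<Longrightarrow> \<phi> (g \<otimes> h) x = \<phi> g (\<phi> h x)"
  shows "kmod (perm_module xs \<phi> :: ('a, 'k::field) kG_module)"
proof (rule kmodI)
  let ?M = "perm_module xs \<phi> :: ('a, 'k) kG_module"
  have d: "mdim ?M = length xs" by (simp add: perm_module_def)
  show "act ?M g \<in> carrier_mat (mdim ?M) (mdim ?M)" for g by (simp add: perm_module_def)
  show "rho ?M \<one> = idm ?M"
    by (simp add: d rho_perm_module[OF xs] \<phi>(2) sum_munit_pos[OF xs])
  fix g h assume gh: "g \<in> carrier G" "h \<in> carrier G"
  have "rho ?M g * rho ?M h
    = (\<Sum>x\<in>set xs. fkron (Suc 0) (munit (pos xs (\<phi> g x)) (pos xs x)) (fone (Suc 0)))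
      * (\<Sum>x\<in>set xs. fkron (Suc 0) (munit (pos xs (\<phi> h x)) (pos xs x)) (fone (Suc 0)))"
    unfolding fkron_1_munit using gh \<phi>(1) by (simp add: rho_perm_module[OF xs])
  also have "\<dots> = (\<Sum>x\<in>set xs. fkron (Suc 0) (munit (pos xs (\<phi> g (\<phi> h x))) (pos xs x)) (fone (Suc 0) * fone (Suc 0)))"
    by (rule block_sum_times) (auto simp: inj_on_pos \<phi>(1) gh)
  also have "\<dots> = (\<Sum>x\<in>set xs. munit (pos xs (\<phi> (g \<otimes> h) x)) (pos xs x))"
    by (simp add: fkron_1_munit \<phi>(3) gh)
  also have "\<dots> = rho ?M (g \<otimes> h)"
    using \<phi>(1) gh by (simp add: rho_perm_module[OF xs])
  finally show "rho ?M (g \<otimes> h) = rho ?M g * rho ?M h" by simp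
qed

abbreviation cpos :: "'a set \<Rightarrow> 'a set \<Rightarrow> nat" where
  "cpos H \<equiv> pos (listing (lcosets H))"

lemma listing_lcosets: "subgroup H G \<Longrightarrow> distinct (listing (lcosets H))"
  "subgroup H G \<Longrightarrow> set (listing (lcosets H)) = lcosets H"
  using listing_enumerates[OF finite_lcosets] by blast+

lemma inj_on_cpos: "subgroup H G \<Longrightarrow> inj_on (cpos H) (lcosets H)"
  using inj_on_pos[of "listing (lcosets H)"] by (simp add: listing_lcosets)

lemma lcosets_translate_inj:
  assumes H: "subgroup H G" and g: "g \<in> carrier G"
  shows "inj_on (\<lambda>C. g <# C) (lcosets H)"
proof (rule inj_on_inverseI)
  fix C assume C: "C \<in> lcosets H"
  show "inv g <# (g <# C) = C"
    using lcosets_assoc[OF subgroup.subset[OF H] inv_closed[OF g] g C]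
      lcosets_one[OF subgroup.subset[OF H] C] g by simp
qed

lemma lcosets_translate_image:
  assumes H: "subgroup H G" and g: "g \<in> carrier G"
  shows "(\<lambda>C. g <# C) ` (lcosets H) = lcosets H"
proof (rule endo_inj_surj[OF finite_lcosets[OF H] _ lcosets_translate_inj[OF assms]])
  show "(\<lambda>C. g <# C) ` (lcosets H) \<subseteq> lcosets H"
    using lcosets_translate[OF subgroup.subset[OF H] g] by blast
qed

lemma kmod_coset_module:
  assumes Q: "subgroup Q G"
  shows "kmod (coset_module G Q)"
  unfolding coset_module_def
proof (rule kmod_perm_module, unfold listing_lcosets(2)[OF Q])
  show "distinct (listing (lcosets Q))" using listing_lcosets(1)[OF Q] .
  fix g C assume C: "C \<in> lcosets Q"
  show "\<one> <# C = C" using lcosets_one[OF subgroup.subset[OF Q] C] .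
  assume g: "g \<in> carrier G"
  show "g <# C \<in> lcosets Q" using lcosets_translate[OF subgroup.subset[OF Q] g C] .
  fix h assume h: "h \<in> carrier G"
  show "(g \<otimes> h) <# C = g <# (h <# C)" using lcosets_assoc[OF subgroup.subset[OF Q] g h C] .
qed

lemma rho_coset_module:
  assumes "subgroup Q G" "g \<in> carrier G"
  shows "rho (coset_module G Q) g = (\<Sum>C\<in>lcosets Q. munit (cpos Q (g <# C)) (cpos Q C))"
  unfolding coset_module_def using assms
  by (subst rho_perm_module) (auto simp: listing_lcosets lcosets_translate subgroup.subset)

lemma mdim_coset_module: "mdim (coset_module G Q) = length (listing (lcosets Q))"
  by (simp add: coset_module_def perm_module_def)

lemma finite_group_subgroup: "subgroup H G \<Longrightarrow> finite_group (G\<lparr>carrier := H\<rparr>)"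
  using subgroup.subgroup_is_group[OF _ group_axioms] finite_subset[OF subgroup.subset fin]
  by (simp add: finite_group_def finite_group_axioms_def)

section \<open>Induced modules and Higman's criterion\<close>

text \<open>The test \<open>h \<in> H\<close> in the definition singles out, for block column
  \<open>C\<close>, exactly the block row of \<open>g C\<close>; all other blocks are zero.\<close>

lemma rho_induced_module:
  assumes H: "subgroup H G" and L: "is_kG_module (G\<lparr>carrier := H\<rparr>) L" and g: "g \<in> carrier G"
  shows "rho (induced_module G H L) g = (\<Sum>C\<in>lcosets H.
    fkron (mdim L) (munit (cpos H (g <# C)) (cpos H C)) (rho L (inv (coset_rep (g <# C)) \<otimes> g \<otimes> coset_rep C)))"
    (is "_ = ?r")
proof (rule fmat_eqI)
  fix i j
  define cs where "cs = listing (lcosets H)"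
  define d where "d = mdim L"
  define n where "n = length cs * d"
  have cs: "distinct cs" "set cs = lcosets H" unfolding cs_def using listing_lcosets[OF H] by auto
  have HG: "H \<subseteq> carrier G" using subgroup.subset[OF H] .
  define hh where "hh = (\<lambda>a b. inv (coset_rep (cs ! a)) \<otimes> g \<otimes> coset_rep (cs ! b))"
  have r: "entry ?r i j = (if j div d < length cs then (if i div d = pos cs (g <# (cs ! (j div d))) then
      entry (rho L (inv (coset_rep (g <# (cs ! (j div d)))) \<otimes> g \<otimes> coset_rep (cs ! (j div d)))) (i mod d) (j mod d) else 0) else 0)"
    using sum_munit_entry[OF cs(1), of d "\<lambda>C. pos cs (g <# C)"
        "\<lambda>C. rho L (inv (coset_rep (g <# C)) \<otimes> g \<otimes> coset_rep C)" i j]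
    unfolding cs(2) by (simp only: d_def cs_def)
  have l: "entry (rho (induced_module G H L) g) i j
    = (if i < n \<and> j < n then (if hh (i div d) (j div d) \<in> H then act L (hh (i div d) (j div d)) $$ (i mod d, j mod d) else 0) else 0)"
    by (simp add: rho_def entry_of_mat induced_module_def Let_def coset_rep_def hh_def n_def d_def cs_def)
  have aL: "act L h \<in> carrier_mat d d" if "h \<in> H" for h
    using L that by (auto simp: is_kG_module_def d_def)
  show "entry (rho (induced_module G H L) g) i j = entry ?r i j"
  proof (cases "d = 0")
    case True
    have "entry (rho L h) a b = 0" if "h \<in> H" for h a b
      using aL[OF that] True by (simp add: rho_def entry_of_mat)
    moreover have "inv (coset_rep (g <# C)) \<otimes> g \<otimes> coset_rep C \<in> H" if "C \<in> lcosets H" for C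
      using coset_rep_translate[OF H g that] .
    ultimately have "entry ?r i j = 0" unfolding r using cs nth_mem[of "j div d" cs] by auto
    then show ?thesis unfolding l n_def using True by simp
  next
    case False
    have lt: "k div d < length cs \<longleftrightarrow> k < n" for k using False by (simp add: n_def div_less_iff_less_mult)
    show ?thesis
    proof (cases "j < n")
      case False
      then show ?thesis unfolding l r lt by simp
    next
      case j: True
      define C where "C = cs ! (j div d)"
      have C: "C \<in> lcosets H" unfolding C_def using nth_mem[of "j div d" cs] j lt cs by simp
      have gC: "g <# C \<in> set cs" using lcosets_translate[OF HG g C] cs by simp
      have key: "i < n \<and> hh (i div d) (j div d) \<in> H \<longleftrightarrow> i div d = pos cs (g <# C)"
      proof
        assume *: "i < n \<and> hh (i div d) (j div d) \<in> H"
        define D where "D = cs ! (i div d)"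
        have D: "D \<in> lcosets H" unfolding D_def using nth_mem[of "i div d" cs] * lt cs by simp
        have c: "coset_rep C \<in> carrier G" "coset_rep D \<in> carrier G" using coset_rep_closed[OF H] C D by auto
        have "inv (coset_rep D) \<otimes> g \<otimes> coset_rep C \<in> H" using * by (simp add: hh_def C_def D_def)
        then have "inv (coset_rep D) \<otimes> (g \<otimes> coset_rep C) \<in> H" using c g by (simp add: m_assoc)
        then have "(g \<otimes> coset_rep C) <# H = coset_rep D <# H"
          unfolding lcoset_eq_iff[OF H m_closed[OF g c(1)] c(2)] .
        then have "g <# C = D"
          unfolding lcos_m_assoc[OF HG g c(1), symmetric] coset_rep_coset[OF H C] coset_rep_coset[OF H D] .
        then show "i div d = pos cs (g <# C)" using * lt pos_nth[OF cs(1)] by (simp add: D_def)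
      next
        assume *: "i div d = pos cs (g <# C)"
        have "i < n" using nth_pos[OF gC] * lt[of i] by simp
        moreover have "cs ! (i div d) = g <# C" using nth_pos[OF gC] * by simp
        then have "hh (i div d) (j div d) \<in> H" unfolding hh_def using coset_rep_translate[OF H g C] by (simp add: C_def)
        ultimately show "i < n \<and> hh (i div d) (j div d) \<in> H" by blast
      qed
      show ?thesis
      proof (cases "i div d = pos cs (g <# C)")
        case True
        then have h: "i < n" "hh (i div d) (j div d) \<in> H" using key by auto
        have e: "cs ! (i div d) = g <# C" using nth_pos[OF gC] True by simp
        define k where "k = inv (coset_rep (g <# C)) \<otimes> g \<otimes> coset_rep C"
        have k: "hh (i div d) (j div d) = k" unfolding hh_def k_def e C_def ..
        show ?thesis unfolding l r lt C_def[symmetric] k k_def[symmetric]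
          using h[unfolded k] j True aL[OF h(2)[unfolded k]] \<open>d \<noteq> 0\<close> by (simp add: rho_def entry_of_mat)
      next
        case False
        then have "\<not> (i < n \<and> hh (i div d) (j div d) \<in> H)" using key by simp
        then show ?thesis unfolding l r lt using False by (simp add: C_def)
      qed
    qed
  qed
qed

context
  fixes H :: "'a set" and L :: "('a, 'k::field) kG_module"
  assumes H: "subgroup H G" and L: "is_kG_module (G\<lparr>carrier := H\<rparr>) L"
begin

private lemma HG: "H \<subseteq> carrier G" using subgroup.subset[OF H] .

private lemma L_shaped: "h \<in> H \<Longrightarrow> shaped (mdim L) (mdim L) (rho L h)"
  using finite_group.rho_shaped[OF finite_group_subgroup[OF H] L] by simp

private lemma L_mult: "h \<in> H \<Longrightarrow> k \<in> H \<Longrightarrow> rho L (h \<otimes> k) = rho L h * rho L k"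
  using finite_group.rho_mult[OF finite_group_subgroup[OF H] L] by simp

private lemma L_one: "rho L \<one> = idm L"
  using finite_group.rho_one[OF finite_group_subgroup[OF H] L] by simp

lemma mdim_induced_module: "mdim (induced_module G H L) = length (listing (lcosets H)) * mdim L"
  by (simp add: induced_module_def Let_def)

lemma idm_induced_module:
  "idm (induced_module G H L) = (\<Sum>C\<in>lcosets H. fkron (mdim L) (munit (cpos H C) (cpos H C)) (idm L))"
proof -
  have "(\<Sum>C\<in>lcosets H. munit (cpos H C) (cpos H C)) = (fone (length (listing (lcosets H))) :: 'k fmat)"
    using sum_munit_pos[OF listing_lcosets(1)[OF H]] unfolding listing_lcosets(2)[OF H] .
  then show ?thesis
    unfolding mdim_induced_module fkron_fone[symmetric] fkron_sum_left[symmetric] by simp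
qed

lemma kmod_induced_module: "kmod (induced_module G H L)"
proof (rule kmodI)
  let ?M = "induced_module G H L"
  show "act ?M g \<in> carrier_mat (mdim ?M) (mdim ?M)" for g
    by (simp add: induced_module_def Let_def)
  have 1: "inv (coset_rep C) \<otimes> \<one> \<otimes> coset_rep C = \<one>" if "C \<in> lcosets H" for C
    using coset_rep_closed[OF H that] by simp
  show "rho ?M \<one> = idm ?M"
    unfolding rho_induced_module[OF H L one_closed] idm_induced_module
    by (rule sum.cong) (auto simp: lcosets_one[OF HG] 1 L_one)
  fix g h assume g: "g \<in> carrier G" and h: "h \<in> carrier G"
  have tr: "inv (coset_rep (g <# C)) \<otimes> g \<otimes> coset_rep C \<in> H" if "g \<in> carrier G" "C \<in> lcosets H" for g C
    using coset_rep_translate[OF H that] .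
  have "rho ?M g * rho ?M h = (\<Sum>C\<in>lcosets H. fkron (mdim L) (munit (cpos H (g <# (h <# C))) (cpos H C))
     (rho L (inv (coset_rep (g <# (h <# C))) \<otimes> g \<otimes> coset_rep (h <# C)) * rho L (inv (coset_rep (h <# C)) \<otimes> h \<otimes> coset_rep C)))"
    unfolding rho_induced_module[OF H L g] rho_induced_module[OF H L h]
    by (rule block_sum_times)
      (auto simp: finite_lcosets H inj_on_cpos lcosets_translate HG g h intro!: L_shaped tr)
  also have "\<dots> = rho ?M (g \<otimes> h)"
    unfolding rho_induced_module[OF H L m_closed[OF g h]]
  proof (rule sum.cong)
    fix C assume C: "C \<in> lcosets H"
    have hC: "h <# C \<in> lcosets H" and gC: "g <# (h <# C) \<in> lcosets H"
      using lcosets_translate[OF HG] g h C by auto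
    have cl: "coset_rep C \<in> carrier G" "coset_rep (h <# C) \<in> carrier G" "coset_rep (g <# (h <# C)) \<in> carrier G"
      using coset_rep_closed[OF H] C hC gC by auto
    have "inv (coset_rep (g <# (h <# C))) \<otimes> g \<otimes> coset_rep (h <# C) \<otimes> (inv (coset_rep (h <# C)) \<otimes> h \<otimes> coset_rep C)
      = inv (coset_rep (g <# (h <# C))) \<otimes> (g \<otimes> (coset_rep (h <# C) \<otimes> inv (coset_rep (h <# C))) \<otimes> h) \<otimes> coset_rep C"
      using cl g h by (simp only: m_assoc m_closed inv_closed)
    also have "\<dots> = inv (coset_rep (g <# (h <# C))) \<otimes> (g \<otimes> h) \<otimes> coset_rep C" using cl g h by simp
    finally show "fkron (mdim L) (munit (cpos H (g <# (h <# C))) (cpos H C))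
     (rho L (inv (coset_rep (g <# (h <# C))) \<otimes> g \<otimes> coset_rep (h <# C)) * rho L (inv (coset_rep (h <# C)) \<otimes> h \<otimes> coset_rep C))
     = fkron (mdim L) (munit (cpos H (g \<otimes> h <# C)) (cpos H C)) (rho L (inv (coset_rep (g \<otimes> h <# C)) \<otimes> (g \<otimes> h) \<otimes> coset_rep C))"
      using L_mult[OF tr[OF g hC] tr[OF h C]] by (simp add: lcosets_assoc[OF HG g h C])
  qed simp
  finally show "rho ?M (g \<otimes> h) = rho ?M g * rho ?M h" by simp
qed

text \<open>The projections \<open>w C\<close> onto the blocks are permuted by conjugation as the
  cosets are by translation, and they add up to the identity; the stabilizer of the coset
  \<open>H\<close> is \<open>H\<close> itself.\<close>

lemma idm_induced_traces: "idm (induced_module G H L) \<in> traces H (induced_module G H L) (induced_module G H L)"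
proof -
  let ?M = "induced_module G H L" and ?d = "mdim L"
  note M = kmod_induced_module
  define w where "w = (\<lambda>C. fkron ?d (munit (cpos H C) (cpos H C)) (idm L))"
  have wl: "lin ?M ?M (w C)" if C: "C \<in> lcosets H" for C
    unfolding w_def mdim_induced_module
    using nth_pos[of C "listing (lcosets H)"] C listing_lcosets[OF H]
    by (intro fkron_shaped shaped_munit) auto
  have wg: "w (g <# C) = conja ?M ?M g (w C)" if g: "g \<in> carrier G" and C: "C \<in> lcosets H" for g C
  proof -
    define x where "x = (\<lambda>C. rho L (inv (coset_rep (g <# C)) \<otimes> g \<otimes> coset_rep C))"
    have x: "shaped ?d ?d (x C)" if "C \<in> lcosets H" for C
      unfolding x_def using coset_rep_translate[OF H g that] L_shaped by blast
    have r: "rho ?M g = (\<Sum>C\<in>lcosets H. fkron ?d (munit (cpos H (g <# C)) (cpos H C)) (x C))"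
      unfolding x_def by (rule rho_induced_module[OF H L g])
    have "rho ?M g * w C = (\<Sum>C\<in>lcosets H. fkron ?d (munit (cpos H (g <# C)) (cpos H C)) (x C))
      * (\<Sum>C\<in>{C}. fkron ?d (munit (cpos H C) (cpos H C)) (idm L))"
      unfolding r w_def by simp
    also have "\<dots> = (\<Sum>C\<in>{C}. fkron ?d (munit (cpos H (g <# C)) (cpos H C)) (x C * idm L))"
      by (rule block_sum_times) (use C x in \<open>auto simp: finite_lcosets H inj_on_cpos\<close>)
    finally have 1: "rho ?M g * w C = fkron ?d (munit (cpos H (g <# C)) (cpos H C)) (x C)"
      using shapedD(2)[OF x[OF C]] by simp
    have "w (g <# C) * rho ?M g = (\<Sum>D\<in>lcosets H. if D = C then fkron ?d (munit (cpos H (g <# C)) (cpos H C)) (x C) else 0)"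
      unfolding r sum_distrib_left
    proof (rule sum.cong)
      fix D assume D: "D \<in> lcosets H"
      have "cpos H (g <# C) = cpos H (g <# D) \<longleftrightarrow> D = C"
        using inj_on_eq_iff[OF inj_on_cpos[OF H]] inj_on_eq_iff[OF lcosets_translate_inj[OF H g]]
          lcosets_translate[OF HG g] C D by metis
      then show "w (g <# C) * fkron ?d (munit (cpos H (g <# D)) (cpos H D)) (x D)
        = (if D = C then fkron ?d (munit (cpos H (g <# C)) (cpos H C)) (x C) else 0)"
        unfolding w_def using fkron_munit_times[OF shaped_diagc x[OF D]] shapedD(1)[OF x[OF D]] by auto
    qed simp
    also have "\<dots> = rho ?M g * w C" using C 1 by (simp add: finite_lcosets H)
    finally have "conja ?M ?M g (w C) = w (g <# C) * (rho ?M g * rho ?M (inv g))"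
      unfolding conja_def by (simp only: mult.assoc[symmetric])
    then show ?thesis
      using shapedD(2)[OF wl[OF lcosets_translate[OF HG g C]]] by (simp add: rho_inv_right[OF M g])
  qed
  have "sum w (lcosets H) \<in> traces {g \<in> carrier G. g <# H = H} ?M ?M"
  proof (rule sum_orbit_traces[OF M M])
    show "\<exists>g\<in>carrier G. C = g <# H" if "C \<in> lcosets H" for C using that by (auto simp: LCOSETS_def)
  qed (use wl wg HG lcosets_translate lcosets_assoc lcosets_one lcosets_self[OF H] finite_lcosets[OF H] in auto)
  moreover have "{g \<in> carrier G. g <# H = H} = H"
  proof -
    have "{g \<in> carrier G. g <# H = H} = conjg \<one> H"
      using lcoset_stabilizer[OF H one_closed] lcos_mult_one[OF HG] by simp
    also have "\<dots> = H" using HG by (force simp: image_iff)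
    finally show ?thesis .
  qed
  ultimately show ?thesis unfolding idm_induced_module w_def by simp
qed

end

lemma kmod_restrict: "kmod M \<Longrightarrow> subgroup H G \<Longrightarrow> is_kG_module (G\<lparr>carrier := H\<rparr>) M"
  using subsetD[OF subgroup.subset[of H G]] by (simp add: is_kG_module_def)

text \<open>Higman's criterion. Forward, the identity of an induced module is a trace and traces
  form an ideal; backward, a map \<open>t\<close> whose trace is the identity splits the canonical
  map from the induced module onto \<open>M\<close>.\<close>

lemma relatively_projective_iff:
  fixes M :: "('a, 'k::field) kG_module"
  assumes M: "kmod M" and H: "subgroup H G"
  shows "relatively_projective G H M \<longleftrightarrow> idm M \<in> traces H M M"
proof
  assume "relatively_projective G H M"
  then obtain L where L: "is_kG_module (G\<lparr>carrier := H\<rparr>) L" "direct_summand G M (induced_module G H L)"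
    by (auto simp: relatively_projective_def)
  let ?I = "induced_module G H L"
  have I: "kmod ?I" using kmod_induced_module[OF H L(1)] .
  obtain i p where ip: "ghom M ?I i" "ghom ?I M p" "p * i = idm M"
    using L(2) direct_summand_iff[OF M I] by blast
  have "p * idm ?I * i \<in> traces H M M"
    using traces_comp_right[OF M I M H traces_comp_left[OF I I M H idm_induced_traces[OF H L(1)] ip(2)] ip(1)] .
  then show "idm M \<in> traces H M M" using ip hom_on_id_right[OF ip(2)] by simp
next
  assume "idm M \<in> traces H M M"
  then obtain t where t: "idm M = rtrace H M M t" "hom_on H M M t" by (auto simp: traces_def)
  have HG: "H \<subseteq> carrier G" using subgroup.subset[OF H] .
  have L: "is_kG_module (G\<lparr>carrier := H\<rparr>) M" using kmod_restrict[OF M H] .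
  let ?I = "induced_module G H M" and ?d = "mdim M"
  have I: "kmod ?I" using kmod_induced_module[OF H L] .
  let ?r = coset_rep
  \<comment> \<open>With \<open>c\<close> the representative of \<open>C\<close>, these are
    \<open>v \<mapsto> \<Sum>C. c \<otimes> t (c^-1 v)\<close> and
    \<open>c \<otimes> v \<mapsto> c v\<close>, so \<open>p * i\<close> is the relative trace of
    \<open>t\<close>.\<close>
  define i where "i = (\<Sum>C\<in>lcosets H. fkron ?d (munit (cpos H C) 0) (t * rho M (inv (?r C))))"
  define p where "p = (\<Sum>C\<in>lcosets H. fkron ?d (munit 0 (cpos H C)) (rho M (?r C)))"
  have cr: "?r C \<in> carrier G" if "C \<in> lcosets H" for C using coset_rep_closed[OF H that] .
  have gr: "?r (g <# C) \<in> carrier G" "g <# C \<in> lcosets H" if "C \<in> lcosets H" "g \<in> carrier G" for g C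
    using cr lcosets_translate[OF HG] that by auto
  have tl: "shaped ?d ?d t" using t(2) by (simp add: hom_on_def)
  have sh: "shaped ?d ?d (t * rho M (inv (?r C)))" if "C \<in> lcosets H" for C
    using shaped_times[OF tl rho_shaped[OF M]] cr[OF that] by simp
  have sr: "shaped ?d ?d (rho M (?r C))" if "C \<in> lcosets H" for C
    using rho_shaped[OF M cr[OF that]] .
  have mC: "cpos H C < length (listing (lcosets H))" if "C \<in> lcosets H" for C
    using nth_pos[of C "listing (lcosets H)"] that listing_lcosets[OF H] by simp
  have "p * i = (\<Sum>C\<in>lcosets H. fkron ?d (munit 0 0) (rho M (?r C) * (t * rho M (inv (?r C)))))"
    unfolding i_def p_def
    by (rule block_sum_times) (auto simp: finite_lcosets H inj_on_cpos sh sr)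
  also have "\<dots> = (\<Sum>C\<in>lcosets H. conja M M (?r C) t)"
    by (rule sum.cong) (auto simp: fkron_munit_0[OF shaped_times[OF sr sh]] conja_def mult.assoc)
  finally have pi: "p * i = idm M" using t(1) by (simp add: rtrace_def)
  have sI: "mdim ?I = length (listing (lcosets H)) * ?d" using mdim_induced_module[OF H L] .
  have li: "lin M ?I i"
  proof -
    have "shaped (length (listing (lcosets H)) * ?d) (1 * ?d) i" unfolding i_def
      using mC sh by (intro shaped_sum fkron_shaped shaped_munit) auto
    then show ?thesis by (simp add: sI)
  qed
  have lp: "lin ?I M p"
  proof -
    have "shaped (1 * ?d) (length (listing (lcosets H)) * ?d) p" unfolding p_def
      using mC sr by (intro shaped_sum fkron_shaped shaped_munit) auto
    then show ?thesis by (simp add: sI)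
  qed
  have hh: "inv (?r (g <# C)) \<otimes> g \<otimes> ?r C \<in> H" if "C \<in> lcosets H" "g \<in> carrier G" for g C
    using coset_rep_translate[OF H that(2,1)] .
  have hi: "rho ?I g * i = i * rho M g" if g: "g \<in> carrier G" for g
  proof -
    have "rho ?I g * i = (\<Sum>C\<in>lcosets H. fkron ?d (munit (cpos H (g <# C)) 0)
        (rho M (inv (?r (g <# C)) \<otimes> g \<otimes> ?r C) * (t * rho M (inv (?r C)))))"
      unfolding i_def rho_induced_module[OF H L g]
      by (rule block_sum_times)
        (use HG g hh in \<open>auto simp: finite_lcosets H inj_on_cpos sh intro!: rho_shaped[OF M]\<close>)
    also have "\<dots> = (\<Sum>C\<in>lcosets H. fkron ?d (munit (cpos H (g <# C)) 0) (t * rho M (inv (?r (g <# C))) * rho M g))"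
    proof (rule sum.cong)
      fix C assume C: "C \<in> lcosets H"
      have "rho M (inv (?r (g <# C)) \<otimes> g \<otimes> ?r C) * (t * rho M (inv (?r C)))
        = t * (rho M (inv (?r (g <# C)) \<otimes> g \<otimes> ?r C) * rho M (inv (?r C)))"
        using hom_onD(2)[OF t(2) hh[OF C g]] by (simp flip: mult.assoc)
      also have "\<dots> = t * rho M (inv (?r (g <# C)) \<otimes> g \<otimes> ?r C \<otimes> inv (?r C))"
        using C g cr gr by (simp add: rho_mult[OF M])
      also have "inv (?r (g <# C)) \<otimes> g \<otimes> ?r C \<otimes> inv (?r C) = inv (?r (g <# C)) \<otimes> g"
        using C g cr gr by (simp add: m_assoc)
      finally show "fkron ?d (munit (cpos H (g <# C)) 0) (rho M (inv (?r (g <# C)) \<otimes> g \<otimes> ?r C) * (t * rho M (inv (?r C))))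
        = fkron ?d (munit (cpos H (g <# C)) 0) (t * rho M (inv (?r (g <# C))) * rho M g)"
        using C g gr by (simp add: rho_mult[OF M] mult.assoc)
    qed simp
    also have "\<dots> = (\<Sum>C\<in>(\<lambda>C. g <# C) ` (lcosets H). fkron ?d (munit (cpos H C) 0) (t * rho M (inv (?r C)) * rho M g))"
      by (simp add: sum.reindex[OF lcosets_translate_inj[OF H g]])
    also have "\<dots> = (\<Sum>C\<in>lcosets H. fkron ?d (munit (cpos H C) 0) (t * rho M (inv (?r C))) * fkron ?d (munit 0 0) (rho M g))"
      unfolding lcosets_translate_image[OF H g]
      by (rule sum.cong) (auto simp: fkron_munit_times[OF sh rho_shaped[OF M g]])
    also have "\<dots> = i * rho M g"
      by (simp add: i_def sum_distrib_right fkron_munit_0[OF rho_shaped[OF M g]])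
    finally show ?thesis .
  qed
  have hp: "rho M g * p = p * rho ?I g" if g: "g \<in> carrier G" for g
  proof -
    have "p * rho ?I g = (\<Sum>C\<in>lcosets H. fkron ?d (munit 0 (cpos H C))
        (rho M (?r (g <# C)) * rho M (inv (?r (g <# C)) \<otimes> g \<otimes> ?r C)))"
      unfolding p_def rho_induced_module[OF H L g]
      by (rule block_sum_times)
        (use HG g hh gr in \<open>auto simp: finite_lcosets H inj_on_cpos sr intro!: rho_shaped[OF M]\<close>)
    also have "\<dots> = (\<Sum>C\<in>lcosets H. fkron ?d (munit 0 0) (rho M g) * fkron ?d (munit 0 (cpos H C)) (rho M (?r C)))"
    proof (rule sum.cong)
      fix C assume C: "C \<in> lcosets H"
      have "?r (g <# C) \<otimes> (inv (?r (g <# C)) \<otimes> g \<otimes> ?r C) = g \<otimes> ?r C"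
        using C g gr[OF C g] cr[OF C] by (simp add: m_assoc)
      then have "rho M (?r (g <# C)) * rho M (inv (?r (g <# C)) \<otimes> g \<otimes> ?r C) = rho M g * rho M (?r C)"
        using C g gr[OF C g] cr[OF C] by (simp flip: rho_mult[OF M])
      then show "fkron ?d (munit 0 (cpos H C)) (rho M (?r (g <# C)) * rho M (inv (?r (g <# C)) \<otimes> g \<otimes> ?r C))
        = fkron ?d (munit 0 0) (rho M g) * fkron ?d (munit 0 (cpos H C)) (rho M (?r C))"
        by (simp add: fkron_munit_times[OF rho_shaped[OF M g] sr[OF C]])
    qed simp
    also have "\<dots> = rho M g * p"
      by (simp add: p_def sum_distrib_left fkron_munit_0[OF rho_shaped[OF M g]])
    finally show ?thesis by simp
  qed
  have "direct_summand G M ?I"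
    unfolding direct_summand_iff[OF M I] using li lp hi hp pi by (auto simp: hom_on_def)
  then show "relatively_projective G H M" using L by (auto simp: relatively_projective_def)
qed

lemma rho_trivial_module: "rho (trivial_module n) g = fone n"
  by (simp add: rho_def trivial_module_def)

lemma mdim_trivial_module [simp]: "mdim (trivial_module n) = n"
  by (simp add: trivial_module_def)

lemma kmod_trivial_module: "kmod (trivial_module n)"
  by (simp add: is_kG_module_def trivial_module_def)

text \<open>\<open>k[G/Q]\<close> is induced from the trivial module, with literally the same
  matrices on the group.\<close>

lemma idm_coset_module_traces:
  assumes Q: "subgroup Q G"
  shows "idm (coset_module G Q :: ('a, 'k::field) kG_module) \<in> traces Q (coset_module G Q) (coset_module G Q)"
proof -
  let ?V = "coset_module G Q :: ('a, 'k) kG_module" and ?L = "trivial_module (Suc 0) :: ('a, 'k) kG_module"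
  have V: "kmod ?V" using kmod_coset_module[OF Q] .
  have L: "is_kG_module (G\<lparr>carrier := Q\<rparr>) ?L" using kmod_restrict[OF kmod_trivial_module Q] .
  let ?I = "induced_module G Q ?L"
  have d: "mdim ?I = mdim ?V" by (simp add: mdim_induced_module[OF Q L] mdim_coset_module)
  have r: "rho ?I g = rho ?V g" if "g \<in> carrier G" for g
    by (simp add: rho_induced_module[OF Q L that] rho_coset_module[OF Q that] rho_trivial_module fkron_1_munit)
  have "ghom ?V ?I (idm ?V)" "ghom ?I ?V (idm ?V)"
    using r rho_id_left[OF V] rho_id_right[OF V] by (auto simp: hom_on_def d)
  then have "direct_summand G ?V ?I"
    unfolding direct_summand_iff[OF V kmod_induced_module[OF Q L]] using fone_idem by blast
  then have "relatively_projective G Q ?V" using L by (auto simp: relatively_projective_def)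
  then show ?thesis using relatively_projective_iff[OF V Q] by simp
qed

section \<open>Tensor products and projectivity relative to coset modules\<close>

lemma rho_tensor_module:
  assumes "kmod L" "g \<in> carrier G"
  shows "rho (tensor_module V L) g = fkron (mdim L) (rho V g) (rho L g)"
  unfolding rho_def tensor_module_def using assms
  by (simp add: is_kG_module_def of_mat_kronecker)

lemma mdim_tensor_module [simp]: "mdim (tensor_module V L) = mdim V * mdim L"
  by (simp add: tensor_module_def)

lemma kmod_tensor_module:
  assumes V: "kmod V" and L: "kmod L"
  shows "kmod (tensor_module V L)"
proof (rule kmodI)
  fix g assume g: "g \<in> carrier G"
  show "act (tensor_module V L) g \<in> carrier_mat (mdim (tensor_module V L)) (mdim (tensor_module V L))"
  proof -
    have "act V g \<in> carrier_mat (mdim V) (mdim V)" "act L g \<in> carrier_mat (mdim L) (mdim L)"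
      using V L g by (auto simp: is_kG_module_def)
    then show ?thesis unfolding tensor_module_def kronecker_def by auto
  qed
  fix h assume h: "h \<in> carrier G"
  show "rho (tensor_module V L) (g \<otimes> h) = rho (tensor_module V L) g * rho (tensor_module V L) h"
    using g h by (simp add: rho_tensor_module[OF L] fkron_times rho_shaped[OF L] rho_mult V L)
qed (simp add: rho_tensor_module[OF L] rho_one V L fkron_fone)

lemma conja_tensor:
  assumes "kmod V" "kmod W" "kmod L" "g \<in> carrier G" "lin L L y"
  shows "conja (tensor_module V L) (tensor_module W L) g (fkron (mdim L) x y)
    = fkron (mdim L) (conja V W g x) (conja L L g y)"
  using assms by (simp add: conja_def rho_tensor_module fkron_times rho_shaped shaped_times[OF rho_shaped])

lemma ghom_tensor:
  assumes V: "kmod V" and W: "kmod W" and L: "kmod L" and x: "hom_on H V W x" and H: "H \<subseteq> carrier G"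
  shows "hom_on H (tensor_module V L) (tensor_module W L) (fkron (mdim L) x (idm L))"
proof -
  have "rho (tensor_module W L) h * fkron (mdim L) x (idm L) = fkron (mdim L) x (idm L) * rho (tensor_module V L) h"
    if "h \<in> H" for h
    using hom_onD(2)[OF x that] that H
    by (auto simp: rho_tensor_module[OF L] fkron_times rho_shaped[OF L] rho_id_left[OF L] rho_id_right[OF L] subset_iff)
  then show ?thesis using hom_onD(1)[OF x] by (simp add: hom_on_def fkron_shaped)
qed

text \<open>The identity of \<open>L\<close> is fixed by conjugation, so tensoring with it commutes
  with the relative trace.\<close>

lemma traces_tensor:
  assumes V: "kmod V" and L: "kmod L" and Q: "subgroup Q G" and x: "x \<in> traces Q V V"
  shows "fkron (mdim L) x (idm L) \<in> traces Q (tensor_module V L) (tensor_module V L)"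
proof -
  obtain t where t: "x = rtrace Q V V t" "hom_on Q V V t" using x by (auto simp: traces_def)
  have "fkron (mdim L) x (idm L) = rtrace Q (tensor_module V L) (tensor_module V L) (fkron (mdim L) t (idm L))"
    unfolding t rtrace_def fkron_sum_left
    by (rule sum.cong)
      (auto simp: conja_tensor[OF V V L coset_rep_closed[OF Q] shaped_diagc] conja_ghom[OF L L ghom_id[OF L] coset_rep_closed[OF Q]])
  then show ?thesis using ghom_tensor[OF V V L t(2) subgroup.subset[OF Q]] by (auto simp: traces_def)
qed

lemma tideal_tensor:
  assumes V: "kmod V" and L: "kmod L" and F: "\<forall>Q\<in>F. subgroup Q G" and x: "x \<in> tideal F V V"
  shows "fkron (mdim L) x (idm L) \<in> tideal F (tensor_module V L) (tensor_module V L)"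
proof -
  obtain z where z: "x = sum z F" "\<forall>Q\<in>F. z Q \<in> traces Q V V" using x by (auto simp: tideal_def)
  then show ?thesis unfolding tideal_def
    by (auto simp: fkron_sum_left F traces_tensor[OF V L] intro!: exI[of _ "\<lambda>Q. fkron (mdim L) (z Q) (idm L)"])
qed

lemma idm_direct_sum_cosets:
  assumes Qs: "\<forall>Q\<in>set Qs. subgroup Q G" and F: "finite F" "set Qs \<subseteq> F" "\<forall>Q\<in>F. subgroup Q G"
  defines "V \<equiv> direct_sum (map (coset_module G) Qs) :: ('a, 'k::field) kG_module"
  shows "idm V \<in> tideal F V V"
proof -
  let ?Cs = "map (coset_module G) Qs :: ('a, 'k) kG_module list"
  have Cs: "\<forall>N\<in>set ?Cs. kmod N" using Qs kmod_coset_module by auto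
  have V: "kmod V" unfolding V_def using kmod_direct_sum[OF Cs] .
  obtain i p where ip: "decomposes V ?Cs i p" unfolding V_def using direct_sum_decomposes[OF Cs] by blast
  have "i j * p j \<in> tideal F V V" if j: "j < length ?Cs" for j
  proof -
    have Q: "subgroup (Qs ! j) G" using Qs j by simp
    have C: "kmod (?Cs ! j)" using bspec[OF Cs nth_mem[OF j]] .
    have "idm (?Cs ! j) \<in> traces (Qs ! j) (?Cs ! j) (?Cs ! j)" using idm_coset_module_traces[OF Q] j by simp
    then have "i j * idm (?Cs ! j) * p j \<in> traces (Qs ! j) V V"
      using traces_comp_right[OF V C V Q traces_comp_left[OF C C V Q]] decomposesD[OF ip j] by blast
    then have "i j * p j \<in> traces (Qs ! j) V V" unfolding decomposesD(4)[OF ip j] .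
    moreover have "Qs ! j \<in> F" using F(2) j by auto
    ultimately show ?thesis using traces_tideal[OF F(1)] by blast
  qed
  then show ?thesis using decomposes_sum[OF ip] tideal_sum[of "{..<length ?Cs}" "\<lambda>j. i j * p j" F V V] by simp
qed

text \<open>The identity of each \<open>k[G/Q]\<close> is a trace from \<open>Q\<close>; membership
  in the trace ideal passes to direct sums, to tensor products and to summands.\<close>

lemma module_projective_tideal:
  fixes W :: "('a, 'k::field) kG_module"
  assumes Qs: "\<forall>Q\<in>set Qs. subgroup Q G" and F: "finite F" "set Qs \<subseteq> F" "\<forall>Q\<in>F. subgroup Q G"
    and W: "kmod W" and p: "module_projective G (direct_sum (map (coset_module G) Qs)) W"
  shows "idm W \<in> tideal F W W"
proof -
  let ?V = "direct_sum (map (coset_module G) Qs) :: ('a, 'k) kG_module"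
  have V: "kmod ?V" using Qs kmod_coset_module by (intro kmod_direct_sum) auto
  obtain L where L: "kmod L" "direct_summand G W (tensor_module ?V L)" using p by (auto simp: module_projective_def)
  let ?T = "tensor_module ?V L"
  have T: "kmod ?T" using kmod_tensor_module[OF V L(1)] .
  obtain i q where iq: "ghom W ?T i" "ghom ?T W q" "q * i = idm W" using L(2) direct_summand_iff[OF W T] by blast
  have "idm ?T \<in> tideal F ?T ?T"
    using tideal_tensor[OF V L(1) F(3) idm_direct_sum_cosets[OF Qs F]] by (simp add: fkron_fone)
  then have "q * idm ?T * i \<in> tideal F W W"
    using tideal_comp_right[OF W T W F(3) tideal_comp_left[OF T T W F(3)]] iq by blast
  then show ?thesis using iq hom_on_id_right[OF iq(2)] by simp
qed

text \<open>A trace \<open>\<Sum>C. y C\<close> factors as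
  \<open>W \<rightarrow> k[G/Q] \<otimes> W \<rightarrow> W\<close>, first by
  \<open>v \<mapsto> \<Sum>C. C \<otimes> y C v\<close>, then by the augmentation \<open>u\<close>.
  Only the first map depends on \<open>x\<close>.\<close>

lemma traces_factor_coset:
  fixes W :: "('a, 'k::field) kG_module"
  assumes W: "kmod W" and Q: "subgroup Q G" and x: "x \<in> traces Q W W"
  defines "u \<equiv> (\<Sum>C\<in>lcosets Q. munit 0 (cpos Q C))"
  shows "\<exists>i. ghom W (tensor_module (coset_module G Q) W) i \<and> fkron (mdim W) u (idm W) * i = x"
proof -
  let ?K = "coset_module G Q :: ('a, 'k) kG_module" and ?d = "mdim W"
  obtain t where t: "x = rtrace Q W W t" "hom_on Q W W t" using x by (auto simp: traces_def)
  define y where "y = (\<lambda>C. conja W W (coset_rep C) t)"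
  have y: "shaped ?d ?d (y C)" if "C \<in> lcosets Q" for C
    unfolding y_def using conja_lin[OF W W coset_rep_closed[OF Q that]] t(2) by (simp add: hom_on_def)
  have QG: "Q \<subseteq> carrier G" using subgroup.subset[OF Q] .
  define i where "i = (\<Sum>C\<in>lcosets Q. fkron ?d (munit (cpos Q C) 0) (y C))"
  have mC: "cpos Q C < length (listing (lcosets Q))" if "C \<in> lcosets Q" for C
    using nth_pos[of C "listing (lcosets Q)"] that listing_lcosets[OF Q] by simp
  have "fkron ?d u (idm W) * i = (\<Sum>C\<in>lcosets Q. fkron ?d (munit 0 0) (idm W * y C))"
    unfolding u_def i_def fkron_sum_left
    by (rule block_sum_times) (auto simp: finite_lcosets Q inj_on_cpos y)
  also have "\<dots> = x" unfolding t rtrace_def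
    using shapedD(1)[OF y] fkron_munit_0[OF y] by (intro sum.cong) (auto simp: y_def)
  finally have 1: "fkron ?d u (idm W) * i = x" .
  have "shaped (length (listing (lcosets Q)) * ?d) (1 * ?d) i" unfolding i_def
    using mC y by (intro shaped_sum fkron_shaped shaped_munit) auto
  then have l: "lin W (tensor_module ?K W) i" by (simp add: mdim_coset_module)
  have "rho (tensor_module ?K W) g * i = i * rho W g" if g: "g \<in> carrier G" for g
  proof -
    have "rho (tensor_module ?K W) g * i = (\<Sum>C\<in>lcosets Q. fkron ?d (munit (cpos Q (g <# C)) (cpos Q C)) (rho W g)) * i"
      by (simp add: rho_tensor_module[OF W g] rho_coset_module[OF Q g] fkron_sum_left)
    also have "\<dots> = (\<Sum>C\<in>lcosets Q. fkron ?d (munit (cpos Q (g <# C)) 0) (rho W g * y C))"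
      unfolding i_def by (rule block_sum_times) (auto simp: finite_lcosets Q inj_on_cpos y rho_shaped[OF W g])
    also have "\<dots> = (\<Sum>C\<in>lcosets Q. fkron ?d (munit (cpos Q (g <# C)) 0) (y (g <# C) * rho W g))"
    proof (rule sum.cong)
      fix C assume C: "C \<in> lcosets Q"
      have "y (g <# C) * rho W g = rho W g * (y C * (rho W (inv g) * rho W g))"
        unfolding y_def conja_coset_rep_translate[OF W W Q t(2) g C] by (simp add: conja_def[of W W g] mult.assoc)
      also have "\<dots> = rho W g * y C" using shapedD(2)[OF y[OF C]] by (simp add: rho_inv_left[OF W g])
      finally show "fkron ?d (munit (cpos Q (g <# C)) 0) (rho W g * y C)
        = fkron ?d (munit (cpos Q (g <# C)) 0) (y (g <# C) * rho W g)" by simp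
    qed simp
    also have "\<dots> = (\<Sum>C\<in>(\<lambda>C. g <# C) ` (lcosets Q). fkron ?d (munit (cpos Q C) 0) (y C * rho W g))"
      by (simp add: sum.reindex[OF lcosets_translate_inj[OF Q g]])
    also have "\<dots> = (\<Sum>C\<in>lcosets Q. fkron ?d (munit (cpos Q C) 0) (y C) * fkron ?d (munit 0 0) (rho W g))"
      unfolding lcosets_translate_image[OF Q g]
      by (rule sum.cong) (auto simp: fkron_munit_times[OF y rho_shaped[OF W g]])
    also have "\<dots> = i * rho W g"
      by (simp add: i_def sum_distrib_right fkron_munit_0[OF rho_shaped[OF W g]])
    finally show ?thesis .
  qed
  with l 1 show ?thesis unfolding hom_on_def by blast
qed

lemma ghom_augmentation:
  assumes Q: "subgroup Q G"
  shows "ghom (coset_module G Q) (trivial_module 1) (\<Sum>C\<in>lcosets Q. munit 0 (cpos Q C) :: 'k::field fmat)"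
proof -
  let ?u = "\<Sum>C\<in>lcosets Q. munit 0 (cpos Q C) :: 'k fmat"
  have mC: "cpos Q C < length (listing (lcosets Q))" if "C \<in> lcosets Q" for C
    using nth_pos[of C "listing (lcosets Q)"] that listing_lcosets[OF Q] by simp
  have s: "shaped 1 (length (listing (lcosets Q))) ?u"
    using mC by (intro shaped_sum shaped_munit) auto
  have "?u * rho (coset_module G Q) g = ?u" if g: "g \<in> carrier G" for g
  proof -
    have "?u * rho (coset_module G Q) g
      = (\<Sum>C\<in>lcosets Q. fkron (Suc 0) (munit 0 (cpos Q C)) (fone (Suc 0)))
       * (\<Sum>C\<in>lcosets Q. fkron (Suc 0) (munit (cpos Q (g <# C)) (cpos Q C)) (fone (Suc 0)))"
      by (simp add: fkron_1_munit rho_coset_module[OF Q g])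
    also have "\<dots> = (\<Sum>C\<in>lcosets Q. fkron (Suc 0) (munit 0 (cpos Q C)) (fone (Suc 0) * fone (Suc 0)))"
      by (rule block_sum_times) (auto simp: finite_lcosets Q inj_on_cpos lcosets_translate subgroup.subset g)
    finally show ?thesis by (simp add: fkron_1_munit)
  qed
  then show ?thesis using s shapedD(1)[OF s] by (simp add: hom_on_def rho_trivial_module mdim_coset_module)
qed

text \<open>The augmentations of all summands combine to one map \<open>P\<close> from
  \<open>V \<otimes> W\<close> to \<open>W\<close>, the same for every \<open>a\<close>. The lifts
  \<open>q a\<close> of the individual traces may therefore be added, even when several of them use
  the same \<open>Q\<close>, and their sum splits \<open>P\<close>.\<close>

lemma module_projectiveI:
  fixes W :: "('a, 'k::field) kG_module"
  assumes Qs: "\<forall>Q\<in>set Qs. subgroup Q G" and W: "kmod W"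
    and z: "idm W = sum z A" "\<And>a. a \<in> A \<Longrightarrow> \<exists>Q\<in>set Qs. z a \<in> traces Q W W"
  shows "module_projective G (direct_sum (map (coset_module G) Qs)) W"
proof -
  let ?Cs = "map (coset_module G) Qs :: ('a, 'k) kG_module list"
  let ?V = "direct_sum ?Cs" and ?d = "mdim W"
  have Cs: "\<forall>N\<in>set ?Cs. kmod N" using Qs kmod_coset_module by auto
  have V: "kmod ?V" using kmod_direct_sum[OF Cs] .
  obtain i p where ip: "decomposes ?V ?Cs i p" using direct_sum_decomposes[OF Cs] by blast
  define u :: "'a set \<Rightarrow> 'k fmat" where "u = (\<lambda>Q. \<Sum>C\<in>lcosets Q. munit 0 (cpos Q C))"
  define U where "U = (\<Sum>j<length ?Cs. u (Qs ! j) * p j)"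
  have uh: "ghom (?Cs ! j) (trivial_module 1) (u (Qs ! j))" if "j < length ?Cs" for j
  proof -
    have "subgroup (Qs ! j) G" using Qs that by simp
    then show ?thesis using ghom_augmentation that unfolding u_def by fastforce
  qed
  have Uh: "ghom ?V (trivial_module 1) U" unfolding U_def
    using hom_on_comp[OF uh decomposesD(2)[OF ip]] by (intro hom_on_sum) auto
  have Ui: "U * i j = u (Qs ! j)" if j: "j < length ?Cs" for j
  proof -
    have "U * i j = (\<Sum>l<length ?Cs. if l = j then u (Qs ! j) * idm (?Cs ! j) else 0)"
      unfolding U_def sum_distrib_right
      by (rule sum.cong) (use j in \<open>auto simp: mult.assoc decomposesD(3)[OF ip]\<close>)
    also have "\<dots> = u (Qs ! j)" using j hom_on_id_right[OF uh[OF j]] by simp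
    finally show ?thesis .
  qed
  let ?T = "tensor_module ?V W"
  define P where "P = fkron ?d U (idm W)"
  have T: "kmod ?T" using kmod_tensor_module[OF V W] .
  have Ph: "ghom ?T W P"
  proof -
    have "ghom ?T (tensor_module (trivial_module 1) W) P"
      unfolding P_def using ghom_tensor[OF V kmod_trivial_module W Uh] by simp
    moreover have "rho (tensor_module (trivial_module 1) W) g = rho W g" if "g \<in> carrier G" for g
    proof -
      have "(fone 1 :: 'k fmat) = munit 0 0" by (simp add: fone_eq_sum)
      then show ?thesis
        using fkron_munit_0[OF rho_shaped[OF W that]] by (simp add: rho_tensor_module[OF W that] rho_trivial_module)
    qed
    ultimately show ?thesis by (simp add: hom_on_def)
  qed
  have "\<exists>q. ghom W ?T q \<and> P * q = z a" if a: "a \<in> A" for a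
  proof -
    obtain Q where "Q \<in> set Qs" "z a \<in> traces Q W W" using z(2)[OF a] by blast
    then obtain j where j: "j < length ?Cs" "z a \<in> traces (Qs ! j) W W" by (auto simp: in_set_conv_nth)
    have Q: "subgroup (Qs ! j) G" using Qs j(1) by simp
    have C: "kmod (?Cs ! j)" using bspec[OF Cs nth_mem[OF j(1)]] .
    obtain q where q: "ghom W (tensor_module (coset_module G (Qs ! j)) W) q" "fkron ?d (u (Qs ! j)) (idm W) * q = z a"
      using traces_factor_coset[OF W Q j(2)] unfolding u_def by blast
    have "ghom (tensor_module (?Cs ! j) W) ?T (fkron ?d (i j) (idm W))"
      using ghom_tensor[OF C V W decomposesD(1)[OF ip j(1)]] by simp
    then have "ghom W ?T (fkron ?d (i j) (idm W) * q)" using hom_on_comp q(1) j(1) by force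
    moreover have "P * (fkron ?d (i j) (idm W) * q) = z a"
      unfolding P_def mult.assoc[symmetric] using q(2) Ui[OF j(1)] by (simp add: fkron_times)
    ultimately show ?thesis by blast
  qed
  then obtain q where q: "\<And>a. a \<in> A \<Longrightarrow> ghom W ?T (q a) \<and> P * q a = z a" by metis
  have "ghom W ?T (sum q A)" using q by (intro hom_on_sum) auto
  moreover have "P * sum q A = idm W" unfolding z(1) sum_distrib_left using q by (intro sum.cong) auto
  ultimately have "direct_summand G W ?T" unfolding direct_summand_iff[OF W T] using Ph by blast
  then show ?thesis using W by (auto simp: module_projective_def)
qed

end

section \<open>The trace form on endomorphisms\<close>

text \<open>In \<open>End_module G M\<close> the basis vector with index \<open>a * mdim M + b\<close> is the matrix unit with entry
  \<open>(b, a)\<close>; a row vector is indexed by the transposed positions, so that pairing a row with a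
  column becomes the trace form.\<close>

lift_definition mvec :: "nat \<Rightarrow> 'k::comm_ring_1 fmat \<Rightarrow> 'k fmat"
  is "\<lambda>d f i j. if j = 0 \<and> i < d * d then f (i mod d) (i div d) else 0"
proof -
  fix d :: nat and f :: "nat \<Rightarrow> nat \<Rightarrow> 'k"
  show "\<exists>n. \<forall>i j. n \<le> i \<or> n \<le> j \<longrightarrow> (if j = 0 \<and> i < d * d then f (i mod d) (i div d) else 0) = 0"
    by (intro exI[of _ "max 1 (d * d)"]) auto
qed

lift_definition munvec :: "nat \<Rightarrow> 'k::comm_ring_1 fmat \<Rightarrow> 'k fmat"
  is "\<lambda>d y i j. if i < d \<and> j < d then y (j * d + i) 0 else 0"
proof -
  fix d :: nat and y :: "nat \<Rightarrow> nat \<Rightarrow> 'k"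
  show "\<exists>n. \<forall>i j. n \<le> i \<or> n \<le> j \<longrightarrow> (if i < d \<and> j < d then y (j * d + i) 0 else 0) = 0"
    by (intro exI[of _ d]) auto
qed

definition mrow :: "nat \<Rightarrow> 'k::comm_ring_1 fmat \<Rightarrow> 'k fmat" where
  "mrow d f = ftranspose (mvec d (ftranspose f))"

lemma entry_mvec: "entry (mvec d f) i j = (if j = 0 \<and> i < d * d then entry f (i mod d) (i div d) else 0)"
  by transfer simp

lemma entry_munvec: "entry (munvec d y) i j = (if i < d \<and> j < d then entry y (j * d + i) 0 else 0)"
  by transfer simp

lemma shaped_mvec: "shaped (d * d) (Suc 0) (mvec d f)"
  by (auto simp: shaped_iff entry_mvec)

lemma shaped_mrow: "shaped (Suc 0) (d * d) (mrow d f)"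
  unfolding mrow_def using shaped_mvec by (rule ftranspose_shaped)

lemma mvec_plus: "mvec d (f + g) = mvec d f + mvec d g"
  by (rule fmat_eqI) (auto simp: entry_mvec entry_plus)

lemma mvec_zero: "mvec d 0 = 0"
  by (rule fmat_eqI) (auto simp: entry_mvec entry_zero)

lemma mvec_sum: "mvec d (sum f A) = (\<Sum>a\<in>A. mvec d (f a))"
  by (induction A rule: infinite_finite_induct) (auto simp: mvec_plus mvec_zero)

lemma div_less_of_less_square: "i < d * d \<Longrightarrow> i div d < (d::nat)"
  by (simp add: less_mult_imp_div_less)

lemma munvec_mvec: "shaped d d f \<Longrightarrow> munvec d (mvec d f) = f"
proof (rule fmat_eqI)
  fix i j assume f: "shaped d d f"
  show "entry (munvec d (mvec d f)) i j = entry f i j"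
  proof (cases "i < d \<and> j < d")
    case True
    have "j * d + i < j * d + d" using True by simp
    also have "\<dots> = Suc j * d" by simp
    also have "\<dots> \<le> d * d" using True by (intro mult_le_mono1) simp
    finally have "j * d + i < d * d" .
    then show ?thesis using True by (simp add: entry_mvec entry_munvec)
  next
    case False
    then have "entry f i j = 0" using shaped_entry[OF f, of i j] by (simp add: not_less)
    then show ?thesis using False by (auto simp: entry_munvec)
  qed
qed

lemma mvec_munvec: "shaped (d * d) (Suc 0) y \<Longrightarrow> mvec d (munvec d y) = y"
proof (rule fmat_eqI)
  fix i j assume y: "shaped (d * d) (Suc 0) y"
  show "entry (mvec d (munvec d y)) i j = entry y i j"
  proof (cases "j = 0 \<and> i < d * d")
    case True
    then have "0 < d" by (cases d) auto
    then show ?thesis using True div_less_of_less_square[of i d] by (simp add: entry_mvec entry_munvec)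
  next
    case False
    then have "entry y i j = 0" using shaped_entry[OF y, of i j] by auto
    then show ?thesis using False by (auto simp: entry_mvec)
  qed
qed

lemma shaped_munvec: "shaped d d (munvec d y)"
  by (auto simp: shaped_iff entry_munvec)

lemma mrow_surj:
  assumes "shaped (Suc 0) (d * d) y"
  obtains f where "shaped d d f" "y = mrow d f"
proof (rule that[of "ftranspose (munvec d (ftranspose y))"])
  show "shaped d d (ftranspose (munvec d (ftranspose y)))" using shaped_munvec by (rule ftranspose_shaped)
  show "y = mrow d (ftranspose (munvec d (ftranspose y)))"
    using mvec_munvec[OF ftranspose_shaped[OF assms]] by (simp add: mrow_def)
qed

text \<open>Column stacking turns multiplication on both sides into a Kronecker product; the right
  factor appears transposed, which cancels the transpose in the dual module.\<close>

lemma fkron_mvec: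
  assumes A: "shaped d d A" and B: "shaped d d B" and f: "shaped d d f"
  shows "fkron d A B * mvec d f = mvec d (B * f * ftranspose A)"
proof (cases "d = 0")
  case True
  then have "f = 0" using f by (simp add: shaped_def)
  then show ?thesis by (simp add: mvec_zero)
next
  case False
  show ?thesis
  proof (rule fmat_eqI)
    fix i j
    have AB: "shaped (d * d) (d * d) (fkron d A B)" using fkron_shaped[OF A B] .
    have 1: "entry (fkron d A B * mvec d f) i j
      = (\<Sum>k<d*d. entry (fkron d A B) i k * entry (mvec d f) k j)"
      by (rule entry_times_left) (use shaped_entry[OF AB] in auto)
    show "entry (fkron d A B * mvec d f) i j = entry (mvec d (B * f * ftranspose A)) i j"
    proof (cases "j = 0 \<and> i < d * d")
      case True
      have "(\<Sum>k<d*d. entry (fkron d A B) i k * entry (mvec d f) k j)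
        = (\<Sum>k<d*d. entry A (i div d) (k div d) * entry B (i mod d) (k mod d) * entry f (k mod d) (k div d))"
        using True by (intro sum.cong) (auto simp: entry_fkron entry_mvec)
      also have "\<dots> = (\<Sum>a<d. \<Sum>b<d. entry A (i div d) a * entry B (i mod d) b * entry f b a)"
        using False by (subst sum_div_mod[symmetric]) auto
      also have "\<dots> = (\<Sum>a<d. (\<Sum>b<d. entry B (i mod d) b * entry f b a) * entry A (i div d) a)"
        by (simp add: sum_distrib_left mult_ac)
      also have "\<dots> = (\<Sum>a<d. entry (B * f) (i mod d) a * entry (ftranspose A) a (i div d))"
        by (simp add: entry_times_left[of d] shaped_entry[OF B] entry_ftranspose)
      also have "\<dots> = entry (B * f * ftranspose A) (i mod d) (i div d)"
        by (rule entry_times_left[symmetric]) (use shaped_entry[OF shaped_times[OF B f]] in auto)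
      finally show ?thesis using 1 True by (simp add: entry_mvec)
    next
      case F: False
      have z: "entry (fkron d A B) i k * entry (mvec d f) k j = 0" for k
        using F shaped_entry[OF AB, of i k] by (auto simp: entry_mvec)
      have "entry (mvec d (B * f * ftranspose A)) i j = 0" using F by (auto simp: entry_mvec)
      then show ?thesis unfolding 1 by (simp only: z sum.neutral_const)
    qed
  qed
qed

lemma ftranspose_fkron: "ftranspose (fkron d A B) = fkron d (ftranspose A) (ftranspose B)"
  by (rule fmat_eqI) (simp add: entry_ftranspose entry_fkron)

lemma mrow_fkron:
  assumes A: "shaped d d A" and B: "shaped d d B" and f: "shaped d d f"
  shows "mrow d f * fkron d A B = mrow d (ftranspose A * f * B)"
proof -
  have "mrow d f * fkron d A B
    = ftranspose (fkron d (ftranspose A) (ftranspose B) * mvec d (ftranspose f))"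
    by (simp add: mrow_def ftranspose_times ftranspose_fkron)
  also have "\<dots> = mrow d (ftranspose A * f * B)"
    using fkron_mvec[OF ftranspose_shaped[OF A] ftranspose_shaped[OF B] ftranspose_shaped[OF f]]
    by (simp add: mrow_def ftranspose_times mult.assoc)
  finally show ?thesis .
qed

text \<open>The transposed indexing of \<open>mrow\<close> makes the sum over positions the double
  sum of \<open>h a b * f b a\<close>.\<close>

lemma ftrace_mrow_mvec:
  assumes f: "shaped d d f" and h: "shaped d d h"
  shows "ftrace (mrow d h * mvec d f) = ftrace (h * f)"
proof (cases "d = 0")
  case True
  then have "f = 0" using f by (simp add: shaped_def)
  then show ?thesis by (simp add: mvec_zero)
next
  case False
  have "ftrace (mrow d h * mvec d f) = entry (mrow d h * mvec d f) 0 0"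
    using ftrace_shaped[OF shaped_times[OF shaped_mrow shaped_mvec], of d h d f] by simp
  also have "\<dots> = (\<Sum>k<d*d. entry (mrow d h) 0 k * entry (mvec d f) k 0)"
    by (rule entry_times_left) (simp add: shaped_entry[OF shaped_mrow])
  also have "\<dots> = (\<Sum>k<d*d. entry h (k div d) (k mod d) * entry f (k mod d) (k div d))"
    by (rule sum.cong) (auto simp: mrow_def entry_ftranspose entry_mvec)
  also have "\<dots> = (\<Sum>a<d. \<Sum>b<d. entry h a b * entry f b a)"
    using False by (subst sum_div_mod[symmetric]) auto
  also have "\<dots> = (\<Sum>a<d. entry (h * f) a a)"
    by (simp add: entry_times_left[of d] shaped_entry[OF h])
  also have "\<dots> = ftrace (h * f)" using ftrace_shaped[OF shaped_times[OF h f]] by simp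
  finally show ?thesis .
qed

lemma mrow_mvec_eq:
  assumes "shaped d d f" "shaped d d h"
  shows "mrow d h * mvec d f = diagc (Suc 0) (ftrace (h * f))"
  using shaped_1_eq[OF shaped_times[OF shaped_mrow shaped_mvec]] ftrace_mrow_mvec[OF assms] by metis

context finite_group
begin

section \<open>Homomorphisms between the trivial module and End(M)\<close>

abbreviation triv :: "('a, 'k::field) kG_module" where
  "triv \<equiv> trivial_module (Suc 0)"

lemma kmod_dual_module:
  fixes M :: "('a, 'k::field) kG_module"
  assumes M: "kmod M"
  shows "kmod (dual_module G M)"
    and "rho (dual_module G M) g = ftranspose (rho M (inv g))"
proof -
  let ?D = "dual_module G M"
  have d: "mdim ?D = mdim M" by (simp add: dual_module_def)
  show r: "rho ?D g = ftranspose (rho M (inv g))" for g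
    by (simp add: rho_def dual_module_def of_mat_transpose)
  show "kmod ?D"
  proof (rule kmodI)
    fix g h assume g: "g \<in> carrier G"
    show "act ?D g \<in> carrier_mat (mdim ?D) (mdim ?D)"
      using M g by (auto simp: dual_module_def is_kG_module_def)
    assume h: "h \<in> carrier G"
    show "rho ?D (g \<otimes> h) = rho ?D g * rho ?D h"
      using g h by (simp add: r inv_mult_group rho_mult[OF M] ftranspose_times)
  qed (simp add: r d rho_one[OF M])
qed

lemma mdim_End_module: "mdim (End_module G M) = mdim M * mdim M"
  by (simp add: End_module_def dual_module_def)

lemma kmod_End_module: "kmod M \<Longrightarrow> kmod (End_module G M)"
  unfolding End_module_def by (intro kmod_tensor_module kmod_dual_module)

lemma rho_End_module:
  "kmod M \<Longrightarrow> g \<in> carrier G \<Longrightarrow> rho (End_module G M) g = fkron (mdim M) (ftranspose (rho M (inv g))) (rho M g)"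
  unfolding End_module_def by (simp add: rho_tensor_module kmod_dual_module(2))

lemma rho_End_mvec:
  assumes M: "kmod M" and g: "g \<in> carrier G" and f: "lin M M f"
  shows "rho (End_module G M) g * mvec (mdim M) f = mvec (mdim M) (conja M M g f)"
  using fkron_mvec[OF ftranspose_shaped[OF rho_shaped[OF M inv_closed[OF g]]] rho_shaped[OF M g] f]
  by (simp add: rho_End_module[OF M g] conja_def)

lemma mvec_triv: "mvec d f * rho triv g = mvec d f"
  using shapedD(2)[OF shaped_mvec] by (simp add: rho_trivial_module)

text \<open>Homomorphisms from the trivial module are fixed points, and the points of
  \<open>End(M)\<close> fixed by \<open>H\<close> are the \<open>kH\<close>-endomorphisms.\<close>

lemma hom_on_mvec_iff:
  assumes M: "kmod M" and H: "H \<subseteq> carrier G" and f: "lin M M f"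
  shows "hom_on H triv (End_module G M) (mvec (mdim M) f) \<longleftrightarrow> hom_on H M M f"
proof -
  have "mvec (mdim M) (conja M M h f) = mvec (mdim M) f \<longleftrightarrow> conja M M h f = f" if "h \<in> H" for h
  proof -
    have h: "h \<in> carrier G" using that H by blast
    show ?thesis using munvec_mvec[OF conja_lin[OF M M h f]] munvec_mvec[OF f] by metis
  qed
  moreover have "rho (End_module G M) h * mvec (mdim M) f = mvec (mdim M) (conja M M h f)" if "h \<in> H" for h
    using rho_End_mvec[OF M _ f] that H by blast
  moreover have "lin triv (End_module G M) (mvec (mdim M) f)"
    using shaped_mvec by (simp add: mdim_End_module)
  ultimately show ?thesis
    unfolding hom_on_iff_conja[OF M M H] using f by (simp add: hom_on_def mvec_triv)
qed

lemma ghom_from_triv: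
  assumes M: "kmod M" and y: "hom_on H triv (End_module G M) y" and H: "H \<subseteq> carrier G"
  obtains f where "hom_on H M M f" "y = mvec (mdim M) f"
proof -
  have s: "shaped (mdim M * mdim M) (Suc 0) y" using hom_onD(1)[OF y] by (simp add: mdim_End_module)
  have "hom_on H M M (munvec (mdim M) y)"
    unfolding hom_on_mvec_iff[OF M H shaped_munvec, symmetric] mvec_munvec[OF s] using y .
  then show thesis using that[of "munvec (mdim M) y"] mvec_munvec[OF s] by simp
qed

text \<open>The row of \<open>h\<close> is the functional \<open>f \<mapsto> tr (h f)\<close>,
  invariant because \<open>h\<close> is fixed by conjugation. With the converse
  \<open>ghom_to_triv\<close>, both arguments of the form range over endomorphisms of
  \<open>M\<close>.\<close>

lemma ghom_mrow:
  assumes M: "kmod M" and h: "ghom M M h"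
  shows "ghom (End_module G M) triv (mrow (mdim M) h)"
  unfolding hom_on_def
proof (intro conjI ballI)
  show "lin (End_module G M) triv (mrow (mdim M) h)" using shaped_mrow by (simp add: mdim_End_module)
  fix g assume g: "g \<in> carrier G"
  have "rho M (inv g) * h * rho M g = h"
    using conja_ghom[OF M M h inv_closed[OF g]] g by (simp add: conja_def)
  then show "rho triv g * mrow (mdim M) h = mrow (mdim M) h * rho (End_module G M) g"
    using mrow_fkron[OF ftranspose_shaped[OF rho_shaped[OF M inv_closed[OF g]]] rho_shaped[OF M g] hom_onD(1)[OF h]]
      shapedD(1)[OF shaped_mrow]
    by (simp add: rho_End_module[OF M g] rho_trivial_module)
qed

lemma ghom_to_triv:
  assumes M: "kmod M" and y: "ghom (End_module G M) triv y"
  obtains h where "ghom M M h" "y = mrow (mdim M) h"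
proof -
  let ?d = "mdim M"
  have s: "shaped (Suc 0) (?d * ?d) y" using hom_onD(1)[OF y] by (simp add: mdim_End_module)
  obtain h where h: "shaped ?d ?d h" "y = mrow ?d h" using mrow_surj[OF s] .
  have "conja M M g h = h" if g: "g \<in> carrier G" for g
  proof -
    have "mrow ?d h = rho triv (inv g) * mrow ?d h"
      by (simp add: rho_trivial_module shapedD(1)[OF shaped_mrow])
    also have "\<dots> = mrow ?d h * rho (End_module G M) (inv g)"
      using hom_onD(2)[OF y inv_closed[OF g]] unfolding h(2) .
    also have "\<dots> = mrow ?d (conja M M g h)"
      using mrow_fkron[OF ftranspose_shaped[OF rho_shaped[OF M g]] rho_shaped[OF M inv_closed[OF g]] h(1)] g
      by (simp add: rho_End_module[OF M inv_closed[OF g]] conja_def)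
    finally have "ftranspose (mrow ?d h) = ftranspose (mrow ?d (conja M M g h))" by simp
    then have "munvec ?d (mvec ?d (ftranspose h)) = munvec ?d (mvec ?d (ftranspose (conja M M g h)))"
      by (simp add: mrow_def)
    then have "ftranspose h = ftranspose (conja M M g h)"
      using munvec_mvec[OF ftranspose_shaped[OF h(1)]] munvec_mvec[OF ftranspose_shaped[OF conja_lin[OF M M g h(1)]]]
      by simp
    then show ?thesis by (metis ftranspose_twice)
  qed
  then have "ghom M M h" unfolding hom_on_iff_conja[OF M M subset_refl] using h by blast
  then show thesis using that h by blast
qed

text \<open>Column stacking commutes with conjugation, hence with relative traces.\<close>

lemma tideal_mvec:
  assumes M: "kmod M" and F: "\<forall>Q\<in>F. subgroup Q G" and w: "w \<in> tideal F triv (End_module G M)"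
  shows "\<exists>x\<in>tideal F M M. w = mvec (mdim M) x"
proof -
  let ?E = "End_module G M"
  obtain z where z: "w = sum z F" "\<forall>Q\<in>F. z Q \<in> traces Q triv ?E" using w by (auto simp: tideal_def)
  have "\<exists>x\<in>traces Q M M. z Q = mvec (mdim M) x" if Q: "Q \<in> F" for Q
  proof -
    have sQ: "subgroup Q G" using F Q by blast
    obtain t where t: "z Q = rtrace Q triv ?E t" "hom_on Q triv ?E t" using z(2) Q by (auto simp: traces_def)
    obtain f where f: "hom_on Q M M f" "t = mvec (mdim M) f"
      using ghom_from_triv[OF M t(2) subgroup.subset[OF sQ]] .
    have "z Q = mvec (mdim M) (rtrace Q M M f)"
      unfolding t(1) rtrace_def mvec_sum f(2)
    proof (rule sum.cong)
      fix C assume C: "C \<in> lcosets Q"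
      have c: "coset_rep C \<in> carrier G" using coset_rep_closed[OF sQ C] .
      show "conja triv ?E (coset_rep C) (mvec (mdim M) f) = mvec (mdim M) (conja M M (coset_rep C) f)"
        unfolding conja_def[of triv] rho_End_mvec[OF M c hom_onD(1)[OF f(1)]] mvec_triv ..
    qed simp
    then show ?thesis using f(1) by (auto simp: traces_def)
  qed
  then obtain x where x: "\<And>Q. Q \<in> F \<Longrightarrow> x Q \<in> traces Q M M \<and> z Q = mvec (mdim M) (x Q)" by metis
  have "w = mvec (mdim M) (sum x F)" unfolding z(1) mvec_sum using x by (intro sum.cong) auto
  moreover have "sum x F \<in> tideal F M M" unfolding tideal_def using x by blast
  ultimately show ?thesis by blast
qed

text \<open>Elements of the trace ideal are invisible to the pairing of invariants with coinvariants,
  so the rank of the trace form on \<open>End\<^bsub>kG\<^esub>(M)\<close> is the multiplicity \<open>n\<close> of the trivial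
  module.\<close>

definition End_split :: "'a set set \<Rightarrow> ('a, 'k::field) kG_module \<Rightarrow> nat \<Rightarrow> (nat \<Rightarrow> 'k fmat) \<Rightarrow> (nat \<Rightarrow> 'k fmat) \<Rightarrow> 'k fmat \<Rightarrow> bool" where
  "End_split F M n y \<phi> t \<longleftrightarrow>
     (\<forall>l<n. ghom triv (End_module G M) (y l) \<and> ghom (End_module G M) triv (\<phi> l)) \<and>
     (\<forall>l<n. \<forall>m<n. \<phi> l * y m = (if l = m then fone (Suc 0) else 0)) \<and>
     t \<in> tideal F (End_module G M) (End_module G M) \<and>
     idm (End_module G M) = (\<Sum>l<n. y l * \<phi> l) + t"

text \<open>\<open>y l\<close> and \<open>\<phi> l\<close> are the coordinate inclusions and
  projections of the trivial summand, and \<open>t\<close> is the idempotent of \<open>W\<close>,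
  which lies in the trace ideal because \<open>idm W\<close> does.\<close>

lemma End_split_exists:
  fixes M :: "('a, 'k::field) kG_module"
  assumes M: "kmod M" and W: "kmod W" and F: "\<forall>Q\<in>F. subgroup Q G" and WF: "idm W \<in> tideal F W W"
    and iso: "kG_iso G (End_module G M) (direct_sum [trivial_module n, W])"
  shows "\<exists>y \<phi> t. End_split F M n y \<phi> t"
proof -
  let ?E = "End_module G M" and ?T = "trivial_module n :: ('a, 'k) kG_module"
  have E: "kmod ?E" using kmod_End_module[OF M] .
  obtain i p where ip: "decomposes ?E [?T, W] i p"
    using iso kG_iso_direct_sum_iff[OF E, of "[?T, W]"] W kmod_trivial_module by auto
  have h: "ghom ?T ?E (i 0)" "ghom ?E ?T (p 0)" "p 0 * i 0 = fone n" "ghom W ?E (i 1)" "ghom ?E W (p 1)"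
    "i 1 * idm W = i 1" "idm ?E = i 0 * p 0 + i 1 * p 1" "i 0 * fone n = i 0" "fone n * p 0 = p 0"
    using decomposesD[OF ip, of 0] decomposesD[OF ip, of 1] decomposes_sum[OF ip] by simp_all
  define y where "y = (\<lambda>l. i 0 * munit l 0)"
  define \<phi> where "\<phi> = (\<lambda>l. munit 0 l * p 0)"
  have u: "ghom triv ?T (munit l 0)" "ghom ?T triv (munit 0 l)" if "l < n" for l
  proof -
    have a: "shaped n (Suc 0) (munit l 0 :: 'k fmat)" "shaped (Suc 0) n (munit 0 l :: 'k fmat)"
      using that by (auto intro: shaped_munit)
    show "ghom triv ?T (munit l 0)" "ghom ?T triv (munit 0 l)"
      using a shapedD[OF a(1)] shapedD[OF a(2)] by (simp_all add: hom_on_def rho_trivial_module)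
  qed
  have f1: "(fone (Suc 0) :: 'k fmat) = munit 0 0" by (simp add: fone_eq_sum)
  have "\<phi> l * y m = (if l = m then fone (Suc 0) else 0)" if "l < n" "m < n" for l m
  proof -
    have "\<phi> l * y m = munit 0 l * (p 0 * i 0) * munit m 0" by (simp add: \<phi>_def y_def mult.assoc)
    also have "\<dots> = munit 0 l * munit m 0"
      unfolding h(3) using hom_on_id_right[OF u(2)[OF that(1)]] by simp
    finally show ?thesis by (simp add: munit_times f1)
  qed
  moreover have "i 1 * p 1 \<in> tideal F ?E ?E"
    using tideal_comp_right[OF E W E F tideal_comp_left[OF W W E F WF h(4)] h(5)] h(6) by simp
  moreover have "i 0 * p 0 = (\<Sum>l<n. y l * \<phi> l)"
  proof -
    have "(\<Sum>l<n. y l * \<phi> l) = i 0 * (\<Sum>l<n. munit l 0 * munit 0 l) * p 0"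
      by (simp add: y_def \<phi>_def sum_distrib_left sum_distrib_right mult.assoc)
    also have "(\<Sum>l<n. munit l 0 * munit 0 l) = (fone n :: 'k fmat)" by (simp add: munit_times fone_eq_sum)
    finally show ?thesis using h by simp
  qed
  moreover have "ghom triv ?E (y l)" "ghom ?E triv (\<phi> l)" if "l < n" for l
    unfolding y_def \<phi>_def using hom_on_comp[OF h(1) u(1)[OF that]] hom_on_comp[OF u(2)[OF that] h(2)] .
  ultimately have "End_split F M n y \<phi> (i 1 * p 1)" unfolding End_split_def using h(7) by auto
  then show ?thesis by blast
qed

section \<open>Rank and corners of the trace form\<close>

context
  fixes F :: "'a set set" and M :: "('a, 'k::field) kG_module" and n y \<phi> t
  assumes M: "kmod M" and F: "\<forall>Q\<in>F. subgroup Q G"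
    and index: "\<And>Q. Q \<in> F \<Longrightarrow> of_nat (card (lcosets Q)) = (0 :: 'k)"
    and split: "End_split F M n y \<phi> t"
begin

private abbreviation "E \<equiv> End_module G M"

private lemma E: "kmod E" using kmod_End_module[OF M] .

private lemma y: "l < n \<Longrightarrow> ghom triv E (y l)" and phi: "l < n \<Longrightarrow> ghom E triv (\<phi> l)"
  and phi_y: "l < n \<Longrightarrow> m < n \<Longrightarrow> \<phi> l * y m = (if l = m then fone (Suc 0) else 0)"
  and t: "t \<in> tideal F E E" and idE: "idm E = (\<Sum>l<n. y l * \<phi> l) + t"
  using split by (auto simp: End_split_def)

text \<open>The composite is an endomorphism of the trivial module inside the trace ideal, so its
  trace vanishes; a 1 by 1 matrix is determined by its trace.\<close>

private lemma pair_t: "ghom E triv a \<Longrightarrow> ghom triv E b \<Longrightarrow> a * t * b = 0"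
proof -
  assume a: "ghom E triv a" and b: "ghom triv E b"
  have "a * t * b \<in> tideal F triv triv"
    using tideal_comp_right[OF kmod_trivial_module E kmod_trivial_module F tideal_comp_left[OF E E kmod_trivial_module F t a] b] .
  then have "ftrace (a * t * b) = 0"
    using ftrace_tideal[OF kmod_trivial_module _ index] F by blast
  moreover have "shaped (Suc 0) (Suc 0) (a * t * b)"
    using hom_onD(1)[OF a] hom_onD(1)[OF b] shaped_times[OF shaped_times] tideal_ghom[OF E E F t] hom_onD(1)
    by (metis mdim_trivial_module)
  ultimately show ?thesis using shaped_1_eq by fastforce
qed

private lemma pair: "ghom E triv a \<Longrightarrow> ghom triv E b \<Longrightarrow> a * b = (\<Sum>l<n. a * y l * (\<phi> l * b))"
proof -
  assume a: "ghom E triv a" and b: "ghom triv E b"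
  have "a * b = a * idm E * b" using hom_on_id_right[OF a] by simp
  also have "\<dots> = (\<Sum>l<n. a * y l * (\<phi> l * b)) + a * t * b"
    unfolding idE by (simp add: distrib_left distrib_right sum_distrib_left sum_distrib_right mult.assoc)
  finally show ?thesis using pair_t[OF a b] by simp
qed

lemma trace_form_nonzero:
  assumes "0 < n"
  shows "\<exists>f h. ghom M M f \<and> ghom M M h \<and> ftrace (h * f) \<noteq> 0"
proof -
  obtain f where f: "ghom M M f" "y 0 = mvec (mdim M) f" using ghom_from_triv[OF M y[OF assms]] by blast
  obtain h where h: "ghom M M h" "\<phi> 0 = mrow (mdim M) h" using ghom_to_triv[OF M phi[OF assms]] .
  have "ftrace (h * f) = ftrace (\<phi> 0 * y 0)" unfolding f h
    using ftrace_mrow_mvec[OF hom_onD(1)[OF f(1)] hom_onD(1)[OF h(1)]] by simp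
  also have "\<dots> = 1" using phi_y[OF assms assms] by simp
  finally show ?thesis using f(1) h(1) by (intro exI[of _ f] exI[of _ h]) simp
qed

lemma trace_form_zero:
  assumes "n = 0" "ghom M M f" "ghom M M h"
  shows "ftrace (h * f) = 0"
proof -
  have b: "ghom triv E (mvec (mdim M) f)"
    using hom_on_mvec_iff[OF M subset_refl hom_onD(1)[OF assms(2)]] assms(2) by simp
  have "mrow (mdim M) h * mvec (mdim M) f = 0"
    using pair[OF ghom_mrow[OF M assms(3)] b] assms(1) by simp
  then show ?thesis
    using ftrace_mrow_mvec[OF hom_onD(1)[OF assms(2)] hom_onD(1)[OF assms(3)]] by simp
qed

text \<open>The form is a functional of \<open>h\<close> times a functional of \<open>f\<close>, so
  its 2 by 2 minors vanish.\<close>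

lemma trace_form_rank_one:
  assumes n: "n = 1" and f: "ghom M M f" "ghom M M f'" and h: "ghom M M h" "ghom M M h'"
  shows "ftrace (h * f) * ftrace (h' * f') = ftrace (h * f') * ftrace (h' * f)"
proof -
  have *: "ftrace (h * f) = ftrace (mrow (mdim M) h * y 0) * ftrace (\<phi> 0 * mvec (mdim M) f)"
    if h: "ghom M M h" and f: "ghom M M f" for h f
  proof -
    have a: "ghom E triv (mrow (mdim M) h)" using ghom_mrow[OF M h] .
    have b: "ghom triv E (mvec (mdim M) f)"
      using hom_on_mvec_iff[OF M subset_refl hom_onD(1)[OF f]] f by simp
    have s: "shaped (Suc 0) (Suc 0) (mrow (mdim M) h * y 0)" "shaped (Suc 0) (Suc 0) (\<phi> 0 * mvec (mdim M) f)"
      using hom_onD(1)[OF hom_on_comp[OF a y]] hom_onD(1)[OF hom_on_comp[OF phi b]] n by simp_all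
    have "ftrace (h * f) = ftrace (mrow (mdim M) h * mvec (mdim M) f)"
      using ftrace_mrow_mvec[OF hom_onD(1)[OF f] hom_onD(1)[OF h]] by simp
    also have "\<dots> = ftrace (mrow (mdim M) h * y 0 * (\<phi> 0 * mvec (mdim M) f))"
      using pair[OF a b] n by simp
    also have "\<dots> = ftrace (diagc (Suc 0) (ftrace (mrow (mdim M) h * y 0)) * diagc (Suc 0) (ftrace (\<phi> 0 * mvec (mdim M) f)))"
      using shaped_1_eq[OF s(1)] shaped_1_eq[OF s(2)] by simp
    finally show ?thesis by (simp add: diagc_times)
  qed
  show ?thesis using *[OF h(1) f(1)] *[OF h(2) f(2)] *[OF h(1) f(2)] *[OF h(2) f(1)] by simp
qed

text \<open>The dual families \<open>\<phi>\<close> and \<open>y\<close>, translated into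
  endomorphisms, contain a minor that is the identity matrix.\<close>

lemma trace_form_rank_ge_two:
  assumes n: "2 \<le> n"
  shows "\<exists>f f' h h'. ghom M M f \<and> ghom M M f' \<and> ghom M M h \<and> ghom M M h' \<and>
    ftrace (h * f) * ftrace (h' * f') \<noteq> ftrace (h * f') * ftrace (h' * f)"
proof -
  have l: "0 < n" "1 < n" using n by auto
  obtain f where f: "ghom M M f" "y 0 = mvec (mdim M) f" using ghom_from_triv[OF M y[OF l(1)]] by blast
  obtain f' where f': "ghom M M f'" "y 1 = mvec (mdim M) f'" using ghom_from_triv[OF M y[OF l(2)]] by blast
  obtain h where h: "ghom M M h" "\<phi> 0 = mrow (mdim M) h" using ghom_to_triv[OF M phi[OF l(1)]] .
  obtain h' where h': "ghom M M h'" "\<phi> 1 = mrow (mdim M) h'" using ghom_to_triv[OF M phi[OF l(2)]] .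
  note s = hom_onD(1)[OF f(1)] hom_onD(1)[OF f'(1)] hom_onD(1)[OF h(1)] hom_onD(1)[OF h'(1)]
  have "ftrace (h * f) = 1" "ftrace (h' * f') = 1" "ftrace (h * f') = 0" "ftrace (h' * f) = 0"
    using ftrace_mrow_mvec[OF s(1,3)] ftrace_mrow_mvec[OF s(2,4)] ftrace_mrow_mvec[OF s(2,3)] ftrace_mrow_mvec[OF s(1,4)]
      phi_y[OF l(1,1)] phi_y[OF l(2,2)] phi_y[OF l(1,2)] phi_y[OF l(2,1)]
    unfolding f(2) f'(2) h(2) h'(2) by simp_all
  then show ?thesis using f f' h h' by (intro exI[of _ f] exI[of _ f'] exI[of _ h] exI[of _ h']) simp
qed

text \<open>The operator \<open>x \<mapsto> e * x * e'\<close> on \<open>End\<^sub>k(M)\<close>.  Modulo the trace ideal it equals the component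
  \<open>u\<close> that factors through the trivial summand, and \<open>u * u = 0\<close> when the trace form vanishes on
  its image.\<close>

lemma corner_operator_tideal:
  assumes e: "ghom M M e" "e * e = e" and e': "ghom M M e'" "e' * e' = e'"
    and zero: "\<And>f h. ghom M M f \<Longrightarrow> ghom M M h \<Longrightarrow> ftrace (h * (e * f * e')) = 0"
  shows "fkron (mdim M) (ftranspose e') e \<in> tideal F E E"
proof -
  let ?d = "mdim M"
  define x where "x = fkron ?d (ftranspose e') e"
  have se: "shaped ?d ?d e" "shaped ?d ?d (ftranspose e')"
    using hom_onD(1)[OF e(1)] ftranspose_shaped[OF hom_onD(1)[OF e'(1)]] by auto
  have xx: "x * x = x"
    unfolding x_def using fkron_times[OF se(1) se(1)] e(2) e'(2) by (simp add: ftranspose_times[symmetric])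
  have x: "ghom E E x"
    unfolding hom_on_def
  proof (intro conjI ballI)
    show "lin E E x" unfolding x_def mdim_End_module using fkron_shaped[OF se(2,1)] .
    fix g assume g: "g \<in> carrier G"
    show "rho E g * x = x * rho E g"
      unfolding x_def rho_End_module[OF M g] fkron_times[OF rho_shaped[OF M g] se(1)] fkron_times[OF se(1) rho_shaped[OF M g]]
      using hom_onD(2)[OF e(1) g] hom_onD(2)[OF e'(1) inv_closed[OF g]] by (simp add: ftranspose_times[symmetric])
  qed
  \<comment> \<open>The hypothesis says that the trace form vanishes on the image of the operator;
    hence \<open>x\<close> has no component from the trivial summand to itself.\<close>
  have pz: "\<phi> l * x * y m = 0" if lm: "l < n" "m < n" for l m
  proof -
    obtain f where f: "ghom M M f" "y m = mvec ?d f" using ghom_from_triv[OF M y[OF lm(2)]] by blast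
    obtain h where h: "ghom M M h" "\<phi> l = mrow ?d h" using ghom_to_triv[OF M phi[OF lm(1)]] .
    have "x * y m = mvec ?d (e * f * e')"
      unfolding f x_def using fkron_mvec[OF se(2,1) hom_onD(1)[OF f(1)]] by simp
    then have "\<phi> l * x * y m = diagc (Suc 0) (ftrace (h * (e * f * e')))"
      using mrow_mvec_eq[OF hom_onD(1)[OF hom_on_comp[OF hom_on_comp[OF e(1) f(1)] e'(1)]] hom_onD(1)[OF h(1)]]
      by (simp add: h mult.assoc)
    then show ?thesis using zero[OF f(1) h(1)] by simp
  qed
  define u where "u = (\<Sum>l<n. x * y l * (\<phi> l * x))"
  define s where "s = x * t * x"
  have "x * idm E * x = x" using hom_on_id_right[OF x] xx by simp
  then have xus: "x = u + s"
    unfolding idE u_def s_def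
    by (simp add: distrib_left distrib_right sum_distrib_left sum_distrib_right mult.assoc)
  have "x * y l * (\<phi> l * x) * (x * y m * (\<phi> m * x)) = 0" if "l < n" "m < n" for l m
  proof -
    have "x * y l * (\<phi> l * x) * (x * y m * (\<phi> m * x)) = x * y l * (\<phi> l * (x * x) * y m) * (\<phi> m * x)"
      by (simp only: mult.assoc)
    then show ?thesis by (simp add: xx pz[OF that])
  qed
  then have uu: "u * u = 0" unfolding u_def sum_product by (intro sum.neutral ballI) auto
  have s: "s \<in> tideal F E E" unfolding s_def
    using tideal_comp_right[OF E E E F tideal_comp_left[OF E E E F t x] x] .
  have sh: "ghom E E s" using tideal_ghom[OF E E F s] .
  have uh: "ghom E E u" using hom_on_minus[OF x sh] xus by simp
  \<comment> \<open>Expands \<open>x * x = x\<close> with \<open>x = u + s\<close>; once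
    \<open>u * u\<close> is gone, both remaining terms contain \<open>s\<close>.\<close>
  have "x = u * u + (u * s + s * x)" using xx xus by (simp add: algebra_simps)
  then have "x = u * s + s * x" by (simp add: uu)
  moreover have "u * s + s * x \<in> tideal F E E"
    using tideal_plus[OF tideal_comp_left[OF E E E F s uh] tideal_comp_right[OF E E E F s x]] .
  ultimately show ?thesis unfolding x_def by metis
qed

text \<open>The operator fixes \<open>e\<close>, since \<open>e * e * e = e\<close>; so
  \<open>e\<close>, seen as an invariant of \<open>End(M)\<close>, is its own image under a map in
  the trace ideal.\<close>

lemma corner_idempotent_tideal:
  assumes e: "ghom M M e" "e * e = e"
    and zero: "\<And>f h. ghom M M f \<Longrightarrow> ghom M M h \<Longrightarrow> ftrace (h * (e * f * e)) = 0"
  shows "e \<in> tideal F M M"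
proof -
  let ?d = "mdim M"
  have se: "shaped ?d ?d e" "shaped ?d ?d (ftranspose e)"
    using hom_onD(1)[OF e(1)] ftranspose_shaped[OF hom_onD(1)[OF e(1)]] by auto
  have eh: "ghom triv E (mvec ?d e)" using hom_on_mvec_iff[OF M subset_refl se(1)] e(1) by simp
  have "fkron ?d (ftranspose e) e * mvec ?d e = mvec ?d e"
    using fkron_mvec[OF se(2,1,1)] e(2) by simp
  then have "mvec ?d e \<in> tideal F triv E"
    using tideal_comp_right[OF kmod_trivial_module E E F corner_operator_tideal[OF e e zero] eh] by simp
  then obtain x where x: "x \<in> tideal F M M" "mvec ?d e = mvec ?d x" using tideal_mvec[OF M F] by blast
  then have "e = x"
    using munvec_mvec[OF se(1)] munvec_mvec[OF hom_onD(1)[OF tideal_ghom[OF M M F x(1)]]] by metis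
  then show ?thesis using x by simp
qed

text \<open>The left side is the trace of the operator on \<open>End(M)\<close>, and traces vanish
  on the trace ideal. For projections onto summands it is the product of their dimensions in
  \<open>k\<close>.\<close>

lemma corner_trace_zero:
  assumes e: "ghom M M e" "e * e = e" and e': "ghom M M e'" "e' * e' = e'"
    and zero: "\<And>f h. ghom M M f \<Longrightarrow> ghom M M h \<Longrightarrow> ftrace (h * (e * f * e')) = 0"
  shows "ftrace e' * ftrace e = 0"
proof -
  have "ftrace (fkron (mdim M) (ftranspose e') e) = 0"
    using ftrace_tideal[OF E _ index corner_operator_tideal[OF e e' zero]] F by blast
  then show ?thesis
    using ftrace_fkron[OF ftranspose_shaped[OF hom_onD(1)[OF e'(1)]] hom_onD(1)[OF e(1)]] by simp
qed

end

end

section \<open>Strongly capped modules\<close>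

context finite_group
begin

lemma kG_iso_refl: "kmod M \<Longrightarrow> kG_iso G M M"
  unfolding kG_iso_iff[of M M] using ghom_id fone_idem by blast

lemma kG_iso_mdim: "kG_iso G M N \<Longrightarrow> mdim M = mdim N"
  by (simp add: kG_iso_def)

lemma indecomposable_kmod: "indecomposable_module G N \<Longrightarrow> kmod N"
  by (simp add: indecomposable_module_def)

text \<open>Benson--Carlson: if the trace form pairs the two Hom spaces nontrivially, then some
  composite is not nilpotent, hence invertible.\<close>

lemma kG_iso_of_trace:
  fixes N N' :: "('a, 'k::field) kG_module"
  assumes N: "indecomposable_module G N" and N': "indecomposable_module G N'"
    and a: "ghom N' N a" and b: "ghom N N' b" and tr: "ftrace (a * b) \<noteq> 0"
  shows "kG_iso G N N'"
proof -
  note M = indecomposable_kmod[OF N] and M' = indecomposable_kmod[OF N']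
  have ab: "ghom N N (a * b)" using hom_on_comp[OF a b] .
  have "\<not> fnil (a * b)" using fnil_ftrace[OF hom_onD(1)[OF ab]] tr by blast
  then have "funit (mdim N) (a * b)" using indecomposable_local[OF N ab] by blast
  then obtain y where y: "shaped (mdim N) (mdim N) y" "a * b * y = idm N" "y * (a * b) = idm N"
    unfolding funit_def by blast
  have yh: "ghom N N y" using unit_inverse_ghom[OF ab M y] .
  \<comment> \<open>A nonzero idempotent of \<open>N'\<close> that factors through \<open>N\<close>;
    indecomposability makes it the identity, so \<open>b * y\<close> is a two-sided inverse of
    \<open>a\<close>.\<close>
  define e where "e = b * y * a"
  have e: "ghom N' N' e" unfolding e_def using hom_on_comp[OF hom_on_comp[OF b yh] a] .
  have "e * e = b * y * (a * b * y) * a" by (simp only: e_def mult.assoc)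
  also have "\<dots> = b * y * (idm N * a)" unfolding y(2) by (simp only: mult.assoc)
  also have "\<dots> = e" unfolding hom_on_id_left[OF a] e_def ..
  finally have ee: "e * e = e" .
  have "e \<noteq> 0"
  proof
    assume "e = 0"
    then have "a * e * b = 0" by simp
    moreover have "a * e * b = a * b * y * (a * b)" by (simp only: e_def mult.assoc)
    ultimately have "a * b = 0" unfolding y(2) hom_on_id_left[OF ab] by simp
    then show False using tr by simp
  qed
  then have e1: "e = idm N'" using indecomposable_idempotent[OF N' e ee] by blast
  have "a * (b * y) = idm N" using y by (simp add: mult.assoc)
  moreover have "b * y * a = idm N'" using e1 by (simp add: e_def)
  ultimately show ?thesis unfolding kG_iso_iff[OF M M'] using hom_on_comp[OF b yh] a by blast
qed

text \<open>Taking \<open>h = f\<close> in the trace identity makes the square of the trace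
  zero.\<close>

lemma ftrace_zero_of_dim:
  fixes N :: "('a, 'k::alg_closed_field) kG_module"
  assumes "indecomposable_module G N" "of_nat (mdim N) = (0 :: 'k)" "ghom N N f"
  shows "ftrace f = 0"
  using indecomposable_ftrace_mult[OF assms(1,3,3)] assms(2) by simp

lemma subgroup_carrier: "subgroup (carrier G) G"
  by (rule subgroupI) auto

text \<open>Every module is projective relative to the whole group, which has index one in itself; a
  subgroup of least order with this property is minimal under inclusion.\<close>

lemma vertex_exists:
  fixes C :: "('a, 'k::field) kG_module"
  assumes C: "indecomposable_module G C"
  shows "\<exists>Q. is_vertex G C Q"
proof -
  note M = indecomposable_kmod[OF C]
  define P where "P = (\<lambda>Q. subgroup Q G \<and> relatively_projective G Q C)"
  have "card (lcosets (carrier G)) * card (carrier G) = card (carrier G)"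
    using l_lagrange[OF fin subgroup_carrier] by (simp add: Coset.order_def)
  moreover have "card (carrier G) \<noteq> 0" using fin one_closed by auto
  ultimately have "card (lcosets (carrier G)) = 1" by simp
  then have "idm C \<in> traces (carrier G) C C" using idm_traces_index[OF M subgroup_carrier] by simp
  then have "P (carrier G)"
    unfolding P_def using relatively_projective_iff[OF M subgroup_carrier] subgroup_carrier by blast
  then obtain Q where Q: "P Q" "\<And>R. P R \<Longrightarrow> card Q \<le> card R"
    using ex_has_least_nat[of P "carrier G" card] by blast
  have "\<not> (subgroup R G \<and> R \<subset> Q \<and> relatively_projective G R C)" for R
  proof
    assume R: "subgroup R G \<and> R \<subset> Q \<and> relatively_projective G R C"
    have "finite Q" using finite_subset[OF subgroup.subset fin] Q(1) by (simp add: P_def)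
    then have "card R < card Q" using R psubset_card_mono by blast
    moreover have "card Q \<le> card R" using Q(2)[of R] R by (simp add: P_def)
    ultimately show False by simp
  qed
  then show ?thesis using Q(1) C by (auto simp: is_vertex_def P_def)
qed

lemma decomposes_idempotents:
  assumes d: "decomposes M Ns i p" and j: "j < length Ns"
  shows "ghom M M (i j * p j)" and "i j * p j * (i j * p j) = i j * p j"
    and "ftrace (i j * p j) = of_nat (mdim (Ns ! j))"
proof -
  show "ghom M M (i j * p j)" using hom_on_comp decomposesD[OF d j] by blast
  have "i j * p j * (i j * p j) = i j * (p j * i j) * p j" by (simp only: mult.assoc)
  then show "i j * p j * (i j * p j) = i j * p j" using decomposesD[OF d j] j by simp
  have "ftrace (i j * p j) = ftrace (p j * i j)" by (rule ftrace_commute)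
  then show "ftrace (i j * p j) = of_nat (mdim (Ns ! j))" using decomposesD(3)[OF d j j] by simp
qed

text \<open>Peirce decomposition of the form: each term is the trace of a round trip
  \<open>N_b \<rightarrow> N_a \<rightarrow> N_b\<close>.\<close>

lemma ftrace_decomposes:
  fixes M :: "('a, 'k::field) kG_module"
  assumes d: "decomposes M Ns i p" and h: "ghom M M h" and f: "ghom M M f"
  shows "ftrace (h * f) = (\<Sum>a<length Ns. \<Sum>b<length Ns. ftrace ((p b * h * i a) * (p a * f * i b)))"
proof -
  have "h * f = h * idm M * f * idm M"
    using hom_on_id_right[OF h] hom_on_id_right[OF f] by (simp add: mult.assoc)
  also have "\<dots> = (\<Sum>a<length Ns. \<Sum>b<length Ns. h * i a * p a * f * i b * p b)"
    unfolding decomposes_sum[OF d, symmetric]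
    by (simp add: sum_distrib_left sum_distrib_right mult.assoc) (rule sum.swap)
  finally have "ftrace (h * f) = (\<Sum>a<length Ns. \<Sum>b<length Ns. ftrace (h * i a * p a * f * i b * p b))"
    by (simp add: ftrace_sum)
  also have "\<dots> = (\<Sum>a<length Ns. \<Sum>b<length Ns. ftrace ((p b * h * i a) * (p a * f * i b)))"
  proof (intro sum.cong refl)
    fix a b
    have "ftrace (h * i a * p a * f * i b * p b) = ftrace (p b * (h * i a * p a * f * i b))"
      by (rule ftrace_commute)
    then show "ftrace (h * i a * p a * f * i b * p b) = ftrace ((p b * h * i a) * (p a * f * i b))"
      by (simp add: mult.assoc)
  qed
  finally show ?thesis .
qed

lemma decomposes_component:
  fixes M :: "('a, 'k::field) kG_module"
  assumes d: "decomposes M Ns i p" and j: "j < length Ns" and M: "kmod M"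
    and N: "indecomposable_module G (Ns ! j)"
  shows "component G (Ns ! j) M"
  unfolding component_def direct_summand_iff[OF indecomposable_kmod[OF N] M]
  using N decomposesD(1,2)[OF d j] decomposesD(3)[OF d j j] by auto

end

lemma length_filter_unique:
  assumes "j < length xs" "P (xs ! j)" "\<And>i. i < length xs \<Longrightarrow> P (xs ! i) \<Longrightarrow> i = j"
  shows "length (filter P xs) = 1"
proof -
  have "{i. i < length xs \<and> P (xs ! i)} = {j}" using assms by blast
  then show ?thesis by (simp add: length_filter_conv_card)
qed

lemma length_filter_uniqueD:
  assumes "length (filter P xs) = 1"
  obtains j where "j < length xs" "P (xs ! j)" "\<And>i. i < length xs \<Longrightarrow> P (xs ! i) \<Longrightarrow> i = j"
proof -
  have "card {i. i < length xs \<and> P (xs ! i)} = 1" using assms by (simp add: length_filter_conv_card)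
  then obtain j where "{i. i < length xs \<and> P (xs ! i)} = {j}" by (auto simp: card_1_singleton_iff)
  then show thesis using that[of j] by blast
qed

section \<open>Non-Sylow subgroups and vertices\<close>

text \<open>The argument \<open>field_type\<close> ties the locale to one field, to which the
  assumption on the characteristic refers.\<close>

locale sylow_setting = finite_group G for G (structure) +
  fixes p :: nat and S :: "'a set" and field_type :: "'k::alg_closed_field itself"
  assumes p: "Factorial_Ring.prime p" and char: "CHAR('k) = p" and S: "sylow_subgroup G p S"
begin

abbreviation "\<F> \<equiv> non_sylow_subgroups G p"
abbreviation "pm \<equiv> Factorial_Ring.multiplicity p (Coset.order G)"

lemma order_pos: "Coset.order G \<noteq> 0"
  using fin one_closed by (auto simp: Coset.order_def)

lemma non_sylow_subgroup: "Q \<in> \<F> \<Longrightarrow> subgroup Q G"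
  by (simp add: non_sylow_subgroups_def)

lemma non_sylow_all: "\<forall>Q\<in>\<F>. subgroup Q G"
  using non_sylow_subgroup by blast

lemma finite_non_sylow: "finite \<F>"
proof -
  have "\<F> \<subseteq> Pow (carrier G)" using non_sylow_subgroup subgroup.subset by blast
  then show ?thesis using fin finite_subset by blast
qed

lemma p_power_subgroup_le:
  assumes "subgroup Q G" "card Q = p ^ a"
  shows "a \<le> pm"
proof -
  have "p ^ a dvd Coset.order G" using l_lagrange[OF fin assms(1)] assms(2) by (metis dvd_triv_right)
  then show ?thesis using order_pos p by (intro multiplicity_geI) auto
qed

lemma non_sylow_card:
  assumes "Q \<in> \<F>"
  obtains a where "card Q = p ^ a" "a < pm"
proof -
  obtain a where a: "card Q = p ^ a" "\<not> sylow_subgroup G p Q" "subgroup Q G"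
    using assms by (auto simp: non_sylow_subgroups_def)
  then have "a \<noteq> pm" by (auto simp: sylow_subgroup_def)
  then show thesis using that[of a] a p_power_subgroup_le[OF a(3,1)] by simp
qed

lemma non_sylowI:
  assumes "subgroup Q G" "card Q dvd p ^ a" "a < pm"
  shows "Q \<in> \<F>"
proof -
  obtain b where b: "b \<le> a" "card Q = p ^ b" using assms(2) divides_primepow_nat[OF p] by blast
  have "p ^ b < p ^ pm" using b(1) assms(3) prime_gt_1_nat[OF p] by (intro power_strict_increasing) auto
  then have "card Q \<noteq> p ^ pm" using b by simp
  then show ?thesis using assms(1) b by (auto simp: non_sylow_subgroups_def sylow_subgroup_def)
qed

lemma sylow_not_non_sylow: "S \<notin> \<F>"
  using S by (simp add: non_sylow_subgroups_def)

lemma sylow: "subgroup S G" "card S = p ^ pm"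
  using S by (auto simp: sylow_subgroup_def)

lemma index_zero_iff: "of_nat n = (0 :: 'k) \<longleftrightarrow> p dvd n"
  using of_nat_eq_0_iff_char_dvd[where 'a = 'k] char by simp

text \<open>The order of the group is divisible by \<open>p ^ pm\<close>, so at least one factor
  \<open>p\<close> is left for the index.\<close>

lemma smaller_index:
  assumes Q: "subgroup Q G" and a: "card Q = p ^ a" "a < pm"
  shows "of_nat (card (lcosets Q)) = (0 :: 'k)"
proof (rule ccontr)
  assume "of_nat (card (lcosets Q)) \<noteq> (0 :: 'k)"
  then have np: "\<not> p dvd card (lcosets Q)" using index_zero_iff by blast
  have o: "card (lcosets Q) * p ^ a = Coset.order G" using l_lagrange[OF fin Q] a by simp
  have "p ^ pm dvd Coset.order G" by (rule multiplicity_dvd)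
  then have "p ^ Suc a dvd card (lcosets Q) * p ^ a" unfolding o
    using a(2) by (meson Suc_leI dvd_trans le_imp_power_dvd)
  then have "p dvd card (lcosets Q)" using prime_gt_0_nat[OF p] by simp
  with np show False by blast
qed

lemma non_sylow_index: "Q \<in> \<F> \<Longrightarrow> of_nat (card (lcosets Q)) = (0 :: 'k)"
  using non_sylow_card smaller_index non_sylow_subgroup by metis

lemma sylow_index: "of_nat (card (lcosets S)) \<noteq> (0 :: 'k)"
proof
  assume "of_nat (card (lcosets S)) = (0 :: 'k)"
  then have "p dvd card (lcosets S)" using index_zero_iff by blast
  then obtain c where c: "card (lcosets S) = p * c" by blast
  have "card (lcosets S) * p ^ pm = Coset.order G" using l_lagrange[OF fin sylow(1)] sylow(2) by simp
  then have "p ^ Suc pm dvd Coset.order G" using c by (metis dvd_triv_left mult.assoc mult.commute power_Suc)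
  then have "Suc pm \<le> pm" using order_pos p by (intro multiplicity_geI) auto
  then show False by simp
qed

lemma conjg_non_sylow:
  assumes Q: "Q \<in> \<F>" and g: "g \<in> carrier G"
  shows "conjg g Q \<in> \<F>"
proof -
  obtain a where a: "card Q = p ^ a" "a < pm" using non_sylow_card[OF Q] .
  have "card (conjg g Q) = p ^ a" using card_conjg[OF subgroup.subset[OF non_sylow_subgroup[OF Q]] g] a by simp
  then show ?thesis using non_sylowI[OF conjg_subgroup[OF non_sylow_subgroup[OF Q] g] _ a(2)] by simp
qed

text \<open>Names the representatives chosen inside \<open>non_sylow_module\<close>, so that they
  can be compared with all of \<open>\<F>\<close> by conjugation.\<close>

definition non_sylow_reps :: "'a set list" where
  "non_sylow_reps = map (\<lambda>K. SOME Q. Q \<in> K) (listing (conjugacy_class G ` \<F>))"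

lemma non_sylow_module_eq: "non_sylow_module G p = direct_sum (map (coset_module G) non_sylow_reps)"
  by (simp add: non_sylow_module_def non_sylow_reps_def comp_def)

lemma some_in_conjugacy_class: "(SOME Q'. Q' \<in> conjugacy_class G Q) \<in> conjugacy_class G Q"
proof (rule someI)
  show "conjg \<one> Q \<in> conjugacy_class G Q" unfolding conjugacy_class_def by blast
qed

lemma listing_classes: "set (listing (conjugacy_class G ` \<F>)) = conjugacy_class G ` \<F>"
  using listing_enumerates[of "conjugacy_class G ` \<F>"] finite_non_sylow by simp

lemma non_sylow_reps_subset: "set non_sylow_reps \<subseteq> \<F>"
proof
  fix Q' assume "Q' \<in> set non_sylow_reps"
  then obtain Q where Q: "Q \<in> \<F>" "Q' = (SOME Q'. Q' \<in> conjugacy_class G Q)"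
    unfolding non_sylow_reps_def by (auto simp: listing_classes)
  then obtain g where "g \<in> carrier G" "Q' = conjg g Q"
    using some_in_conjugacy_class[of Q] by (auto simp: conjugacy_class_def)
  then show "Q' \<in> \<F>" using conjg_non_sylow Q by blast
qed

lemma non_sylow_reps_conj:
  assumes "Q \<in> \<F>"
  obtains g where "g \<in> carrier G" "conjg g Q \<in> set non_sylow_reps"
proof -
  define Q' where "Q' = (SOME Q'. Q' \<in> conjugacy_class G Q)"
  have "Q' \<in> set non_sylow_reps"
    unfolding non_sylow_reps_def Q'_def using assms by (auto simp: listing_classes)
  moreover obtain g where "g \<in> carrier G" "Q' = conjg g Q"
    using some_in_conjugacy_class[of Q] by (auto simp: conjugacy_class_def Q'_def)
  ultimately show thesis using that by blast
qed

text \<open>Higman's criterion for the whole family. Traces from a subgroup are traces from its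
  conjugates, so one representative serves its class.\<close>

lemma non_sylow_projective_iff:
  fixes W :: "('a, 'k) kG_module"
  assumes W: "kmod W"
  shows "module_projective G (non_sylow_module G p) W \<longleftrightarrow> idm W \<in> tideal \<F> W W"
proof
  have reps: "\<forall>Q\<in>set non_sylow_reps. subgroup Q G"
    using non_sylow_reps_subset non_sylow_subgroup by blast
  show "module_projective G (non_sylow_module G p) W \<Longrightarrow> idm W \<in> tideal \<F> W W"
    unfolding non_sylow_module_eq
    using module_projective_tideal[OF reps finite_non_sylow non_sylow_reps_subset non_sylow_all W] .
  assume "idm W \<in> tideal \<F> W W"
  then obtain z where z: "idm W = sum z \<F>" "\<forall>Q\<in>\<F>. z Q \<in> traces Q W W" by (auto simp: tideal_def)
  have "\<exists>Q'\<in>set non_sylow_reps. z Q \<in> traces Q' W W" if Q: "Q \<in> \<F>" for Q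
  proof -
    obtain g where g: "g \<in> carrier G" "conjg g Q \<in> set non_sylow_reps" using non_sylow_reps_conj[OF Q] .
    have "z Q \<in> traces (conjg g Q) W W"
      using traces_conjg[OF W W non_sylow_subgroup[OF Q] g(1)] z(2) Q by blast
    then show ?thesis using g(2) by blast
  qed
  then show "module_projective G (non_sylow_module G p) W"
    unfolding non_sylow_module_eq using module_projectiveI[OF reps W z(1)] by blast
qed

text \<open>The identity is a trace from some non-Sylow \<open>Q\<close>. Comparison with the vertex
  \<open>R\<close> gives a subgroup of \<open>R\<close> of order dividing that of \<open>Q\<close>,
  and minimality of \<open>R\<close> makes it equal to \<open>R\<close>.\<close>

lemma vertex_non_sylow:
  fixes C :: "('a, 'k) kG_module"
  assumes v: "is_vertex G C R" and C: "idm C \<in> tideal \<F> C C"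
  shows "R \<in> \<F>"
proof -
  have ind: "indecomposable_module G C" and R: "subgroup R G" and rp: "relatively_projective G R C"
    and min: "\<And>K. subgroup K G \<Longrightarrow> K \<subset> R \<Longrightarrow> \<not> relatively_projective G K C"
    using v by (auto simp: is_vertex_def)
  note M = indecomposable_kmod[OF ind]
  obtain Q where Q: "Q \<in> \<F>" "idm C \<in> traces Q C C"
    using indecomposable_tideal[OF ind finite_non_sylow non_sylow_all C] by blast
  have "idm C \<in> traces R C C" using relatively_projective_iff[OF M R] rp by blast
  then obtain K where K: "subgroup K G" "K \<subseteq> R" "card K dvd card Q" "idm C \<in> traces K C C"
    using indecomposable_two_traces[OF ind non_sylow_subgroup[OF Q(1)] Q(2) R] by blast
  have "relatively_projective G K C" using relatively_projective_iff[OF M K(1)] K(4) by blast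
  then have "K = R" using min[OF K(1)] K(2) by blast
  obtain a where "card Q = p ^ a" "a < pm" using non_sylow_card[OF Q(1)] .
  then show ?thesis using non_sylowI[OF R] K(3) \<open>K = R\<close> by simp
qed

text \<open>The index of \<open>S\<close> is invertible in \<open>k\<close>, so \<open>N\<close> is
  projective relative to \<open>S\<close>. A relative trace from a proper subgroup of
  \<open>S\<close> has matrix trace zero, whereas the identity has trace
  \<open>dim N\<close>.\<close>

lemma sylow_vertexI:
  fixes N :: "('a, 'k) kG_module"
  assumes N: "indecomposable_module G N" and d: "of_nat (mdim N) \<noteq> (0 :: 'k)"
  shows "is_vertex G N S"
proof -
  note M = indecomposable_kmod[OF N]
  have "relatively_projective G S N"
    using relatively_projective_iff[OF M sylow(1)] idm_traces_index[OF M sylow(1) sylow_index] by blast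
  moreover have "\<not> relatively_projective G R N" if R: "subgroup R G" "R \<subset> S" for R
  proof
    assume "relatively_projective G R N"
    then have "idm N \<in> traces R N N" using relatively_projective_iff[OF M R(1)] by blast
    then obtain c where c: "ftrace (idm N) = of_nat (card (lcosets R)) * c"
      using ftrace_traces[OF M R(1)] by blast
    have fS: "finite S" using sylow(1) subgroup.subset fin finite_subset by blast
    interpret GS: group "G\<lparr>carrier := S\<rparr>"
      using subgroup.subgroup_is_group[OF sylow(1) group_axioms] .
    have "subgroup R (G\<lparr>carrier := S\<rparr>)" using subgroup_incl[OF R(1) sylow(1)] R(2) by blast
    from GS.l_lagrange[OF _ this] have "card (lcosets\<^bsub>G\<lparr>carrier := S\<rparr>\<^esub> R) * card R = card S"
      using fS by (simp add: Coset.order_def)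
    then have "card R dvd p ^ pm" using sylow(2) by (metis dvd_triv_right)
    then obtain a where a: "a \<le> pm" "card R = p ^ a" using divides_primepow_nat[OF p] by blast
    have "card R < card S" using psubset_card_mono[OF fS R(2)] .
    then have "a \<noteq> pm" using a sylow(2) by auto
    then have "of_nat (card (lcosets R)) = (0 :: 'k)" using smaller_index[OF R(1) a(2)] a(1) by simp
    then show False using c d by simp
  qed
  ultimately show ?thesis using N sylow(1) by (auto simp: is_vertex_def)
qed

lemma group_action_kmod:
  fixes \<phi> :: "'a \<Rightarrow> nat \<Rightarrow> nat"
  assumes "group_action G {..<n} \<phi>"
  shows "kmod (perm_module [0..<n] \<phi>)"
proof -
  interpret A: group_action G "{..<n}" \<phi> by fact
  have set: "set [0..<n] = {..<n}" by auto
  show ?thesis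
  proof (rule kmod_perm_module, unfold set)
    fix g x assume g: "g \<in> carrier G" and x: "x \<in> {..<n}"
    show "\<phi> g x \<in> {..<n}" using A.element_image[OF g x] by blast
    fix h assume h: "h \<in> carrier G"
    show "\<phi> (g \<otimes> h) x = \<phi> g (\<phi> h x)" using A.composition_rule[OF x g h] .
  next
    fix x assume x: "x \<in> {..<n}"
    have "(\<lambda>x\<in>{..<n}. x) x = \<phi> \<one> x" using A.id_eq_one by simp
    then show "\<phi> \<one> x = x" using x by simp
  qed simp
qed

lemma direct_summand_trans:
  fixes A B C :: "('a, 'k) kG_module"
  assumes A: "kmod A" and B: "kmod B" and C: "kmod C" and AB: "direct_summand G A B" and BC: "direct_summand G B C"
  shows "direct_summand G A C"
proof -
  obtain i q where iq: "ghom A B i" "ghom B A q" "q * i = idm A" using AB direct_summand_iff[OF A B] by blast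
  obtain j r where jr: "ghom B C j" "ghom C B r" "r * j = idm B" using BC direct_summand_iff[OF B C] by blast
  have "q * r * (j * i) = q * (r * j) * i" by (simp only: mult.assoc)
  also have "\<dots> = idm A" using hom_on_id_right[OF iq(2)] iq(3) by (simp add: jr)
  finally show ?thesis
    unfolding direct_summand_iff[OF A C] using hom_on_comp[OF jr(1) iq(1)] hom_on_comp[OF iq(2) jr(2)] by blast
qed

lemma component_tideal:
  fixes C W :: "('a, 'k) kG_module"
  assumes C: "component G C W" and W: "kmod W" and WF: "idm W \<in> tideal \<F> W W"
  shows "idm C \<in> tideal \<F> C C"
proof -
  have K: "kmod C" using C indecomposable_kmod by (auto simp: component_def)
  obtain i q where iq: "ghom C W i" "ghom W C q" "q * i = idm C"
    using C direct_summand_iff[OF K W] by (auto simp: component_def)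
  have "q * idm W * i \<in> tideal \<F> C C"
    using tideal_comp_right[OF K W K non_sylow_all tideal_comp_left[OF W W K non_sylow_all WF iq(2)] iq(1)] .
  then show ?thesis using hom_on_id_right[OF iq(2)] iq(3) by simp
qed

text \<open>Each component has a vertex in \<open>\<F>\<close>, so its identity is a trace from
  there; inclusions and projections carry these traces to \<open>W\<close>.\<close>

lemma non_sylow_vertices_tideal:
  fixes W :: "('a, 'k) kG_module"
  assumes W: "kmod W" and v: "\<And>C Q. component G C W \<Longrightarrow> is_vertex G C Q \<Longrightarrow> Q \<in> \<F>"
  shows "idm W \<in> tideal \<F> W W"
proof -
  obtain Ns i q where Ns: "\<forall>N\<in>set Ns. indecomposable_module G N" and d: "decomposes W Ns i q"
    using decomposition_exists[OF W] by blast
  have "i j * q j \<in> tideal \<F> W W" if j: "j < length Ns" for j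
  proof -
    have N: "indecomposable_module G (Ns ! j)" using Ns j by simp
    note K = indecomposable_kmod[OF N]
    obtain Q where Q: "is_vertex G (Ns ! j) Q" using vertex_exists[OF N] by blast
    have QF: "Q \<in> \<F>" using v[OF decomposes_component[OF d j W N] Q] .
    have "idm (Ns ! j) \<in> traces Q (Ns ! j) (Ns ! j)"
      using relatively_projective_iff[OF K non_sylow_subgroup[OF QF]] Q by (simp add: is_vertex_def)
    then have "idm (Ns ! j) \<in> tideal \<F> (Ns ! j) (Ns ! j)" using traces_tideal[OF finite_non_sylow QF] by blast
    then have "i j * idm (Ns ! j) * q j \<in> tideal \<F> W W"
      using tideal_comp_right[OF W K W non_sylow_all tideal_comp_left[OF K K W non_sylow_all]] decomposesD(1,2)[OF d j] by blast
    then show ?thesis unfolding decomposesD(4)[OF d j] .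
  qed
  then show ?thesis
    unfolding decomposes_sum[OF d, symmetric] using tideal_sum[of "{..<length Ns}" "\<lambda>j. i j * q j" \<F> W W] by simp
qed

section \<open>The two implications\<close>

lemma strongly_capped_imp:
  fixes M :: "('a, 'k) kG_module"
  assumes sc: "strongly_capped G p M"
  shows "dade_module G p M \<and> capped G S M \<and> (\<exists>C. is_cap G p S C M \<and> occurs_with_multiplicity G C M 1)"
proof -
  let ?E = "End_module G M"
  have M: "kmod M" using sc by (simp add: strongly_capped_def endo_p_permutation_def)
  have E: "kmod ?E" using kmod_End_module[OF M] .
  obtain W where W: "kmod W" "module_projective G (non_sylow_module G p) W"
    and iso: "kG_iso G ?E (direct_sum [trivial_module 1, W])"
    using sc by (auto simp: strongly_capped_def)
  have WF: "idm W \<in> tideal \<F> W W" using non_sylow_projective_iff[OF W(1)] W(2) by blast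
  \<comment> \<open>\<open>W\<close> is a summand of \<open>End(M)\<close>, which is a summand of a
    permutation module by hypothesis.\<close>
  have "p_permutation G W"
  proof -
    obtain n \<phi> where \<phi>: "group_action G {..<n::nat} \<phi>" "direct_summand G ?E (perm_module [0..<n] \<phi>)"
      using sc by (auto simp: strongly_capped_def endo_p_permutation_def p_permutation_def)
    have P: "kmod (perm_module [0..<n] \<phi> :: ('a, 'k) kG_module)" using group_action_kmod[OF \<phi>(1)] .
    obtain i q where ip: "decomposes ?E [trivial_module 1, W] i q"
      using iso kG_iso_direct_sum_iff[OF E, of "[trivial_module 1, W]"] W(1) kmod_trivial_module by auto
    have "direct_summand G W ?E"
      unfolding direct_summand_iff[OF W(1) E]
      using decomposesD[OF ip, of 1] by (intro exI[of _ "i 1"] exI[of _ "q 1"]) simp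
    then have "direct_summand G W (perm_module [0..<n] \<phi>)" using direct_summand_trans[OF W(1) E P _ \<phi>(2)] by blast
    then show ?thesis using \<phi>(1) by (auto simp: p_permutation_def)
  qed
  moreover have "\<forall>C Q. component G C W \<and> is_vertex G C Q \<longrightarrow> Q \<in> \<F>"
    using component_tideal[OF _ W(1) WF] vertex_non_sylow by blast
  ultimately have dade: "dade_module G p M" using M iso by (auto simp: dade_module_def)
  obtain y \<phi> t where split: "End_split \<F> M 1 y \<phi> t"
    using End_split_exists[OF M W(1) non_sylow_all WF iso] by blast
  obtain Ns i q where Ns: "\<forall>N\<in>set Ns. indecomposable_module G N" and d: "decomposes M Ns i q"
    using decomposition_exists[OF M] by blast
  have ind: "indecomposable_module G (Ns ! j)" if "j < length Ns" for j using Ns that by simp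
  obtain f h where fh: "ghom M M f" "ghom M M h" "ftrace (h * f) \<noteq> 0"
    using trace_form_nonzero[OF M non_sylow_all non_sylow_index split] by auto
  \<comment> \<open>If all dimensions vanished in \<open>k\<close>, every term of the Peirce
    decomposition would be zero, although the form is not.\<close>
  have "\<exists>j<length Ns. of_nat (mdim (Ns ! j)) \<noteq> (0 :: 'k)"
  proof (rule ccontr)
    assume neg: "\<not> ?thesis"
    have "ftrace ((q b * h * i a) * (q a * f * i b)) = 0" if ab: "a < length Ns" "b < length Ns" for a b
    proof (rule ftrace_zero_of_dim[OF ind[OF ab(2)]])
      show "of_nat (mdim (Ns ! b)) = (0 :: 'k)" using neg ab(2) by blast
      show "ghom (Ns ! b) (Ns ! b) ((q b * h * i a) * (q a * f * i b))"
        using decomposesD(1,2)[OF d ab(1)] decomposesD(1,2)[OF d ab(2)] fh by (intro hom_on_comp)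
    qed
    then show False using fh(3) unfolding ftrace_decomposes[OF d fh(2,1)] by simp
  qed
  then obtain j where j: "j < length Ns" "of_nat (mdim (Ns ! j)) \<noteq> (0 :: 'k)" by blast
  \<comment> \<open>For the projections \<open>?e\<close> and \<open>?e'\<close> onto two such
    summands, \<open>?e * ?e' = 0\<close>, so their minor would be the product of the two
    dimensions, which is nonzero.\<close>
  have unique: "l = j" if l: "l < length Ns" "of_nat (mdim (Ns ! l)) \<noteq> (0 :: 'k)" for l
  proof (rule ccontr)
    assume lj: "l \<noteq> j"
    let ?e = "i j * q j" and ?e' = "i l * q l"
    note e = decomposes_idempotents[OF d j(1)] and e' = decomposes_idempotents[OF d l(1)]
    have "?e * ?e' = i j * (q j * i l) * q l" by (simp only: mult.assoc)
    then have 0: "?e * ?e' = 0" using decomposesD(3)[OF d j(1) l(1)] lj by simp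
    have "ftrace (?e * ?e) * ftrace (?e' * ?e') = ftrace (?e * ?e') * ftrace (?e' * ?e)"
      using trace_form_rank_one[OF M non_sylow_all non_sylow_index split refl e(1) e'(1) e(1) e'(1)] by simp
    then show False using 0 e e' j(2) l(2) by simp
  qed
  define C where "C = Ns ! j"
  have C: "indecomposable_module G C" unfolding C_def using ind[OF j(1)] .
  have comp: "component G C M" unfolding C_def using decomposes_component[OF d j(1) M ind[OF j(1)]] .
  have vert: "is_vertex G C S" unfolding C_def using sylow_vertexI[OF ind[OF j(1)] j(2)] .
  have capped: "capped G S M" using comp vert by (auto simp: capped_def)
  \<comment> \<open>A summand isomorphic to \<open>C\<close> has the same dimension, which is
    nonzero in \<open>k\<close>, so it sits at index \<open>j\<close>.\<close>
  have "length (filter (kG_iso G C) Ns) = 1"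
  proof (rule length_filter_unique[OF j(1)])
    show "kG_iso G C (Ns ! j)" using kG_iso_refl[OF indecomposable_kmod[OF C]] by (simp add: C_def)
    fix l assume "l < length Ns" "kG_iso G C (Ns ! l)"
    then show "l = j" using unique kG_iso_mdim j(2) by (metis C_def)
  qed
  moreover have "kG_iso G M (direct_sum Ns)"
    using kG_iso_direct_sum_iff[OF M, of Ns] d Ns indecomposable_kmod by blast
  ultimately have "occurs_with_multiplicity G C M 1"
    using Ns by (auto simp: occurs_with_multiplicity_def)
  then show ?thesis using dade capped comp vert by (auto simp: is_cap_def)
qed

lemma imp_strongly_capped:
  fixes M :: "('a, 'k) kG_module"
  assumes endo: "endo_p_permutation G M" and dade: "dade_module G p M"
    and vert: "is_vertex G C S" and occ: "occurs_with_multiplicity G C M 1"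
  shows "strongly_capped G p M"
proof -
  let ?E = "End_module G M"
  have M: "kmod M" using endo by (simp add: endo_p_permutation_def)
  obtain n W where pW: "p_permutation G W"
    and vW: "\<forall>C Q. component G C W \<and> is_vertex G C Q \<longrightarrow> Q \<in> \<F>"
    and iso: "kG_iso G ?E (direct_sum [trivial_module n, W])"
    using dade by (auto simp: dade_module_def)
  have W: "kmod W" using pW by (auto simp: p_permutation_def direct_summand_def)
  have WF: "idm W \<in> tideal \<F> W W" using non_sylow_vertices_tideal[OF W] vW by blast
  obtain y \<phi> t where split: "End_split \<F> M n y \<phi> t"
    using End_split_exists[OF M W non_sylow_all WF iso] by blast
  obtain Ns where Ns: "\<forall>N\<in>set Ns. indecomposable_module G N" "kG_iso G M (direct_sum Ns)"
    and one: "length (filter (kG_iso G C) Ns) = 1"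
    using occ by (auto simp: occurs_with_multiplicity_def)
  have ind: "indecomposable_module G (Ns ! j)" if "j < length Ns" for j using Ns that by simp
  obtain i q where d: "decomposes M Ns i q"
    using kG_iso_direct_sum_iff[OF M, of Ns] Ns indecomposable_kmod by blast
  obtain j where j: "j < length Ns" "kG_iso G C (Ns ! j)"
    and unique: "\<And>l. l < length Ns \<Longrightarrow> kG_iso G C (Ns ! l) \<Longrightarrow> l = j"
    using length_filter_uniqueD[OF one] by blast
  have C: "indecomposable_module G C" using vert by (simp add: is_vertex_def)
  note K = indecomposable_kmod[OF C] and N = indecomposable_kmod[OF ind[OF j(1)]]
  obtain u v where uv: "ghom C (Ns ! j) u" "ghom (Ns ! j) C v" "v * u = idm C" "u * v = idm (Ns ! j)"
    using kG_iso_iff[OF K N] j(2) by blast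
  \<comment> \<open>Otherwise the identity of \<open>C\<close> would lie in the trace ideal, and its
    vertex \<open>S\<close> would be non-Sylow.\<close>
  have not_proj: "i j * q j \<notin> tideal \<F> M M"
  proof
    assume "i j * q j \<in> tideal \<F> M M"
    then have "v * q j * (i j * q j) * (i j * u) \<in> tideal \<F> C C"
      using tideal_comp_right[OF K M K non_sylow_all tideal_comp_left[OF M M K non_sylow_all]]
        hom_on_comp[OF uv(2) decomposesD(2)[OF d j(1)]] hom_on_comp[OF decomposesD(1)[OF d j(1)] uv(1)] by blast
    moreover have "v * q j * (i j * q j) * (i j * u) = v * (q j * i j) * (q j * i j) * u"
      by (simp only: mult.assoc)
    ultimately have "v * u \<in> tideal \<F> C C"
      using decomposesD(3)[OF d j(1) j(1)] hom_on_id_right[OF uv(2)] by simp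
    then show False using vertex_non_sylow[OF vert] sylow_not_non_sylow uv(3) by simp
  qed
  note e = decomposes_idempotents[OF d]
  have dimj: "of_nat (mdim (Ns ! j)) \<noteq> (0 :: 'k)"
  proof
    assume z: "of_nat (mdim (Ns ! j)) = (0 :: 'k)"
    have "ftrace (h * (i j * q j * f * (i j * q j))) = 0" if fh: "ghom M M f" "ghom M M h" for f h
    proof -
      have "ftrace (h * (i j * q j * f * (i j * q j))) = ftrace (h * i j * q j * f * i j * q j)"
        by (simp only: mult.assoc)
      also have "\<dots> = ftrace (q j * (h * i j * q j * f * i j))" by (rule ftrace_commute)
      also have "\<dots> = 0"
      proof (rule ftrace_zero_of_dim[OF ind[OF j(1)] z])
        show "ghom (Ns ! j) (Ns ! j) (q j * (h * i j * q j * f * i j))"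
          using decomposesD(1,2)[OF d j(1)] fh by (intro hom_on_comp)
      qed
      finally show ?thesis .
    qed
    then have "i j * q j \<in> tideal \<F> M M"
      using corner_idempotent_tideal[OF M non_sylow_all non_sylow_index split e(1,2)[OF j(1)]] by blast
    then show False using not_proj by blast
  qed
  \<comment> \<open>Multiplicity one enters here: a nonzero pairing would make \<open>Ns ! l\<close>
    isomorphic to the cap. Hence the form vanishes on this corner and the product of the two
    dimensions is zero in \<open>k\<close>.\<close>
  have dim0: "of_nat (mdim (Ns ! l)) = (0 :: 'k)" if l: "l < length Ns" "l \<noteq> j" for l
  proof -
    have "ftrace (h * (i j * q j * f * (i l * q l))) = 0" if fh: "ghom M M f" "ghom M M h" for f h
    proof (rule ccontr)
      assume nz: "ftrace (h * (i j * q j * f * (i l * q l))) \<noteq> 0"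
      have "ftrace (h * (i j * q j * f * (i l * q l))) = ftrace (h * i j * (q j * f * i l * q l))"
        by (simp only: mult.assoc)
      also have "\<dots> = ftrace (q j * f * i l * q l * (h * i j))" by (rule ftrace_commute)
      also have "\<dots> = ftrace ((q j * f * i l) * (q l * h * i j))" by (simp only: mult.assoc)
      finally have tr: "ftrace ((q j * f * i l) * (q l * h * i j)) \<noteq> 0" using nz by simp
      have a: "ghom (Ns ! l) (Ns ! j) (q j * f * i l)" "ghom (Ns ! j) (Ns ! l) (q l * h * i j)"
        using decomposesD(1,2)[OF d j(1)] decomposesD(1,2)[OF d l(1)] fh by (auto intro: hom_on_comp)
      have "kG_iso G (Ns ! j) (Ns ! l)" using kG_iso_of_trace[OF ind[OF j(1)] ind[OF l(1)] a tr] .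
      moreover note L = indecomposable_kmod[OF ind[OF l(1)]]
      ultimately obtain r s where rs: "ghom (Ns ! j) (Ns ! l) r" "ghom (Ns ! l) (Ns ! j) s"
        "s * r = idm (Ns ! j)" "r * s = idm (Ns ! l)" using kG_iso_iff[OF N L] by blast
      have "v * s * (r * u) = v * (s * r) * u" "r * u * (v * s) = r * (u * v) * s" by (simp_all only: mult.assoc)
      then have "v * s * (r * u) = idm C" "r * u * (v * s) = idm (Ns ! l)"
        using rs uv hom_on_id_right[OF uv(2)] hom_on_id_right[OF rs(1)] by simp_all
      then have "kG_iso G C (Ns ! l)"
        unfolding kG_iso_iff[OF K L] using hom_on_comp[OF rs(1) uv(1)] hom_on_comp[OF uv(2) rs(2)] by blast
      then show False using unique l by blast
    qed
    then have "ftrace (i l * q l) * ftrace (i j * q j) = 0"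
      using corner_trace_zero[OF M non_sylow_all non_sylow_index split e(1,2)[OF j(1)] e(1,2)[OF l(1)]] by blast
    then show ?thesis using e(3)[OF j(1)] e(3)[OF l(1)] dimj by simp
  qed
  \<comment> \<open>Only the block \<open>(j, j)\<close> survives, and there the trace identity for
    indecomposable modules shows that a nonzero multiple of the form has rank at most one.\<close>
  have tr: "of_nat (mdim (Ns ! j)) * ftrace (h * f) = ftrace (q j * h * i j) * ftrace (q j * f * i j)"
    if fh: "ghom M M f" "ghom M M h" for f h
  proof -
    have zero: "ftrace ((q b * h * i a) * (q a * f * i b)) = 0"
      if ab: "a < length Ns" "b < length Ns" "a \<noteq> j \<or> b \<noteq> j" for a b
    proof -
      have g: "ghom (Ns ! a) (Ns ! b) (q b * h * i a)" "ghom (Ns ! b) (Ns ! a) (q a * f * i b)"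
        using decomposesD(1,2)[OF d ab(1)] decomposesD(1,2)[OF d ab(2)] fh by (auto intro: hom_on_comp)
      show ?thesis
      proof (cases "b = j")
        case False
        then show ?thesis using ftrace_zero_of_dim[OF ind[OF ab(2)] dim0[OF ab(2)] hom_on_comp[OF g]] by simp
      next
        case True
        then have "a \<noteq> j" using ab(3) by simp
        then have "ftrace ((q a * f * i b) * (q b * h * i a)) = 0"
          using ftrace_zero_of_dim[OF ind[OF ab(1)] dim0[OF ab(1)] hom_on_comp[OF g(2,1)]] by simp
        then show ?thesis using ftrace_commute by metis
      qed
    qed
    have "ftrace (h * f) = (\<Sum>a<length Ns. \<Sum>b<length Ns.
      if a = j then (if b = j then ftrace ((q j * h * i j) * (q j * f * i j)) else 0) else 0)"
      unfolding ftrace_decomposes[OF d fh(2,1)]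
    proof (intro sum.cong refl)
      fix a b assume "a \<in> {..<length Ns}" "b \<in> {..<length Ns}"
      then show "ftrace ((q b * h * i a) * (q a * f * i b))
        = (if a = j then (if b = j then ftrace ((q j * h * i j) * (q j * f * i j)) else 0) else 0)"
        using zero[of a b] by auto
    qed
    also have "\<dots> = (\<Sum>a<length Ns. if a = j then (\<Sum>b<length Ns. if b = j then ftrace ((q j * h * i j) * (q j * f * i j)) else 0) else 0)"
      by (intro sum.cong) auto
    also have "\<dots> = ftrace ((q j * h * i j) * (q j * f * i j))" using j(1) by simp
    finally show ?thesis
      using indecomposable_ftrace_mult[OF ind[OF j(1)], of "q j * h * i j" "q j * f * i j"]
        hom_on_comp[OF hom_on_comp[OF decomposesD(2)[OF d j(1)] fh(2)] decomposesD(1)[OF d j(1)]]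
        hom_on_comp[OF hom_on_comp[OF decomposesD(2)[OF d j(1)] fh(1)] decomposesD(1)[OF d j(1)]] by simp
  qed
  have "n = 1"
  proof -
    have "n \<noteq> 0"
    proof
      assume "n = 0"
      then have "ftrace (i j * q j * (i j * q j)) = 0"
        using trace_form_zero[OF M non_sylow_all non_sylow_index split _ e(1)[OF j(1)] e(1)[OF j(1)]] by blast
      then show False using e(2,3)[OF j(1)] dimj by simp
    qed
    moreover have "\<not> 2 \<le> n"
    proof
      assume "2 \<le> n"
      then obtain f f' h h' where fh: "ghom M M f" "ghom M M f'" "ghom M M h" "ghom M M h'"
        and ne: "ftrace (h * f) * ftrace (h' * f') \<noteq> ftrace (h * f') * ftrace (h' * f)"
        using trace_form_rank_ge_two[OF M non_sylow_all non_sylow_index split] by blast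
      \<comment> \<open>Each trace in the minor is scaled by \<open>?m\<close>, which makes the rank
        one formula applicable; the factor is nonzero and cancels.\<close>
      let ?m = "of_nat (mdim (Ns ! j)) :: 'k"
      have "(?m * ftrace (h * f)) * (?m * ftrace (h' * f')) = (?m * ftrace (h * f')) * (?m * ftrace (h' * f))"
        unfolding tr[OF fh(1,3)] tr[OF fh(2,4)] tr[OF fh(2,3)] tr[OF fh(1,4)] by simp
      then have "?m * ?m * (ftrace (h * f) * ftrace (h' * f')) = ?m * ?m * (ftrace (h * f') * ftrace (h' * f))"
        by (simp only: mult_ac)
      then show False using ne dimj by simp
    qed
    ultimately show ?thesis by linarith
  qed
  then show ?thesis
    unfolding strongly_capped_def using endo W non_sylow_projective_iff[OF W] WF iso by blast
qed

end

theorem lemma3p9: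
  fixes G :: "('g, 'b) monoid_scheme"
    and p :: nat
    and S :: "'g set"
    and M :: "('g, 'k::alg_closed_field) kG_module"
  assumes "group G" and "finite (carrier G)"
    and "Factorial_Ring.prime p" and "CHAR('k) = p"
    and "sylow_subgroup G p S"
    and "endo_p_permutation G M"
  shows "strongly_capped G p M \<longleftrightarrow>
    dade_module G p M \<and> capped G S M \<and>
    (\<exists>C. is_cap G p S C M \<and> occurs_with_multiplicity G C M 1)"
proof -
  interpret sylow_setting G p S "TYPE('k)"
    using assms by (simp add: sylow_setting_def sylow_setting_axioms_def finite_group_def finite_group_axioms_def)
  show ?thesis
    using strongly_capped_imp[of M] imp_strongly_capped[OF assms(6)] by (auto simp: is_cap_def)
qed

end
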